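(* Let $(U,\Sigma,\mu)$ be a $\sigma$-finite measure space with a full ordered core $\mathcal A$. Then $(\widetilde{L^1_\mu},L^\infty_\mu)$ is an exact Calder\'on couple.
   Context: Functions equal $\mu$-a.e. are identified. An ordered core of $(U,\Sigma,\mu)$ is a subset $\mathcal A\subseteq\Sigma$, totally ordered by inclusion, containing $\emptyset$, whose members all have finite $\mu$-measure. It is $\sigma$-bounded if $\bigcup\mathcal A=\bigcup\mathcal A_0$ for some countable $\mathcal A_0\subseteq\mathcal A$, and full if it is $\sigma$-bounded and $\bigcup\mathcal A=U$. $\sigma(\mathcal A)$ is the $\sigma$-ring generated by $\mathcal A$ (a $\sigma$-algebra on $U$ when $\mathcal A$ is full). Write $u\le_{\mathcal A}v$ if for all $A\in\mathcal A$, $v\in A$ implies $u\in A$. $L^\downarrow(\mathcal A)$ is the set of core decreasing functions: $\sigma(\mathcal A)$-measurable $f:U\to[0,\infty]$ with $f(u)\ge f(v)$ whenever $u\le_{\mathcal A}v$. A least core decreasing majorant of a $\Sigma$-measurable $g:U\to[-\infty,\infty]$ is a $\widetilde g\in L^\downarrow(\mathcal A)$ with $|g|\le\widetilde g$ $\mu$-a.e. and such that $\widetilde g\le h$ $\mu$-a.e. for every $h\in L^\downarrow(\mathcal A)$ with $|g|\le h$ $\mu$-a.e. (it exists and is unique $\mu$-a.e.). $\widetilde{L^1_\mu}$ is the Banach space of $\Sigma$-measurable $g$ with $\widetilde g\in L^1_\mu$, normed by $\|g\|_{\widetilde{L^1_\mu}}=\|\widetilde g\|_{L^1_\mu}$.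 For a compatible couple $(X_0,X_1)$ of Banach spaces, $K(f,t;X_0,X_1)=\inf\{\|f_0\|_{X_0}+t\|f_1\|_{X_1}:f_0+f_1=f\}$ for $f\in X_0+X_1$, $t>0$. An admissible contraction from $(X_0,X_1)$ to itself is a linear map on $X_0+X_1$ whose restriction to each $X_j$ is a bounded map $X_j\to X_j$ of norm at most $1$, $j=0,1$. The couple is an exact Calder\'on couple if whenever $f,g\in X_0+X_1$ satisfy $K(f,t;X_0,X_1)\le K(g,t;X_0,X_1)$ for all $t>0$, there is an admissible contraction from $(X_0,X_1)$ to itself that maps $g$ to $f$. *)

theory Defs
  imports "HOL-Probability.Essential_Supremum"
begin

section \<open>Ordered cores\<close>

definition ordered_core :: "'a measure \<Rightarrow> 'a set set \<Rightarrow> bool" where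
  "ordered_core M \<A> \<longleftrightarrow>
     \<A> \<subseteq> sets M \<and> {} \<in> \<A> \<and>
     (\<forall>A\<in>\<A>. \<forall>B\<in>\<A>. A \<subseteq> B \<or> B \<subseteq> A) \<and>
     (\<forall>A\<in>\<A>. emeasure M A < \<infinity>)"

definition sigma_bounded_core :: "'a set set \<Rightarrow> bool" where
  "sigma_bounded_core \<A> \<longleftrightarrow> (\<exists>\<A>0\<subseteq>\<A>. countable \<A>0 \<and> \<Union>\<A> = \<Union>\<A>0)"

definition full_ordered_core :: "'a measure \<Rightarrow> 'a set set \<Rightarrow> bool" where
  "full_ordered_core M \<A> \<longleftrightarrow>
     ordered_core M \<A> \<and> sigma_bounded_core \<A> \<and> \<Union>\<A> = space M"

inductive_set sigma_ring_sets :: "'a set set \<Rightarrow> 'a set set" for \<A> :: "'a set set" where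
  Empty: "{} \<in> sigma_ring_sets \<A>"
| Basic: "A \<in> \<A> \<Longrightarrow> A \<in> sigma_ring_sets \<A>"
| Diff: "A \<in> sigma_ring_sets \<A> \<Longrightarrow> B \<in> sigma_ring_sets \<A> \<Longrightarrow> A - B \<in> sigma_ring_sets \<A>"
| Union: "(\<And>i::nat. E i \<in> sigma_ring_sets \<A>) \<Longrightarrow> (\<Union>i. E i) \<in> sigma_ring_sets \<A>"

definition core_le :: "'a set set \<Rightarrow> 'a \<Rightarrow> 'a \<Rightarrow> bool" where
  "core_le \<A> u v \<longleftrightarrow> (\<forall>A\<in>\<A>. v \<in> A \<longrightarrow> u \<in> A)"

text \<open>The measurability clause is meant for full cores, for which the generated sigma-ring
  contains \<open>space M\<close> and hence is a sigma-algebra on it.\<close>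

definition core_decreasing :: "'a measure \<Rightarrow> 'a set set \<Rightarrow> ('a \<Rightarrow> ennreal) set" where
  "core_decreasing M \<A> =
     {f. (\<forall>B\<in>sets borel. f -` B \<inter> space M \<in> sigma_ring_sets \<A>) \<and>
         (\<forall>u\<in>space M. \<forall>v\<in>space M. core_le \<A> u v \<longrightarrow> f v \<le> f u)}"

definition least_core_decreasing_majorant ::
    "'a measure \<Rightarrow> 'a set set \<Rightarrow> ('a \<Rightarrow> ereal) \<Rightarrow> ('a \<Rightarrow> ennreal) \<Rightarrow> bool" where
  "least_core_decreasing_majorant M \<A> g G \<longleftrightarrow>
     G \<in> core_decreasing M \<A> \<and>
     (AE u in M. \<bar>g u\<bar> \<le> enn2ereal (G u)) \<and>
     (\<forall>h\<in>core_decreasing M \<A>.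
        (AE u in M. \<bar>g u\<bar> \<le> enn2ereal (h u)) \<longrightarrow> (AE u in M. G u \<le> h u))"

text \<open>The majorant is unique up to null sets, so the choice does not matter below.\<close>

definition core_tilde :: "'a measure \<Rightarrow> 'a set set \<Rightarrow> ('a \<Rightarrow> ereal) \<Rightarrow> 'a \<Rightarrow> ennreal" where
  "core_tilde M \<A> g = (SOME G. least_core_decreasing_majorant M \<A> g G)"

section \<open>Banach spaces of functions modulo null sets\<close>

text \<open>A space of classes of functions modulo equality almost everywhere is represented by the
  set of all measurable real-valued representatives of its members, together with the norm as a
  function of the representative.\<close>

record 'a fun_space =
  elems :: "('a \<Rightarrow> real) set"
  fnorm :: "('a \<Rightarrow> real) \<Rightarrow> real"

definition banach_fun_space :: "'a measure \<Rightarrow> 'a fun_space \<Rightarrow> bool" where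
  "banach_fun_space M X \<longleftrightarrow>
     elems X \<subseteq> borel_measurable M \<and>
     (\<forall>f\<in>elems X. \<forall>g\<in>borel_measurable M.
        (AE u in M. f u = g u) \<longrightarrow> g \<in> elems X \<and> fnorm X g = fnorm X f) \<and>
     (\<lambda>u. 0) \<in> elems X \<and>
     (\<forall>f\<in>elems X. \<forall>g\<in>elems X. (\<lambda>u. f u + g u) \<in> elems X \<and>
        fnorm X (\<lambda>u. f u + g u) \<le> fnorm X f + fnorm X g) \<and>
     (\<forall>f\<in>elems X. \<forall>c. (\<lambda>u. c * f u) \<in> elems X \<and>
        fnorm X (\<lambda>u. c * f u) = \<bar>c\<bar> * fnorm X f) \<and>
     (\<forall>f\<in>elems X. 0 \<le> fnorm X f \<and> (fnorm X f = 0 \<longleftrightarrow> (AE u in M. f u = 0))) \<and>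
     (\<forall>F::nat \<Rightarrow> 'a \<Rightarrow> real. (\<forall>n. F n \<in> elems X) \<and>
        (\<forall>\<epsilon>>0. \<exists>N. \<forall>m\<ge>N. \<forall>n\<ge>N. fnorm X (\<lambda>u. F m u - F n u) < \<epsilon>) \<longrightarrow>
        (\<exists>f\<in>elems X. (\<lambda>n. fnorm X (\<lambda>u. F n u - f u)) \<longlonglongrightarrow> 0))"

text \<open>Compatibility: both spaces embed continuously into the space of all classes of measurable
  functions with the topology of convergence in measure on sets of finite measure, which is a
  Hausdorff topological vector space when the measure is sigma-finite.  As the spaces are normed
  and the embedding is linear, continuity is tested on null sequences.\<close>

definition embeds_in_measure :: "'a measure \<Rightarrow> 'a fun_space \<Rightarrow> bool" where
  "embeds_in_measure M X \<longleftrightarrow>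
     (\<forall>F::nat \<Rightarrow> 'a \<Rightarrow> real. (\<forall>n. F n \<in> elems X) \<and> (\<lambda>n. fnorm X (F n)) \<longlonglongrightarrow> 0 \<longrightarrow>
        (\<forall>E\<in>sets M. emeasure M E < \<infinity> \<longrightarrow>
           (\<forall>\<epsilon>>0. (\<lambda>n. emeasure M {u\<in>E. \<bar>F n u\<bar> > \<epsilon>}) \<longlonglongrightarrow> 0)))"

definition compatible_couple :: "'a measure \<Rightarrow> 'a fun_space \<Rightarrow> 'a fun_space \<Rightarrow> bool" where
  "compatible_couple M X0 X1 \<longleftrightarrow>
     banach_fun_space M X0 \<and> banach_fun_space M X1 \<and>
     embeds_in_measure M X0 \<and> embeds_in_measure M X1"

definition couple_sum :: "'a measure \<Rightarrow> 'a fun_space \<Rightarrow> 'a fun_space \<Rightarrow> ('a \<Rightarrow> real) set" where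
  "couple_sum M X0 X1 =
     {f \<in> borel_measurable M.
        \<exists>f0\<in>elems X0. \<exists>f1\<in>elems X1. AE u in M. f0 u + f1 u = f u}"

definition K_functional ::
    "'a measure \<Rightarrow> 'a fun_space \<Rightarrow> 'a fun_space \<Rightarrow> ('a \<Rightarrow> real) \<Rightarrow> real \<Rightarrow> real" where
  "K_functional M X0 X1 f t =
     Inf {fnorm X0 f0 + t * fnorm X1 f1 | f0 f1.
            f0 \<in> elems X0 \<and> f1 \<in> elems X1 \<and> (AE u in M. f0 u + f1 u = f u)}"

definition admissible_contraction ::
    "'a measure \<Rightarrow> 'a fun_space \<Rightarrow> 'a fun_space \<Rightarrow> (('a \<Rightarrow> real) \<Rightarrow> ('a \<Rightarrow> real)) \<Rightarrow> bool" where
  "admissible_contraction M X0 X1 T \<longleftrightarrow>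
     (\<forall>f\<in>couple_sum M X0 X1. T f \<in> couple_sum M X0 X1) \<and>
     (\<forall>f\<in>couple_sum M X0 X1. \<forall>g\<in>couple_sum M X0 X1.
        (AE u in M. f u = g u) \<longrightarrow> (AE u in M. T f u = T g u)) \<and>
     (\<forall>f\<in>couple_sum M X0 X1. \<forall>g\<in>couple_sum M X0 X1.
        AE u in M. T (\<lambda>v. f v + g v) u = T f u + T g u) \<and>
     (\<forall>f\<in>couple_sum M X0 X1. \<forall>c. AE u in M. T (\<lambda>v. c * f v) u = c * T f u) \<and>
     (\<forall>f\<in>elems X0. T f \<in> elems X0 \<and> fnorm X0 (T f) \<le> fnorm X0 f) \<and>
     (\<forall>f\<in>elems X1. T f \<in> elems X1 \<and> fnorm X1 (T f) \<le> fnorm X1 f)"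

definition exact_Calderon_couple :: "'a measure \<Rightarrow> 'a fun_space \<Rightarrow> 'a fun_space \<Rightarrow> bool" where
  "exact_Calderon_couple M X0 X1 \<longleftrightarrow>
     compatible_couple M X0 X1 \<and>
     (\<forall>f\<in>couple_sum M X0 X1. \<forall>g\<in>couple_sum M X0 X1.
        (\<forall>t>0. K_functional M X0 X1 f t \<le> K_functional M X0 X1 g t) \<longrightarrow>
        (\<exists>T. admissible_contraction M X0 X1 T \<and> (AE u in M. T g u = f u)))"

section \<open>The two spaces\<close>

text \<open>A function with integrable majorant is finite almost everywhere, so real-valued
  representatives suffice in the first space.\<close>

definition L1_tilde :: "'a measure \<Rightarrow> 'a set set \<Rightarrow> 'a fun_space" where
  "L1_tilde M \<A> =
     \<lparr>elems = {g \<in> borel_measurable M. (\<integral>\<^sup>+u. core_tilde M \<A> (\<lambda>v. ereal (g v)) u \<partial>M) < \<infinity>},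
      fnorm = (\<lambda>g. enn2real (\<integral>\<^sup>+u. core_tilde M \<A> (\<lambda>v. ereal (g v)) u \<partial>M))\<rparr>"

text \<open>The essential supremum is taken in \<open>ennreal\<close>, so it is \<open>0\<close>, not \<open>-\<infinity>\<close>, for a zero measure.\<close>

definition Linfty :: "'a measure \<Rightarrow> 'a fun_space" where
  "Linfty M =
     \<lparr>elems = {g \<in> borel_measurable M. esssup M (\<lambda>u. ennreal \<bar>g u\<bar>) < \<infinity>},
      fnorm = (\<lambda>g. enn2real (esssup M (\<lambda>u. ennreal \<bar>g u\<bar>)))\<rparr>"

end

theory Submission
  imports Defs
begin

text \<open>
  For functions \<open>f\<close>, \<open>g\<close> in the sum of the two spaces write \<open>F\<close>, \<open>G\<close> for their least core decreasing
  majorants, \<open>H*\<close> for the decreasing rearrangement of \<open>H\<close>, and \<open>J h t\<close> for the integral of the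
  rearrangement of the majorant of \<open>h\<close> over the interval from \<open>0\<close> to \<open>t\<close>.

  The K-functional of \<open>f\<close> at \<open>t\<close> is \<open>J f t\<close> (\<open>J_le_K\<close>, \<open>K_le_J\<close>): a decomposition of \<open>f\<close> gives one for \<open>F\<close>,
  and truncating \<open>g\<close> at the height \<open>G*(t)\<close> is optimal.  The hypothesis therefore says \<open>J f \<le> J g\<close>.

  No formula for the contraction can be expected, since even a linear map taking a function to its
  majorant has to reproduce an essential supremum that need not be attained.  Instead the map comes
  from a Hahn-Banach theorem with values in the measurable functions (\<open>hahn_banach_measurable\<close>).  What
  is needed is a sublinear \<open>P\<close> on the sum of the spaces with core decreasing values such that the integral of
  \<open>P h\<close> is at most that of the majorant of \<open>h\<close>, \<open>P h\<close> is bounded by the essential supremum of \<open>\<bar>h\<bar>\<close>, and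
  \<open>\<bar>f\<bar> \<le> P g\<close>.  A linear \<open>T\<close> with \<open>T g = f\<close> and \<open>\<bar>T h\<bar> \<le> P h\<close> is then a contraction for both norms: as
  \<open>P h\<close> is core decreasing, it dominates also the majorant of \<open>T h\<close>.

  The dominant \<open>P\<close> is a composition \<open>h \<mapsto> J h \<mapsto> K h \<mapsto> P h\<close> (\<open>sublinear_dominant\<close>).  The first step is
  sublinear in the sense that \<open>J h1 + J h2 - J h\<close> is nondecreasing if \<open>\<bar>h\<bar> \<le> \<bar>h1\<bar> + \<bar>h2\<bar>\<close>; this rests on the
  superlevel sets of core decreasing functions being nested (\<open>rearrangement_sublinear\<close>).

  The second step is a linear operator on concave functions.  It lowers every concave function,
  preserves the order just described, and pushes \<open>J g\<close> down to \<open>J f\<close> wherever \<open>J f\<close> is steeper than the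
  asymptotic slope of \<open>J g\<close>; elsewhere \<open>J g\<close> is steep enough and stays so.  Cutting the graph of a concave
  function with a line replaces an arc by a chord; once the two end points of the arc are fixed this is
  an operation that is linear in the function.  \<open>J g\<close> is cut successively with the steep tangents
  of \<open>J f\<close> at rational points, and the operator is the limit of the resulting compositions
  (\<open>chop_sequence_exists\<close>).

  The third step differentiates along the core: for a countable chain \<open>\<Q>\<close> of down-sets, the value at \<open>u\<close>
  is the supremum of the difference quotients from the position of \<open>u\<close> to the measures of the members of \<open>\<Q>\<close>
  that contain \<open>u\<close>.  A supremum is sublinear without any differentiability argument, and concavity makes
  it core decreasing, with an integral that is at most the supremum of the concave function (\<open>transport_integral\<close>).  If \<open>\<Q>\<close> contains
  enough superlevel sets of \<open>F\<close>, the result for \<open>g\<close> dominates \<open>F\<close>, and hence \<open>\<bar>f\<bar>\<close>.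
\<close>

section \<open>Essential infima\<close>

lemma ennreal_inverse_le_iff: "inverse x \<le> inverse y \<longleftrightarrow> y \<le> x" for x y :: ennreal
  unfolding less_eq_ennreal.rep_eq inverse_ennreal.rep_eq
  using ereal_inverse_antimono[of "enn2ereal y" "enn2ereal x"]
    ereal_inverse_antimono_strict[of "enn2ereal x" "enn2ereal y"] by (auto simp: not_le[symmetric])

text \<open>Among the countable subfamilies one maximises the integral, against a finite weight, of the strictly
  antitone bounded transform \<open>inverse (1 + _)\<close> of the infimum.  Adding one more member to an optimal
  subfamily cannot change the integral, hence cannot lower the infimum except on a null set.\<close>

lemma (in sigma_finite_measure) essential_infimum:
  fixes D :: "'i \<Rightarrow> 'a \<Rightarrow> ennreal"
  assumes meas: "\<And>i. i \<in> I \<Longrightarrow> D i \<in> borel_measurable M"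
  shows "\<exists>C\<subseteq>I. countable C \<and> (\<forall>i\<in>I. AE u in M. (INF j\<in>C. D j u) \<le> D i u)"
proof -
  obtain w where w: "w \<in> borel_measurable M" "integral\<^sup>N M w < \<infinity>"
      "\<And>x. x \<in> space M \<Longrightarrow> 0 < w x \<and> w x < \<infinity>"
    using Ex_finite_integrable_function by (auto simp: less_top)
  define \<Phi> where "\<Phi> C = (\<integral>\<^sup>+u. w u * inverse (1 + (INF j\<in>C. D j u)) \<partial>M)" for C
  define \<C> where "\<C> = {C. C \<subseteq> I \<and> countable C}"
  have "\<C> \<noteq> {}" by (auto simp: \<C>_def)
  then obtain S :: "nat \<Rightarrow> ennreal" where S: "range S \<subseteq> \<Phi> ` \<C>" "(SUP n. S n) = Sup (\<Phi> ` \<C>)"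
    using ennreal_Sup_countable_SUP[of "\<Phi> ` \<C>"] by (metis image_is_empty)
  have "\<forall>n. \<exists>C. C \<in> \<C> \<and> S n = \<Phi> C" using S(1) by blast
  then obtain Cn where Cn: "\<And>n. Cn n \<in> \<C>" "\<And>n. S n = \<Phi> (Cn n)" by metis
  define C where "C = (\<Union>n. Cn n)"
  have C: "C \<in> \<C>" using Cn(1) by (auto simp: C_def \<C>_def)
  have inf_meas: "(\<lambda>u. w u * inverse (1 + (INF j\<in>B. D j u))) \<in> borel_measurable M" if "B \<in> \<C>" for B
  proof -
    have [measurable]: "(\<lambda>u. INF j\<in>B. D j u) \<in> borel_measurable M"
      using that meas by (intro borel_measurable_INF) (auto simp: \<C>_def)
    show ?thesis using w(1) by measurable
  qed
  have anti: "w u * inverse (1 + (INF j\<in>A. D j u)) \<le> w u * inverse (1 + (INF j\<in>B. D j u))" if "A \<subseteq> B" for A B u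
    using that by (intro mult_left_mono ennreal_inverse_le_iff[THEN iffD2] add_left_mono INF_superset_mono) auto
  have mono: "\<Phi> A \<le> \<Phi> B" if "A \<subseteq> B" for A B
    unfolding \<Phi>_def using anti[OF that] by (intro nn_integral_mono) auto
  have fin: "\<Phi> B < \<infinity>" for B
  proof -
    have "w u * inverse (1 + (INF j\<in>B. D j u)) \<le> w u * inverse 1" for u
      by (intro mult_left_mono ennreal_inverse_le_iff[THEN iffD2]) auto
    then have "\<Phi> B \<le> integral\<^sup>N M w" unfolding \<Phi>_def by (intro nn_integral_mono) auto
    then show ?thesis using w(2) by (meson order_le_less_trans)
  qed
  have top: "\<Phi> C \<ge> \<Phi> B" if "B \<in> \<C>" for B
  proof -
    have "\<Phi> B \<le> Sup (\<Phi> ` \<C>)" using that by (auto intro: Sup_upper)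
    also have "\<dots> \<le> \<Phi> C" unfolding S(2)[symmetric] by (intro SUP_least) (auto simp: Cn(2) C_def intro!: mono)
    finally show ?thesis .
  qed
  have "AE u in M. (INF j\<in>C. D j u) \<le> D i u" if i: "i \<in> I" for i
  proof -
    have iC: "insert i C \<in> \<C>" using C i by (auto simp: \<C>_def)
    let ?f = "\<lambda>u. w u * inverse (1 + (INF j\<in>C. D j u))"
    let ?g = "\<lambda>u. w u * inverse (1 + (INF j\<in>insert i C. D j u))"
    have "(\<integral>\<^sup>+u. ?g u - ?f u \<partial>M) = \<Phi> (insert i C) - \<Phi> C"
      unfolding \<Phi>_def using fin[of C] anti[of C "insert i C"] inf_meas[OF C] inf_meas[OF iC]
      by (intro nn_integral_diff) (auto simp: \<Phi>_def)
    also have "\<dots> = 0" using top[OF iC] by (simp add: diff_eq_0_iff_ennreal fin)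
      (metis fin infinity_ennreal_def)
    finally have "AE u in M. ?g u - ?f u = 0"
      using inf_meas[OF C] inf_meas[OF iC] by (subst (asm) nn_integral_0_iff_AE) auto
    then show ?thesis
      using AE_space
    proof eventually_elim
      case (elim u)
      define a where "a = (INF j\<in>C. D j u)"
      define b where "b = (INF j\<in>insert i C. D j u)"
      have wu: "0 < w u" "w u < top" using w(3)[of u] elim(2) by auto
      have "w u * inverse (1 + b) - w u * inverse (1 + a) = 0" using elim(1) by (simp add: a_def b_def)
      then have "w u * inverse (1 + b) \<le> w u * inverse (1 + a)"
        by (rule ennreal_minus_eq_0)
      then have "inverse (1 + b) \<le> inverse (1 + a)"
        using wu by (metis ennreal_mult_le_mult_iff less_top not_gr_zero)
      then have "1 + a \<le> 1 + b" by (simp add: ennreal_inverse_le_iff)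
      then have "a \<le> b" by (simp add: ennreal_add_left_cancel_le)
      also have "b \<le> D i u" by (simp add: b_def)
      finally show ?case by (simp add: a_def)
    qed
  qed
  then show ?thesis using C by (auto simp: \<C>_def)
qed

section \<open>A Hahn-Banach theorem with measurable values\<close>

text \<open>Dedekind completeness of the measurable functions modulo null sets.  The measurable minorant \<open>b\<close> shifts
  the upper family to nonnegative values, where the essential infimum is taken.\<close>

lemma (in sigma_finite_measure) separating_function:
  fixes L U :: "'i \<Rightarrow> 'a \<Rightarrow> real" and b :: "'a \<Rightarrow> real"
  assumes ne: "I \<noteq> {}"
    and meas: "\<And>i. i \<in> I \<Longrightarrow> U i \<in> borel_measurable M" "b \<in> borel_measurable M"
    and low: "\<And>i. i \<in> I \<Longrightarrow> AE u in M. b u \<le> U i u"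
    and LU: "\<And>i j. i \<in> I \<Longrightarrow> j \<in> I \<Longrightarrow> AE u in M. L i u \<le> U j u"
  shows "\<exists>k\<in>borel_measurable M. \<forall>i\<in>I. AE u in M. L i u \<le> k u \<and> k u \<le> U i u"
proof -
  define D where "D i u = ennreal (U i u - b u)" for i u
  have Dm: "D i \<in> borel_measurable M" if "i \<in> I" for i
    using meas(1)[OF that] meas(2) unfolding D_def by measurable
  from essential_infimum[of I D, OF Dm] obtain C0 where C0: "C0 \<subseteq> I" "countable C0"
    "\<forall>i\<in>I. AE u in M. (INF j\<in>C0. D j u) \<le> D i u" by auto
  obtain i0 where i0: "i0 \<in> I" using ne by auto
  define C where "C = insert i0 C0"
  have C: "C \<subseteq> I" "countable C" "C \<noteq> {}" using C0 i0 by (auto simp: C_def)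
  have le: "AE u in M. (INF j\<in>C. D j u) \<le> D i u" if "i \<in> I" for i
    using C0(3)[rule_format, OF that]
    by eventually_elim (simp add: C_def le_infI2)
  define k where "k u = enn2real (INF j\<in>C. D j u) + b u" for u
  have [measurable]: "(\<lambda>u. INF j\<in>C. D j u) \<in> borel_measurable M"
    using C Dm by (intro borel_measurable_INF) auto
  have "k \<in> borel_measurable M" unfolding k_def using meas(2) by measurable
  moreover have "AE u in M. L i u \<le> k u \<and> k u \<le> U i u" if i: "i \<in> I" for i
  proof -
    have "AE u in M. \<forall>j\<in>C. L i u \<le> U j u \<and> b u \<le> U j u"
      using C LU[OF i] low by (subst AE_ball_countable) auto
    then show ?thesis using le[OF i] low[OF i]
    proof eventually_elim
      case (elim u)
      have fin: "(INF j\<in>C. D j u) < top"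
        using elim(2) by (auto simp: D_def intro: order_le_less_trans)
      have "ennreal (L i u - b u) \<le> (INF j\<in>C. D j u)"
        using elim(1) by (auto intro!: INF_greatest ennreal_leI simp: D_def)
      then have "L i u - b u \<le> enn2real (INF j\<in>C. D j u)"
        using fin by (metis enn2real_ennreal enn2real_mono enn2real_nonneg le_cases order_trans)
      moreover have "enn2real (INF j\<in>C. D j u) \<le> U i u - b u"
        using elim(2,3) fin unfolding D_def by (intro enn2real_leI) auto
      ultimately show ?case by (simp add: k_def)
    qed
  qed
  ultimately show ?thesis by blast
qed

text \<open>Zorn's lemma is applied to graphs, that is, to linear subspaces of pairs \<open>(h, k)\<close> with \<open>k \<le> p h\<close> almost everywhere, rather
  than to operators on classes of functions.  Such a graph is single-valued modulo null sets by
  itself, because a difference \<open>(0, k - k')\<close> satisfies \<open>k - k' \<le> p 0 \<le> 0\<close>.\<close>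

lemma (in sigma_finite_measure) hahn_banach_measurable:
  fixes X :: "('a \<Rightarrow> real) set" and p :: "('a \<Rightarrow> real) \<Rightarrow> 'a \<Rightarrow> real"
  assumes add: "\<And>h h'. h \<in> X \<Longrightarrow> h' \<in> X \<Longrightarrow> (\<lambda>u. h u + h' u) \<in> X"
    and scale: "\<And>h c. h \<in> X \<Longrightarrow> (\<lambda>u. c * h u) \<in> X"
    and p_meas: "\<And>h. h \<in> X \<Longrightarrow> p h \<in> borel_measurable M"
    and p_add: "\<And>h h'. h \<in> X \<Longrightarrow> h' \<in> X \<Longrightarrow> AE u in M. p (\<lambda>v. h v + h' v) u \<le> p h u + p h' u"
    and p_scale: "\<And>h c. h \<in> X \<Longrightarrow> c > 0 \<Longrightarrow> AE u in M. p (\<lambda>v. c * h v) u \<le> c * p h u"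
    and p_zero: "\<And>h. h \<in> X \<Longrightarrow> (AE u in M. h u = 0) \<Longrightarrow> AE u in M. p h u \<le> 0"
    and g: "g \<in> X" and f: "f \<in> borel_measurable M"
    and fp: "\<And>c. AE u in M. c * f u \<le> p (\<lambda>v. c * g v) u"
  shows "\<exists>T. (\<forall>h\<in>X. T h \<in> borel_measurable M \<and> (AE u in M. T h u \<le> p h u)) \<and>
    (\<forall>h\<in>X. \<forall>h'\<in>X. AE u in M. T (\<lambda>v. h v + h' v) u = T h u + T h' u) \<and>
    (\<forall>h\<in>X. \<forall>c. AE u in M. T (\<lambda>v. c * h v) u = c * T h u) \<and>
    (\<forall>h\<in>X. \<forall>h'\<in>X. (AE u in M. h u = h' u) \<longrightarrow> (AE u in M. T h u = T h' u)) \<and>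
    (AE u in M. T g u = f u)"
proof -
  define subsp where "subsp \<Gamma> \<longleftrightarrow>
     (\<forall>h k h' k'. (h, k) \<in> \<Gamma> \<longrightarrow> (h', k') \<in> \<Gamma> \<longrightarrow> ((\<lambda>u. h u + h' u), (\<lambda>u. k u + k' u)) \<in> \<Gamma>) \<and>
     (\<forall>h k c. (h, k) \<in> \<Gamma> \<longrightarrow> ((\<lambda>u. c * h u), (\<lambda>u. c * k u)) \<in> \<Gamma>)"
    for \<Gamma> :: "(('a \<Rightarrow> real) \<times> ('a \<Rightarrow> real)) set"
  define dom where "dom \<Gamma> \<longleftrightarrow> (\<forall>(h, k)\<in>\<Gamma>. h \<in> X \<and> k \<in> borel_measurable M \<and> (AE u in M. k u \<le> p h u))"
    for \<Gamma> :: "(('a \<Rightarrow> real) \<times> ('a \<Rightarrow> real)) set"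
  define \<Gamma>0 where "\<Gamma>0 = range (\<lambda>c. ((\<lambda>u. c * g u), (\<lambda>u. c * f u)))"
  define \<G> where "\<G> = {\<Gamma>. \<Gamma>0 \<subseteq> \<Gamma> \<and> subsp \<Gamma> \<and> dom \<Gamma>}"
  have "subsp \<Gamma>0"
    unfolding subsp_def \<Gamma>0_def
  proof (intro conjI allI impI)
    fix h k h' k' :: "'a \<Rightarrow> real"
    assume "(h, k) \<in> range (\<lambda>c. ((\<lambda>u. c * g u), (\<lambda>u. c * f u)))"
      "(h', k') \<in> range (\<lambda>c. ((\<lambda>u. c * g u), (\<lambda>u. c * f u)))"
    then obtain c c' where "h = (\<lambda>u. c * g u)" "k = (\<lambda>u. c * f u)" "h' = (\<lambda>u. c' * g u)" "k' = (\<lambda>u. c' * f u)"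
      by auto
    then show "((\<lambda>u. h u + h' u), (\<lambda>u. k u + k' u)) \<in> range (\<lambda>c. ((\<lambda>u. c * g u), (\<lambda>u. c * f u)))"
      by (intro range_eqI[of _ _ "c + c'"]) (auto simp: algebra_simps)
  next
    fix h k :: "'a \<Rightarrow> real" and d
    assume "(h, k) \<in> range (\<lambda>c. ((\<lambda>u. c * g u), (\<lambda>u. c * f u)))"
    then obtain c where "h = (\<lambda>u. c * g u)" "k = (\<lambda>u. c * f u)"
      by auto
    then show "((\<lambda>u. d * h u), (\<lambda>u. d * k u)) \<in> range (\<lambda>c. ((\<lambda>u. c * g u), (\<lambda>u. c * f u)))"
      by (intro range_eqI[of _ _ "d * c"]) (auto simp: algebra_simps)
  qed
  moreover have "dom \<Gamma>0"
    using scale[OF g] fp f by (auto simp: dom_def \<Gamma>0_def)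
  ultimately have "\<Gamma>0 \<in> \<G>" by (simp add: \<G>_def)
  have "\<exists>\<Gamma>\<in>\<G>. \<forall>\<Gamma>'\<in>\<G>. \<Gamma> \<subseteq> \<Gamma>' \<longrightarrow> \<Gamma>' = \<Gamma>"
  proof (rule subset_Zorn_nonempty)
    show "\<G> \<noteq> {}" using \<open>\<Gamma>0 \<in> \<G>\<close> by auto
  next
    fix \<C> assume \<C>: "\<C> \<noteq> {}" "subset.chain \<G> \<C>"
    then have sub: "\<C> \<subseteq> \<G>" and ch: "\<And>A B. A \<in> \<C> \<Longrightarrow> B \<in> \<C> \<Longrightarrow> A \<subseteq> B \<or> B \<subseteq> A"
      by (auto simp: subset_chain_def)
    have "subsp (\<Union>\<C>)"
      unfolding subsp_def
    proof (intro conjI allI impI)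
      fix h k h' k' assume "(h, k) \<in> \<Union>\<C>" "(h', k') \<in> \<Union>\<C>"
      then obtain A B where "A \<in> \<C>" "B \<in> \<C>" "(h, k) \<in> A" "(h', k') \<in> B" by auto
      then obtain D where "D \<in> \<C>" "(h, k) \<in> D" "(h', k') \<in> D" using ch by blast
      then show "((\<lambda>u. h u + h' u), (\<lambda>u. k u + k' u)) \<in> \<Union>\<C>"
        using sub unfolding \<G>_def subsp_def by blast
    next
      fix h k d assume "(h, k) \<in> \<Union>\<C>"
      then show "((\<lambda>u. d * h u), (\<lambda>u. d * k u)) \<in> \<Union>\<C>"
        using sub unfolding \<G>_def subsp_def by blast
    qed
    moreover have "dom (\<Union>\<C>)" using sub by (fastforce simp: dom_def \<G>_def)
    moreover have "\<Gamma>0 \<subseteq> \<Union>\<C>" using \<C>(1) sub by (auto simp: \<G>_def)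
    ultimately show "\<Union>\<C> \<in> \<G>" by (simp add: \<G>_def)
  qed
  then obtain \<Gamma> where \<Gamma>: "\<Gamma> \<in> \<G>" and maximal: "\<And>\<Gamma>'. \<Gamma>' \<in> \<G> \<Longrightarrow> \<Gamma> \<subseteq> \<Gamma>' \<Longrightarrow> \<Gamma>' = \<Gamma>"
    by blast
  have \<Gamma>0: "\<Gamma>0 \<subseteq> \<Gamma>" using \<Gamma> by (simp add: \<G>_def)
  have \<Gamma>_add: "((\<lambda>u. h u + h' u), (\<lambda>u. k u + k' u)) \<in> \<Gamma>" if "(h, k) \<in> \<Gamma>" "(h', k') \<in> \<Gamma>" for h k h' k'
    using \<Gamma> that by (auto simp: \<G>_def subsp_def)
  have \<Gamma>_scale: "((\<lambda>u. c * h u), (\<lambda>u. c * k u)) \<in> \<Gamma>" if "(h, k) \<in> \<Gamma>" for h k c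
    using \<Gamma> that by (auto simp: \<G>_def subsp_def)
  have \<Gamma>_dom: "h \<in> X" "k \<in> borel_measurable M" "AE u in M. k u \<le> p h u" if "(h, k) \<in> \<Gamma>" for h k
    using \<Gamma> that by (auto simp: \<G>_def dom_def)
  have gf: "(g, f) \<in> \<Gamma>" using \<Gamma>0 by (force simp: \<Gamma>0_def image_iff intro: exI[of _ 1])
  \<comment> \<open>A maximal graph has full domain: otherwise it could be extended by one dimension.\<close>
  have total: "\<exists>k. (h0, k) \<in> \<Gamma>" if h0: "h0 \<in> X" for h0
  proof -
    have neg: "(\<lambda>u. - h0 u) \<in> X" using scale[OF h0, of "-1"] by simp
    define U where "U = (\<lambda>(h, k) u. p (\<lambda>v. h v + h0 v) u - k u :: real)"
    define L where "L = (\<lambda>(h, k) u. k u - p (\<lambda>v. h v - h0 v) u :: real)"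
    have diffX: "(\<lambda>v. h v - h0 v) \<in> X" if "h \<in> X" for h
      using add[OF that neg] by simp
    have LU: "AE u in M. L i u \<le> U j u" if ij: "i \<in> \<Gamma>" "j \<in> \<Gamma>" for i j
    proof -
      obtain h k h' k' where e: "i = (h, k)" "j = (h', k')" by (cases i, cases j) auto
      have 1: "AE u in M. k u + k' u \<le> p (\<lambda>v. h v + h' v) u"
        using \<Gamma>_dom(3)[OF \<Gamma>_add, of h k h' k'] ij by (simp add: e)
      have "AE u in M. p (\<lambda>v. (h v - h0 v) + (h' v + h0 v)) u \<le> p (\<lambda>v. h v - h0 v) u + p (\<lambda>v. h' v + h0 v) u"
        using ij \<Gamma>_dom(1) by (intro p_add diffX add h0) (auto simp: e)
      moreover have "(\<lambda>v. (h v - h0 v) + (h' v + h0 v)) = (\<lambda>v. h v + h' v)" by auto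
      ultimately have "AE u in M. p (\<lambda>v. h v + h' v) u \<le> p (\<lambda>v. h v - h0 v) u + p (\<lambda>v. h' v + h0 v) u" by simp
      then show ?thesis using 1 by eventually_elim (simp add: L_def U_def e)
    qed
    have Um: "U i \<in> borel_measurable M" if "i \<in> \<Gamma>" for i
      using that \<Gamma>_dom p_meas add h0 by (cases i) (auto simp: U_def)
    have Lm: "L i \<in> borel_measurable M" if "i \<in> \<Gamma>" for i
      using that \<Gamma>_dom p_meas diffX by (cases i) (auto simp: L_def)
    have "\<exists>k\<in>borel_measurable M. \<forall>i\<in>\<Gamma>. AE u in M. L i u \<le> k u \<and> k u \<le> U i u"
      using gf by (intro separating_function[where b = "L (g, f)"] Um Lm LU) auto
    then obtain k0 where k0: "k0 \<in> borel_measurable M" 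
      "\<And>i. i \<in> \<Gamma> \<Longrightarrow> AE u in M. L i u \<le> k0 u \<and> k0 u \<le> U i u" by blast
    \<comment> \<open>The value \<open>k0\<close> at the new direction \<open>h0\<close> lies between the two families of bounds imposed by \<open>p\<close>.\<close>
    define \<Gamma>' where "\<Gamma>' = {((\<lambda>u. h u + c * h0 u), (\<lambda>u. k u + c * k0 u)) | h k c. (h, k) \<in> \<Gamma>}"
    have "AE u in M. k u + c * k0 u \<le> p (\<lambda>v. h v + c * h0 v) u" if hk: "(h, k) \<in> \<Gamma>" for h k c
    proof -
      consider "c = 0" | "c > 0" | "c < 0" by linarith
      then show ?thesis
      proof cases
        case 1 then show ?thesis using \<Gamma>_dom[OF hk] by simp
      next
        case 2
        let ?h = "\<lambda>u. (1/c) * h u"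
        have *: "AE u in M. k0 u \<le> U (?h, (\<lambda>u. (1/c) * k u)) u"
          using k0(2)[OF \<Gamma>_scale[OF hk, of "1/c"]] by auto
        have "AE u in M. p (\<lambda>v. (1/c) * (h v + c * h0 v)) u \<le> (1/c) * p (\<lambda>v. h v + c * h0 v) u"
          using 2 \<Gamma>_dom[OF hk] by (intro p_scale add scale h0) auto
        moreover have "(\<lambda>v. (1/c) * (h v + c * h0 v)) = (\<lambda>v. ?h v + h0 v)" using 2 by (auto simp: field_simps)
        ultimately have "AE u in M. p (\<lambda>v. ?h v + h0 v) u \<le> (1/c) * p (\<lambda>v. h v + c * h0 v) u" by metis
        with * show ?thesis
        proof eventually_elim
          case (elim u)
          then have "k0 u + (1/c) * k u \<le> (1/c) * p (\<lambda>v. h v + c * h0 v) u" by (simp add: U_def)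
          then have "c * (k0 u + (1/c) * k u) \<le> c * ((1/c) * p (\<lambda>v. h v + c * h0 v) u)"
            using 2 by (intro mult_left_mono) auto
          then show ?case using 2 by (simp add: distrib_left)
        qed
      next
        case 3
        define d where "d = - c"
        have d: "d > 0" using 3 by (simp add: d_def)
        let ?h = "\<lambda>u. (1/d) * h u"
        have *: "AE u in M. L (?h, (\<lambda>u. (1/d) * k u)) u \<le> k0 u"
          using k0(2)[OF \<Gamma>_scale[OF hk, of "1/d"]] by auto
        have "AE u in M. p (\<lambda>v. (1/d) * (h v + c * h0 v)) u \<le> (1/d) * p (\<lambda>v. h v + c * h0 v) u"
          using d \<Gamma>_dom[OF hk] by (intro p_scale add scale h0) auto
        moreover have "(\<lambda>v. (1/d) * (h v + c * h0 v)) = (\<lambda>v. ?h v - h0 v)" using d by (auto simp: field_simps d_def)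
        ultimately have "AE u in M. p (\<lambda>v. ?h v - h0 v) u \<le> (1/d) * p (\<lambda>v. h v + c * h0 v) u" by metis
        with * show ?thesis
        proof eventually_elim
          case (elim u)
          then have "(1/d) * k u - k0 u \<le> (1/d) * p (\<lambda>v. h v + c * h0 v) u" by (simp add: L_def)
          then have "d * ((1/d) * k u - k0 u) \<le> d * ((1/d) * p (\<lambda>v. h v + c * h0 v) u)"
            using d by (intro mult_left_mono) auto
          then show ?case using d by (simp add: right_diff_distrib) (simp add: d_def)
        qed
      qed
    qed
    then have "dom \<Gamma>'"
      using \<Gamma>_dom(1,2) k0(1) add scale h0 by (auto simp: dom_def \<Gamma>'_def)
    moreover have "subsp \<Gamma>'"
      unfolding subsp_def
    proof (intro conjI allI impI)
      fix h k h' k' assume "(h, k) \<in> \<Gamma>'" "(h', k') \<in> \<Gamma>'"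
      then obtain a b c a' b' c' where "(a, b) \<in> \<Gamma>" "(a', b') \<in> \<Gamma>"
        "h = (\<lambda>u. a u + c * h0 u)" "k = (\<lambda>u. b u + c * k0 u)"
        "h' = (\<lambda>u. a' u + c' * h0 u)" "k' = (\<lambda>u. b' u + c' * k0 u)" by (auto simp: \<Gamma>'_def)
      then show "((\<lambda>u. h u + h' u), (\<lambda>u. k u + k' u)) \<in> \<Gamma>'"
        unfolding \<Gamma>'_def mem_Collect_eq using \<Gamma>_add[of a b a' b']
        by (intro exI[of _ "\<lambda>u. a u + a' u"] exI[of _ "\<lambda>u. b u + b' u"] exI[of _ "c + c'"])
           (auto simp: algebra_simps)
    next
      fix h k d assume "(h, k) \<in> \<Gamma>'"
      then obtain a b c where "(a, b) \<in> \<Gamma>"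
        "h = (\<lambda>u. a u + c * h0 u)" "k = (\<lambda>u. b u + c * k0 u)" by (auto simp: \<Gamma>'_def)
      then show "((\<lambda>u. d * h u), (\<lambda>u. d * k u)) \<in> \<Gamma>'"
        unfolding \<Gamma>'_def mem_Collect_eq using \<Gamma>_scale[of a b d]
        by (intro exI[of _ "\<lambda>u. d * a u"] exI[of _ "\<lambda>u. d * b u"] exI[of _ "d * c"])
           (auto simp: algebra_simps)
    qed
    moreover have sub: "\<Gamma> \<subseteq> \<Gamma>'"
    proof
      fix x assume "x \<in> \<Gamma>"
      then show "x \<in> \<Gamma>'" by (cases x) (force simp: \<Gamma>'_def intro: exI[of _ 0])
    qed
    ultimately have "\<Gamma>' = \<Gamma>" using \<Gamma>0 by (intro maximal) (auto simp: \<G>_def)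
    moreover have "(h0, k0) \<in> \<Gamma>'"
    proof -
      have "((\<lambda>u. 0 * g u + 1 * h0 u), (\<lambda>u. 0 * f u + 1 * k0 u)) \<in> \<Gamma>'"
        unfolding \<Gamma>'_def
        by (rule CollectI, rule exI[of _ "\<lambda>u. 0 * g u"], rule exI[of _ "\<lambda>u. 0 * f u"], rule exI[of _ 1])
           (use \<Gamma>_scale[OF gf, of 0] in simp)
      then show ?thesis by simp
    qed
    ultimately show ?thesis by auto
  qed
  have unique: "AE u in M. k u = k' u" if hk: "(h, k) \<in> \<Gamma>" "(h', k') \<in> \<Gamma>" and eq: "AE u in M. h u = h' u" for h k h' k'
  proof -
    have le: "AE u in M. k u \<le> k' u" if hk: "(h, k) \<in> \<Gamma>" "(h', k') \<in> \<Gamma>" and eq: "AE u in M. h u = h' u" for h k h' k'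
    proof -
      have d: "((\<lambda>u. h u + (-1) * h' u), (\<lambda>u. k u + (-1) * k' u)) \<in> \<Gamma>"
        by (intro \<Gamma>_add \<Gamma>_scale hk)
      have "AE u in M. p (\<lambda>u. h u + (-1) * h' u) u \<le> 0"
        using eq by (intro p_zero \<Gamma>_dom(1)[OF d]) auto
      then show ?thesis using \<Gamma>_dom(3)[OF d] by eventually_elim auto
    qed
    have eq': "AE u in M. h' u = h u" using eq by eventually_elim simp
    show ?thesis using le[OF hk eq] le[OF hk(2,1) eq'] by eventually_elim auto
  qed
  define T where "T h = (SOME k. (h, k) \<in> \<Gamma>)" for h
  have T: "(h, T h) \<in> \<Gamma>" if "h \<in> X" for h
    unfolding T_def using total[OF that] by (rule someI_ex)
  show ?thesis
  proof (intro exI[of _ T] conjI ballI allI impI)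
    fix h h' assume h: "h \<in> X" "h' \<in> X"
    show "AE u in M. T (\<lambda>v. h v + h' v) u = T h u + T h' u"
      by (rule unique[OF T[OF add[OF h]] \<Gamma>_add[OF T[OF h(1)] T[OF h(2)]]]) auto
    assume "AE u in M. h u = h' u"
    then show "AE u in M. T h u = T h' u" by (rule unique[OF T[OF h(1)] T[OF h(2)]])
  next
    fix h c assume h: "h \<in> X"
    show "AE u in M. T (\<lambda>v. c * h v) u = c * T h u"
      by (rule unique[OF T[OF scale[OF h]] \<Gamma>_scale[OF T[OF h]]]) auto
  next
    show "AE u in M. T g u = f u" by (rule unique[OF T[OF g] gf]) auto
  qed (use T \<Gamma>_dom in auto)
qed

section \<open>Banach spaces from function norms\<close>

text \<open>The countable form of subadditivity plays the role of the Riesz-Fischer property: it gives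
  the triangle inequality, monotonicity and completeness at once.\<close>

locale function_norm =
  fixes M :: "'a measure" and \<rho> :: "('a \<Rightarrow> real) \<Rightarrow> ennreal"
  assumes subadd: "\<And>f F. f \<in> borel_measurable M \<Longrightarrow> (\<And>n::nat. F n \<in> borel_measurable M) \<Longrightarrow>
      (AE u in M. ennreal \<bar>f u\<bar> \<le> (\<Sum>n. ennreal \<bar>F n u\<bar>)) \<Longrightarrow> \<rho> f \<le> (\<Sum>n. \<rho> (F n))"
    and scale: "\<And>f c. f \<in> borel_measurable M \<Longrightarrow> \<rho> (\<lambda>u. c * f u) = ennreal \<bar>c\<bar> * \<rho> f"
    and fin: "\<And>F. (\<And>n::nat. F n \<in> borel_measurable M) \<Longrightarrow> (\<Sum>n. \<rho> (F n)) < \<infinity> \<Longrightarrow>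
      (AE u in M. (\<Sum>n. ennreal \<bar>F n u\<bar>) < \<infinity>)"
begin

definition finite_norm_space :: "'a fun_space" where
  "finite_norm_space = \<lparr>elems = {f \<in> borel_measurable M. \<rho> f < \<infinity>}, fnorm = (\<lambda>f. enn2real (\<rho> f))\<rparr>"

lemma zero: "\<rho> (\<lambda>u. 0) = 0"
  using scale[of "\<lambda>u. 0" 0] by simp

lemma triangle:
  assumes [measurable]: "f \<in> borel_measurable M" "g1 \<in> borel_measurable M" "g2 \<in> borel_measurable M"
    and "AE u in M. \<bar>f u\<bar> \<le> \<bar>g1 u\<bar> + \<bar>g2 u\<bar>"
  shows "\<rho> f \<le> \<rho> g1 + \<rho> g2"
proof -
  define F where "F n = (if n = 0 then g1 else if n = 1 then g2 else (\<lambda>u. 0))" for n :: nat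
  have s: "(\<Sum>n. \<phi> (F n)) = \<phi> g1 + \<phi> g2" if "\<phi> (\<lambda>u. 0) = 0" for \<phi> :: "('a \<Rightarrow> real) \<Rightarrow> ennreal"
    using that by (subst suminf_finite[of "{0, 1}"]) (auto simp: F_def)
  have "\<rho> f \<le> (\<Sum>n. \<rho> (F n))"
  proof (rule subadd)
    show "AE u in M. ennreal \<bar>f u\<bar> \<le> (\<Sum>n. ennreal \<bar>F n u\<bar>)"
      using assms(4)
    proof eventually_elim
      case (elim u)
      have "(\<Sum>n. ennreal \<bar>F n u\<bar>) = ennreal \<bar>g1 u\<bar> + ennreal \<bar>g2 u\<bar>"
        by (rule s[of "\<lambda>f. ennreal \<bar>f u\<bar>"]) simp
      also have "\<dots> = ennreal (\<bar>g1 u\<bar> + \<bar>g2 u\<bar>)" by (simp add: ennreal_plus)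
      finally have eq: "(\<Sum>n. ennreal \<bar>F n u\<bar>) = ennreal (\<bar>g1 u\<bar> + \<bar>g2 u\<bar>)" .
      show ?case unfolding eq using elim by (rule ennreal_leI)
    qed
  qed (auto simp: F_def)
  then show ?thesis by (simp add: s zero)
qed

lemma mono:
  assumes [measurable]: "f \<in> borel_measurable M" "g \<in> borel_measurable M"
    and "AE u in M. \<bar>f u\<bar> \<le> \<bar>g u\<bar>"
  shows "\<rho> f \<le> \<rho> g"
  using triangle[of f g "\<lambda>u. 0"] assms by (simp add: zero)

lemma cong:
  assumes "f \<in> borel_measurable M" "g \<in> borel_measurable M" "AE u in M. f u = g u"
  shows "\<rho> f = \<rho> g"
proof (rule antisym)
  show "\<rho> f \<le> \<rho> g" by (rule mono) (use assms in auto)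
  show "\<rho> g \<le> \<rho> f" by (rule mono) (use assms in auto)
qed

lemma eq_0_iff:
  assumes f: "f \<in> borel_measurable M"
  shows "\<rho> f = 0 \<longleftrightarrow> (AE u in M. f u = 0)"
proof
  assume "\<rho> f = 0"
  then have "AE u in M. (\<Sum>n::nat. ennreal \<bar>f u\<bar>) < \<infinity>"
    using f by (intro fin) auto
  then show "AE u in M. f u = 0"
  proof eventually_elim
    case (elim u)
    have "ennreal \<bar>f u\<bar> = 0"
    proof (rule ccontr)
      assume "ennreal \<bar>f u\<bar> \<noteq> 0"
      then have pos: "\<bar>f u\<bar> > 0" by (auto simp: ennreal_eq_0_iff)
      have le: "of_nat N * ennreal \<bar>f u\<bar> \<le> (\<Sum>n::nat. ennreal \<bar>f u\<bar>)" for N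
      proof -
        have "(\<Sum>n<N. ennreal \<bar>f u\<bar>) \<le> (\<Sum>n::nat. ennreal \<bar>f u\<bar>)"
          by (rule sum_le_suminf) simp_all
        then show ?thesis by (simp only: sum_constant card_lessThan)
      qed
      have "(\<Sum>n::nat. ennreal \<bar>f u\<bar>) \<noteq> top" using elim unfolding infinity_ennreal_def by (rule less_imp_neq)
      then obtain c where c: "(\<Sum>n::nat. ennreal \<bar>f u\<bar>) = ennreal c" "c \<ge> 0"
        using ennreal_cases by metis
      obtain N :: nat where N: "c < real N * \<bar>f u\<bar>" using reals_Archimedean3[OF pos] by blast
      have "ennreal (real N * \<bar>f u\<bar>) = of_nat N * ennreal \<bar>f u\<bar>"
        by (simp add: ennreal_mult ennreal_of_nat_eq_real_of_nat)
      also have "\<dots> \<le> ennreal c" using le[of N] c(1) by (rule ord_le_eq_trans)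
      finally have "real N * \<bar>f u\<bar> \<le> c" using c(2) by (metis ennreal_le_iff)
      then show False using N by linarith
    qed
    then show ?case by (simp add: ennreal_eq_0_iff)
  qed
next
  assume "AE u in M. f u = 0"
  then show "\<rho> f = 0" using cong[OF f, of "\<lambda>u. 0"] zero by simp
qed

text \<open>A subsequence with increments of norm at most \<open>(1/2)^k\<close> converges almost everywhere by \<open>fin\<close>, and countable
  subadditivity bounds the distance from its limit by the tails of the geometric series.\<close>

lemma complete:
  fixes F :: "nat \<Rightarrow> 'a \<Rightarrow> real"
  assumes F: "\<And>n. F n \<in> elems finite_norm_space"
    and cauchy: "\<And>e. e > 0 \<Longrightarrow> \<exists>N. \<forall>m\<ge>N. \<forall>n\<ge>N. fnorm finite_norm_space (\<lambda>u. F m u - F n u) < e"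
  shows "\<exists>f\<in>elems finite_norm_space. (\<lambda>n. fnorm finite_norm_space (\<lambda>u. F n u - f u)) \<longlonglongrightarrow> 0"
proof -
  have [measurable]: "F n \<in> borel_measurable M" for n using F[of n] by (simp add: finite_norm_space_def)
  have finF: "\<rho> (F n) < \<infinity>" for n using F[of n] by (simp add: finite_norm_space_def)
  have fin_diff: "\<rho> (\<lambda>u. F m u - F n u) < \<infinity>" for m n
  proof -
    have "\<rho> (\<lambda>u. F m u - F n u) \<le> \<rho> (F m) + \<rho> (F n)" by (rule triangle) auto
    then show ?thesis using finF[of m] finF[of n] by (auto simp: ennreal_add_less_top intro: order_le_less_trans)
  qed
  have "\<forall>k. \<exists>N. \<forall>m\<ge>N. \<forall>n\<ge>N. fnorm finite_norm_space (\<lambda>u. F m u - F n u) < (1/2)^k"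
    using cauchy by simp
  then obtain N where N: "\<And>k m n. m \<ge> N k \<Longrightarrow> n \<ge> N k \<Longrightarrow> fnorm finite_norm_space (\<lambda>u. F m u - F n u) < (1/2)^k"
    unfolding choice_iff by blast
  define r where "r k = Max (N ` {..k})" for k
  have rN: "r k \<ge> N j" if "j \<le> k" for j k using that by (auto simp: r_def)
  have \<rho>_small: "\<rho> (\<lambda>u. F m u - F n u) \<le> ennreal ((1/2)^k)" if "m \<ge> r k" "n \<ge> r k" for m n k
    using N[of k m n] that rN[of k k] fin_diff[of m n]
    by (cases "\<rho> (\<lambda>u. F m u - F n u)") (auto simp: finite_norm_space_def intro!: ennreal_leI)
  have rmono: "r k \<le> r (Suc k)" for k unfolding r_def by (rule Max_mono) auto
  define G where "G k u = F (r (Suc k)) u - F (r k) u" for k u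
  have [measurable]: "G k \<in> borel_measurable M" for k unfolding G_def by measurable
  have G\<rho>: "\<rho> (G k) \<le> ennreal ((1/2)^k)" for k
    unfolding G_def using rmono by (intro \<rho>_small) auto
  have tail: "(\<Sum>j. \<rho> (G (j + k))) \<le> ennreal (2 * (1/2)^k)" for k
  proof -
    have "(\<Sum>j. \<rho> (G (j + k))) \<le> (\<Sum>j. ennreal ((1/2)^(j + k)))"
      by (intro suminf_le G\<rho>) auto
    also have "\<dots> = ennreal (\<Sum>j. (1/2)^(j + k))"
      by (intro suminf_ennreal2) (auto simp: power_add intro: summable_mult2)
    also have "(\<Sum>j. (1/2)^(j + k)) = (2 * (1/2)^k :: real)"
      using suminf_geometric[of "1/2::real"] suminf_mult2[of "\<lambda>j. (1/2::real)^j" "(1/2)^k"] by (simp add: power_add)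
    finally show ?thesis .
  qed
  have sumfin: "AE u in M. (\<Sum>k. ennreal \<bar>G k u\<bar>) < \<infinity>"
    using tail[of 0] by (intro fin) (auto intro: order_le_less_trans)
  define f where "f u = F (r 0) u + (\<Sum>k. G k u)" for u
  have [measurable]: "f \<in> borel_measurable M" unfolding f_def by measurable
  have f_tail: "\<rho> (\<lambda>u. f u - F (r k) u) \<le> ennreal (2 * (1/2)^k)" for k
  proof -
    have "AE u in M. ennreal \<bar>f u - F (r k) u\<bar> \<le> (\<Sum>j. ennreal \<bar>G (j + k) u\<bar>)"
      using sumfin
    proof eventually_elim
      case (elim u)
      have s: "summable (\<lambda>k. \<bar>G k u\<bar>)"
        using elim by (intro summable_suminf_not_top) (auto simp: less_top)
      have s': "summable (\<lambda>k. G k u)" using s by (rule summable_rabs_cancel)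
      have "F (r k) u = F (r 0) u + (\<Sum>j<k. G j u)"
        by (simp add: G_def sum_lessThan_telescope[of "\<lambda>j. F (r j) u"])
      moreover have "(\<Sum>j. G j u) = (\<Sum>j. G (j + k) u) + (\<Sum>j<k. G j u)"
        by (rule suminf_split_initial_segment[OF s'])
      ultimately have "\<bar>f u - F (r k) u\<bar> = \<bar>\<Sum>j. G (j + k) u\<bar>" by (simp add: f_def)
      also have "\<dots> \<le> (\<Sum>j. \<bar>G (j + k) u\<bar>)"
        using s by (intro summable_rabs) (simp add: summable_iff_shift[of "\<lambda>j. \<bar>G j u\<bar>"])
      finally have "ennreal \<bar>f u - F (r k) u\<bar> \<le> ennreal (\<Sum>j. \<bar>G (j + k) u\<bar>)" by (rule ennreal_leI)
      also have "\<dots> = (\<Sum>j. ennreal \<bar>G (j + k) u\<bar>)"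
        using s by (intro suminf_ennreal2[symmetric]) (auto simp: summable_iff_shift[of "\<lambda>j. \<bar>G j u\<bar>"])
      finally show ?case .
    qed
    then have "\<rho> (\<lambda>u. f u - F (r k) u) \<le> (\<Sum>j. \<rho> (G (j + k)))"
      by (intro subadd) auto
    then show ?thesis using tail[of k] by (rule order_trans)
  qed
  have "\<rho> f \<le> \<rho> (\<lambda>u. f u - F (r 0) u) + \<rho> (F (r 0))" by (rule triangle) auto
  also have "\<dots> \<le> ennreal 2 + \<rho> (F (r 0))" using f_tail[of 0] by (intro add_right_mono) simp
  also have "\<dots> < \<infinity>" using finF[of "r 0"] by simp
  finally have "\<rho> f < \<infinity>" .
  then have fsp: "f \<in> elems finite_norm_space" by (simp add: finite_norm_space_def)
  have close: "fnorm finite_norm_space (\<lambda>u. F n u - f u) \<le> 3 * (1/2)^k" if "n \<ge> r k" for n k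
  proof -
    have "\<rho> (\<lambda>u. F n u - f u) \<le> \<rho> (\<lambda>u. F n u - F (r k) u) + \<rho> (\<lambda>u. f u - F (r k) u)"
      by (rule triangle) auto
    also have "\<dots> \<le> ennreal ((1/2)^k) + ennreal (2 * (1/2)^k)"
      using that by (intro add_mono \<rho>_small f_tail) auto
    also have "\<dots> = ennreal (3 * (1/2)^k)" by (subst ennreal_plus[symmetric]) auto
    finally show ?thesis by (auto simp: finite_norm_space_def intro: enn2real_leI)
  qed
  have "(\<lambda>n. fnorm finite_norm_space (\<lambda>u. F n u - f u)) \<longlonglongrightarrow> 0"
  proof (rule LIMSEQ_I)
    fix e :: real assume e: "e > 0"
    obtain k where "(1/2)^k < e/3" using real_arch_pow_inv[of "e/3" "1/2"] e by auto
    then have k: "3 * (1/2)^k < e" by simp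
    have "norm (fnorm finite_norm_space (\<lambda>u. F n u - f u) - 0) < e" if "n \<ge> r k" for n
      using close[OF that] k by (simp add: finite_norm_space_def)
    then show "\<exists>n0. \<forall>n\<ge>n0. norm (fnorm finite_norm_space (\<lambda>u. F n u - f u) - 0) < e"
      by (intro exI[of _ "r k"]) simp
  qed
  then show ?thesis by (rule bexI[OF _ fsp])
qed

theorem banach: "banach_fun_space M finite_norm_space"
  unfolding banach_fun_space_def
proof (intro conjI ballI allI impI)
  show "elems finite_norm_space \<subseteq> borel_measurable M" by (auto simp: finite_norm_space_def)
  show "(\<lambda>u. 0) \<in> elems finite_norm_space" by (simp add: finite_norm_space_def zero)
next
  fix f g assume "f \<in> elems finite_norm_space" "g \<in> borel_measurable M" "AE u in M. f u = g u"
  moreover from this have "\<rho> f = \<rho> g" by (intro cong) (auto simp: finite_norm_space_def)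
  ultimately show "g \<in> elems finite_norm_space" "fnorm finite_norm_space g = fnorm finite_norm_space f" by (auto simp: finite_norm_space_def)
next
  fix f g assume fg: "f \<in> elems finite_norm_space" "g \<in> elems finite_norm_space"
  have le: "\<rho> (\<lambda>u. f u + g u) \<le> \<rho> f + \<rho> g" using fg by (intro triangle) (auto simp: finite_norm_space_def)
  have fin: "\<rho> f + \<rho> g < \<infinity>" using fg by (auto simp: finite_norm_space_def)
  show "(\<lambda>u. f u + g u) \<in> elems finite_norm_space" using order_le_less_trans[OF le fin] fg by (auto simp: finite_norm_space_def)
  show "fnorm finite_norm_space (\<lambda>u. f u + g u) \<le> fnorm finite_norm_space f + fnorm finite_norm_space g"
    using enn2real_mono[OF le] fin fg by (auto simp: finite_norm_space_def enn2real_plus)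
next
  fix f c assume "f \<in> elems finite_norm_space"
  then show "(\<lambda>u. c * f u) \<in> elems finite_norm_space" "fnorm finite_norm_space (\<lambda>u. c * f u) = \<bar>c\<bar> * fnorm finite_norm_space f"
    by (auto simp: finite_norm_space_def scale ennreal_mult_less_top enn2real_mult)
next
  fix f assume "f \<in> elems finite_norm_space"
  then show "0 \<le> fnorm finite_norm_space f" "(fnorm finite_norm_space f = 0) = (AE u in M. f u = 0)"
    using eq_0_iff[of f] by (auto simp: finite_norm_space_def enn2real_eq_0_iff)
next
  fix F :: "nat \<Rightarrow> 'a \<Rightarrow> real"
  assume "(\<forall>n. F n \<in> elems finite_norm_space) \<and> (\<forall>\<epsilon>>0. \<exists>N. \<forall>m\<ge>N. \<forall>n\<ge>N. fnorm finite_norm_space (\<lambda>u. F m u - F n u) < \<epsilon>)"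
  then show "\<exists>f\<in>elems finite_norm_space. (\<lambda>n. fnorm finite_norm_space (\<lambda>u. F n u - f u)) \<longlonglongrightarrow> 0"
    by (intro complete) auto
qed

end

section \<open>Concave functions on the half-line\<close>

text \<open>Nondecreasing concave functions that vanish at \<open>0\<close>, such as the integrals of decreasing functions.
  Concavity is expressed by supporting lines at interior points, the form that is most easily preserved
  when arcs are replaced by chords; for pointwise limits the closed condition \<open>antitone_slopes\<close> is used.\<close>

definition concave_cone :: "(real \<Rightarrow> real) set" where
  "concave_cone = {J. J 0 = 0 \<and> mono_on {0..} J \<and> (\<forall>x>0. \<exists>c. \<forall>t\<ge>0. J t \<le> J x + c * (t - x))}"

definition antitone_slopes :: "(real \<Rightarrow> real) \<Rightarrow> bool" where
  "antitone_slopes J \<longleftrightarrow>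
     (\<forall>r s t. 0 \<le> r \<longrightarrow> r < s \<longrightarrow> s < t \<longrightarrow> (J t - J s) * (s - r) \<le> (J s - J r) * (t - s))"

text \<open>The arc over the open interval from \<open>a\<close> to \<open>b\<close> is replaced by its chord.  In terms of the derivative this is averaging
  over the interval.\<close>

definition chop :: "real \<Rightarrow> real \<Rightarrow> (real \<Rightarrow> real) \<Rightarrow> real \<Rightarrow> real" where
  "chop a b J t = (if a < t \<and> t < b then J a + (t - a) * ((J b - J a) / (b - a)) else J t)"

primrec chops :: "(nat \<Rightarrow> real \<times> real) \<Rightarrow> nat \<Rightarrow> (real \<Rightarrow> real) \<Rightarrow> real \<Rightarrow> real" where
  "chops ab 0 J = J"
| "chops ab (Suc n) J = chop (fst (ab n)) (snd (ab n)) (chops ab n J)"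

definition chop_limit :: "(nat \<Rightarrow> real \<times> real) \<Rightarrow> (real \<Rightarrow> real) \<Rightarrow> real \<Rightarrow> real" where
  "chop_limit ab J t = lim (\<lambda>n. chops ab n J t)"

lemma concave_cone_supergradient:
  assumes "J \<in> concave_cone" "0 < x"
  obtains c where "\<And>t. 0 \<le> t \<Longrightarrow> J t \<le> J x + c * (t - x)"
  using assms unfolding concave_cone_def by blast

lemma concave_cone_antitone_slopes:
  assumes "J \<in> concave_cone"
  shows "antitone_slopes J"
  unfolding antitone_slopes_def
proof (intro allI impI)
  fix r s t :: real assume rst: "0 \<le> r" "r < s" "s < t"
  obtain c where c: "\<And>t. t \<ge> 0 \<Longrightarrow> J t \<le> J s + c * (t - s)"
    using concave_cone_supergradient[OF assms, of s] rst by auto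
  have "(J t - J s) * (s - r) \<le> (c * (t - s)) * (s - r)"
    using c[of t] rst by (intro mult_right_mono) auto
  also have "\<dots> = (c * (s - r)) * (t - s)" by simp
  also have "\<dots> \<le> (J s - J r) * (t - s)"
    using c[of r] rst by (intro mult_right_mono) (auto simp: algebra_simps)
  finally show "(J t - J s) * (s - r) \<le> (J s - J r) * (t - s)" .
qed

lemma concave_cone_slopes:
  assumes "J \<in> concave_cone" "0 \<le> r" "r < s" "s < t"
  shows "(J t - J s) * (s - r) \<le> (J s - J r) * (t - s)"
  using concave_cone_antitone_slopes[OF assms(1)] assms(2-) unfolding antitone_slopes_def by blast

lemma concave_cone_0: "J \<in> concave_cone \<Longrightarrow> J 0 = 0"
  by (simp add: concave_cone_def)

lemma concave_cone_mono: "J \<in> concave_cone \<Longrightarrow> mono_on {0..} J"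
  by (simp add: concave_cone_def)

lemma concave_cone_nonneg: "J \<in> concave_cone \<Longrightarrow> 0 \<le> t \<Longrightarrow> 0 \<le> J t"
  unfolding concave_cone_def using mono_onD[of "{0..}" J 0 t] by auto

lemma chop_le:
  assumes J: "J \<in> concave_cone" and "0 \<le> a"
  shows "chop a b J t \<le> J t"
proof (cases "a < t \<and> t < b")
  case True
  then have "(J b - J t) * (t - a) \<le> (J t - J a) * (b - t)"
    using concave_cone_slopes[OF J \<open>0 \<le> a\<close>, of t b] by simp
  then have "(t - a) * (J b - J a) \<le> (J t - J a) * (b - a)" by (simp add: algebra_simps)
  then have "(t - a) * ((J b - J a) / (b - a)) \<le> J t - J a"
    using True by (simp add: divide_simps)
  then show ?thesis using True by (simp add: chop_def)
qed (auto simp: chop_def)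

lemma chord_extension:
  assumes J: "J \<in> concave_cone" and "0 \<le> a" "a < b" "0 \<le> t" "\<not> (a < t \<and> t < b)"
  shows "J t \<le> J a + (t - a) * ((J b - J a) / (b - a))"
proof -
  consider "t = a" | "t = b" | "t < a" | "t > b" using assms by linarith
  then show ?thesis
  proof cases
    case 3
    then have "(J b - J a) * (a - t) \<le> (J a - J t) * (b - a)"
      using concave_cone_slopes[OF J \<open>0 \<le> t\<close>, of a b] assms by simp
    define Q where "Q = (J b - J a) / (b - a)"
    have "(a - t) * Q \<le> J a - J t"
      using assms \<open>(J b - J a) * (a - t) \<le> (J a - J t) * (b - a)\<close>
      by (simp add: Q_def divide_simps mult.commute)
    then have "J t \<le> J a + (t - a) * Q" by (simp add: algebra_simps)
    then show ?thesis by (simp add: Q_def)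
  next
    case 4
    then have "(J t - J b) * (b - a) \<le> (J b - J a) * (t - b)"
      using concave_cone_slopes[OF J \<open>0 \<le> a\<close>, of b t] assms by simp
    then have "(J t - J a) * (b - a) \<le> (J b - J a) * (t - a)" by (simp add: algebra_simps)
    then show ?thesis
      using assms by (simp add: divide_simps) (simp add: algebra_simps)
  qed (use assms in auto)
qed

text \<open>Applied to differences of functions, this is the statement that the linear map \<open>chop a b\<close> preserves the order in which
  \<open>J1\<close> is below \<open>J2\<close> if \<open>J2 - J1\<close> is nondecreasing.\<close>

lemma chop_mono_on:
  assumes D: "mono_on {0..} D" and "0 \<le> a"
  shows "mono_on {0..} (chop a b D)"
proof (cases "a < b")
  case True
  define q where "q = (D b - D a) / (b - a)"
  have q: "q \<ge> 0" using mono_onD[OF D, of a b] True assms(2) by (simp add: q_def)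
  have up: "D a + (t - a) * q \<le> D b" if "t \<le> b" for t
  proof -
    have "(t - a) * q \<le> (b - a) * q" using that q by (intro mult_right_mono) auto
    then show ?thesis using True by (simp add: q_def)
  qed
  have lo: "D a \<le> D a + (t - a) * q" if "a \<le> t" for t using that q by simp
  show ?thesis
  proof (rule mono_onI)
    fix s t :: real assume st: "s \<in> {0..}" "t \<in> {0..}" "s \<le> t"
    have *: "x \<le> y \<Longrightarrow> 0 \<le> x \<Longrightarrow> D x \<le> D y" for x y using mono_onD[OF D, of x y] by auto
    have e: "chop a b D x = (if a < x \<and> x < b then D a + (x - a) * q else D x)" for x
      by (simp add: chop_def q_def)
    have m: "(s - a) * q \<le> (t - a) * q" using st q by (intro mult_right_mono) auto
    consider "a < s \<and> s < b" "a < t \<and> t < b" | "a < s \<and> s < b" "b \<le> t"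
      | "s \<le> a" "a < t \<and> t < b" | "\<not> (a < s \<and> s < b)" "\<not> (a < t \<and> t < b)" using st by linarith
    then show "chop a b D s \<le> chop a b D t"
    proof cases
      case 1 then show ?thesis using m by (simp add: e)
    next
      case 2 
      have "D a + (s - a) * q \<le> D b" using up 2 by simp
      also have "D b \<le> D t" using * 2 True assms(2) by auto
      finally show ?thesis using 2 by (simp add: e)
    next
      case 3
      have "D s \<le> D a" using * 3 st by auto
      also have "D a \<le> D a + (t - a) * q" using lo 3 by simp
      finally show ?thesis using 3 by (simp add: e)
    next
      case 4 then show ?thesis using * st by (auto simp: e)
    qed
  qed
next
  case False
  then have "chop a b D = D" by (auto simp: chop_def)
  then show ?thesis using D by simp
qed

lemma chop_concave_cone:
  assumes J: "J \<in> concave_cone" and a: "0 \<le> a"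
  shows "chop a b J \<in> concave_cone"
  unfolding concave_cone_def
proof (intro CollectI conjI allI impI)
  show "chop a b J 0 = 0" using J a by (simp add: chop_def concave_cone_def)
  show "mono_on {0..} (chop a b J)" by (rule chop_mono_on[OF concave_cone_mono[OF J] a])
next
  fix x :: real assume x: "x > 0"
  show "\<exists>c. \<forall>t\<ge>0. chop a b J t \<le> chop a b J x + c * (t - x)"
  proof (cases "a < x \<and> x < b")
    case True
    define q where "q = (J b - J a) / (b - a)"
    have "chop a b J t \<le> J a + (t - a) * q" if "t \<ge> 0" for t
      using chord_extension[OF J a _ that, of b] True by (auto simp: chop_def q_def)
    then show ?thesis using True
      by (intro exI[of _ q]) (auto simp: chop_def q_def[symmetric] algebra_simps)
  next
    case False
    obtain c where "\<And>t. t \<ge> 0 \<Longrightarrow> J t \<le> J x + c * (t - x)"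
      using concave_cone_supergradient[OF J x] by blast
    then show ?thesis using chop_le[OF J a, of b] False
      by (intro exI[of _ c]) (auto simp: chop_def[of _ _ _ x] intro: order_trans)
  qed
qed

lemma concave_cone_cong:
  assumes "J \<in> concave_cone" "\<And>t. t \<ge> 0 \<Longrightarrow> J' t = J t"
  shows "J' \<in> concave_cone"
  using assms by (auto simp: concave_cone_def mono_on_def)

text \<open>Since the line does not start below the function and is eventually above it, a line that cuts
  the graph at all cuts it in two points \<open>a\<close> and \<open>b\<close>.  The line is the chord between them and,
  by concavity, lies above the function outside.\<close>

lemma chop_eq_min:
  assumes J: "J \<in> concave_cone" and cont: "continuous_on {0..} J" and d: "d \<ge> 0"
    and ev: "T \<ge> 0" "\<And>t. t \<ge> T \<Longrightarrow> J t < d + c * t"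
  shows "\<exists>a b. 0 \<le> a \<and> (\<forall>t\<ge>0. chop a b J t = min (J t) (d + c * t))"
proof (cases "\<forall>t\<ge>0. J t \<le> d + c * t")
  case True
  then show ?thesis by (intro exI[of _ 0]) (auto simp: chop_def min_def)
next
  case False
  then obtain x where x: "x \<ge> 0" "J x > d + c * x" by auto
  have "x < T" by (rule ccontr) (use ev(2)[of x] x in auto)
  have J0: "J 0 = 0" using J by (simp add: concave_cone_def)
  have "\<exists>a\<ge>0. a \<le> x \<and> J a - (d + c * a) = 0"
    using x J0 d by (intro IVT') (auto intro!: continuous_intros continuous_on_subset[OF cont])
  then obtain a where a: "0 \<le> a" "a \<le> x" "J a = d + c * a" by auto
  have "\<exists>b\<ge>x. b \<le> T \<and> J b - (d + c * b) = 0"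
    using x ev(2)[of T] \<open>x < T\<close>
    by (intro IVT2') (auto intro!: continuous_intros continuous_on_subset[OF cont])
  then obtain b where b: "x \<le> b" "J b = d + c * b" by auto
  have "a < b" using a b x by (cases "a = x"; cases "b = x") auto
  then have q: "(J b - J a) / (b - a) = c" using a b by (simp add: field_simps)
  have "chop a b J t = min (J t) (d + c * t)" if t: "t \<ge> 0" for t
  proof (cases "a < t \<and> t < b")
    case True
    then have "chop a b J t = d + c * t" unfolding chop_def q using a by (simp add: algebra_simps)
    then show ?thesis using chop_le[OF J a(1), of b t] by simp
  next
    case False
    have "J t \<le> d + c * t"
      using chord_extension[OF J a(1) \<open>a < b\<close> t False] unfolding q using a by (simp add: algebra_simps)
    then show ?thesis unfolding chop_def if_not_P[OF False] by simp
  qed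
  then show ?thesis using a by blast
qed

lemma mono_on_limit:
  fixes X :: "nat \<Rightarrow> real \<Rightarrow> real"
  assumes "\<And>n. mono_on S (X n)" "\<And>t. t \<in> S \<Longrightarrow> (\<lambda>n. X n t) \<longlonglongrightarrow> L t"
  shows "mono_on S L"
proof (rule mono_onI)
  fix r s assume rs: "r \<in> S" "s \<in> S" "r \<le> s"
  show "L r \<le> L s"
    by (rule LIMSEQ_le[OF assms(2)[OF rs(1)] assms(2)[OF rs(2)]])
       (use mono_onD[OF assms(1) rs] in auto)
qed

lemma chop_lin:
  "chop a b (\<lambda>t. \<alpha> * J t + \<beta> * J' t) = (\<lambda>t. \<alpha> * chop a b J t + \<beta> * chop a b J' t)"
proof -
  have "(\<alpha> * J b + \<beta> * J' b - (\<alpha> * J a + \<beta> * J' a)) / (b - a)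
      = \<alpha> * ((J b - J a) / (b - a)) + \<beta> * ((J' b - J' a) / (b - a))"
    by (simp add: diff_divide_distrib add_divide_distrib right_diff_distrib)
  then show ?thesis by (auto simp: chop_def algebra_simps)
qed

context
  fixes ab :: "nat \<Rightarrow> real \<times> real"
  assumes ab: "\<And>n. 0 \<le> fst (ab n)"
begin

lemma chops_cone: "J \<in> concave_cone \<Longrightarrow> chops ab n J \<in> concave_cone"
  by (induction n) (auto intro: chop_concave_cone ab)

lemma chops_mono_on: "mono_on {0..} D \<Longrightarrow> mono_on {0..} (chops ab n D)"
  by (induction n) (auto intro: chop_mono_on ab)

text \<open>The iterates decrease, as each chord lies below its arc, and they are nonnegative.\<close>

lemma chops_tendsto:
  assumes J: "J \<in> concave_cone" and t: "0 \<le> t"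
  shows "(\<lambda>n. chops ab n J t) \<longlonglongrightarrow> chop_limit ab J t"
proof -
  have "decseq (\<lambda>n. chops ab n J t)"
    using chop_le[OF chops_cone[OF J] ab] by (intro decseq_SucI) simp
  then have "convergent (\<lambda>n. chops ab n J t)"
    using concave_cone_nonneg[OF chops_cone[OF J] t] decseq_convergent[of _ 0] by (metis convergent_def)
  then show ?thesis unfolding chop_limit_def by (simp add: convergent_LIMSEQ_iff)
qed

lemma chop_limit_le_chops:
  assumes J: "J \<in> concave_cone" and t: "0 \<le> t"
  shows "chop_limit ab J t \<le> chops ab n J t"
proof -
  have "decseq (\<lambda>n. chops ab n J t)"
    using chop_le[OF chops_cone[OF J] ab] by (intro decseq_SucI) simp
  then show ?thesis using chops_tendsto[OF J t] by (rule decseq_ge)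
qed

lemma chop_limit_le: "J \<in> concave_cone \<Longrightarrow> 0 \<le> t \<Longrightarrow> chop_limit ab J t \<le> J t"
  using chop_limit_le_chops[of J t 0] by simp

lemma chop_limit_0:
  assumes J: "J \<in> concave_cone"
  shows "chop_limit ab J 0 = 0"
proof -
  have z: "chops ab n J 0 = 0" for n by (rule concave_cone_0[OF chops_cone[OF J]])
  have "(\<lambda>n. 0) \<longlonglongrightarrow> chop_limit ab J 0" using chops_tendsto[OF J order_refl] by (simp only: z)
  from LIMSEQ_unique[OF this tendsto_const] show ?thesis .
qed

lemma chop_limit_mono: "J \<in> concave_cone \<Longrightarrow> mono_on {0..} (chop_limit ab J)"
  by (rule mono_on_limit[of _ "\<lambda>n. chops ab n J"]) (simp_all add: chops_mono_on concave_cone_mono chops_tendsto)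

lemma chop_limit_antitone_slopes:
  assumes J: "J \<in> concave_cone"
  shows "antitone_slopes (chop_limit ab J)"
  unfolding antitone_slopes_def
proof (intro allI impI)
  fix r s t :: real assume rst: "0 \<le> r" "r < s" "s < t"
  show "(chop_limit ab J t - chop_limit ab J s) * (s - r) \<le> (chop_limit ab J s - chop_limit ab J r) * (t - s)"
    by (rule LIMSEQ_le[where X = "\<lambda>n. (chops ab n J t - chops ab n J s) * (s - r)"
          and Y = "\<lambda>n. (chops ab n J s - chops ab n J r) * (t - s)"])
       (use rst J concave_cone_slopes[OF chops_cone[OF J] rst] in \<open>auto intro!: tendsto_intros chops_tendsto\<close>)
qed

lemma chops_lin:
  "chops ab n (\<lambda>t. \<alpha> * J t + \<beta> * J' t) = (\<lambda>t. \<alpha> * chops ab n J t + \<beta> * chops ab n J' t)"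
  by (induction n) (simp_all add: chop_lin)

lemma chops_id: "chops ab n (\<lambda>t. t) t = t"
  by (induction n arbitrary: t) (auto simp: chop_def)

lemma chop_limit_sublinear:
  assumes J: "J \<in> concave_cone" "J1 \<in> concave_cone" "J2 \<in> concave_cone"
    and D: "mono_on {0..} (\<lambda>t. \<alpha> * J1 t + \<beta> * J2 t - J t)"
  shows "mono_on {0..} (\<lambda>t. \<alpha> * chop_limit ab J1 t + \<beta> * chop_limit ab J2 t - chop_limit ab J t)"
proof -
  have e: "chops ab n (\<lambda>t. \<alpha> * J1 t + \<beta> * J2 t - J t) t
      = \<alpha> * chops ab n J1 t + \<beta> * chops ab n J2 t - chops ab n J t" for n t
    using chops_lin[of n 1 "\<lambda>t. \<alpha> * J1 t + \<beta> * J2 t" "-1" J] chops_lin[of n \<alpha> J1 \<beta> J2] by simp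
  show ?thesis
    using chops_tendsto J
    by (intro mono_on_limit[OF chops_mono_on[OF D]]) (auto simp: e intro!: tendsto_intros)
qed

text \<open>Linear functions are fixed by every chop, so bounds on the slopes survive, from above
  (\<open>\<beta> = -1\<close>) as well as from below (\<open>\<beta> = 1\<close>).\<close>

lemma chop_limit_lipschitz:
  assumes J: "J \<in> concave_cone" and D: "mono_on {0..} (\<lambda>t. \<alpha> * t + \<beta> * J t)"
  shows "mono_on {0..} (\<lambda>t. \<alpha> * t + \<beta> * chop_limit ab J t)"
proof -
  have e: "chops ab n (\<lambda>t. \<alpha> * t + \<beta> * J t) t = \<alpha> * t + \<beta> * chops ab n J t" for n t
    using chops_lin[of n \<alpha> "\<lambda>t. t" \<beta> J] by (simp add: chops_id)
  show ?thesis
    using chops_tendsto J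
    by (intro mono_on_limit[OF chops_mono_on[OF D]]) (auto simp: e intro!: tendsto_intros)
qed

end

text \<open>Here \<open>\<eta> x\<close> is a slope of \<open>JF\<close> at \<open>x\<close> and \<open>\<gamma>\<close> is the asymptotic slope of \<open>JG\<close>.  A tangent of \<open>JF\<close> steeper than \<open>\<gamma>\<close>
  is eventually above \<open>JG\<close> and cuts off a bounded arc.  The flatter tangents are skipped: the slopes of
  the limit are at least \<open>\<gamma>\<close>, which is all that the conclusion asks where \<open>\<eta> \<le> \<gamma>\<close>.\<close>

theorem chop_sequence_exists:
  assumes JF: "JF \<in> concave_cone" "continuous_on {0..} JF"
    and JG: "JG \<in> concave_cone" "continuous_on {0..} JG"
    and le: "\<And>t. 0 \<le> t \<Longrightarrow> JF t \<le> JG t"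
    and F: "\<And>x t. 0 < x \<Longrightarrow> 0 \<le> t \<Longrightarrow> JF t \<le> JF x + \<eta> x * (t - x)"
    and \<gamma>: "0 \<le> \<gamma>" "mono_on {0..} (\<lambda>t. JG t - \<gamma> * t)"
    and asym: "\<And>c. \<gamma> < c \<Longrightarrow> \<exists>c'<c. \<exists>e. \<forall>t\<ge>0. JG t \<le> e + c' * t"
  shows "\<exists>ab. (\<forall>n. 0 \<le> fst (ab n)) \<and>
    (\<forall>r m s. 0 \<le> r \<longrightarrow> r < m \<longrightarrow> (\<forall>x. 0 < x \<longrightarrow> x < m \<longrightarrow> s \<le> \<eta> x) \<longrightarrow>
       s * (m - r) \<le> chop_limit ab JG m - chop_limit ab JG r)"
proof -
  define q :: "nat \<Rightarrow> real" where "q n = of_rat (from_nat n)" for n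
  define active where "active n \<longleftrightarrow> 0 < q n \<and> \<gamma> < \<eta> (q n)" for n
  define l where "l n t = (JF (q n) - \<eta> (q n) * q n) + \<eta> (q n) * t" for n t
  have l: "JF t \<le> l n t" if "active n" "0 \<le> t" for n t
    using F[of "q n" t] that by (simp add: l_def active_def algebra_simps)
  \<comment> \<open>The running minimum of \<open>JG\<close> and the first \<open>n\<close> steep tangents.\<close>
  define mm where "mm = rec_nat JG (\<lambda>n J t. if active n then min (J t) (l n t) else J t)"
  have mm_0: "mm 0 = JG" and mm_Suc: "mm (Suc n) = (\<lambda>t. if active n then min (mm n t) (l n t) else mm n t)" for n
    unfolding mm_def by simp_all
  have mm_le: "mm n t \<le> JG t" for n t by (induction n) (auto simp: mm_0 mm_Suc min.coboundedI1)
  have JF_le: "JF t \<le> mm n t" if "0 \<le> t" for n t using that by (induction n) (auto simp: mm_0 mm_Suc le l)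
  have cont: "continuous_on {0..} (mm n)" for n
  proof (induction n)
    case (Suc n)
    then show ?case by (cases "active n") (auto simp: mm_Suc l_def intro!: continuous_intros)
  qed (simp add: mm_0 JG)
  have step: "\<exists>a b. 0 \<le> a \<and> (\<forall>t\<ge>0. chop a b (mm n) t = mm (Suc n) t)" if cone: "mm n \<in> concave_cone" for n
  proof (cases "active n")
    case True
    obtain c' e where c': "c' < \<eta> (q n)" "\<And>t. t \<ge> 0 \<Longrightarrow> JG t \<le> e + c' * t"
      using asym[of "\<eta> (q n)"] True by (auto simp: active_def)
    define d where "d = JF (q n) - \<eta> (q n) * q n"
    define T where "T = max 0 ((e - d) / (\<eta> (q n) - c') + 1)"
    have "mm n t < d + \<eta> (q n) * t" if "t \<ge> T" for t
    proof -
      have "(e - d) / (\<eta> (q n) - c') < t" using that by (simp add: T_def)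
      then have "e - d < t * (\<eta> (q n) - c')" using c' by (simp add: pos_divide_less_eq)
      then have "e + c' * t < d + \<eta> (q n) * t" by (simp add: algebra_simps)
      moreover have "mm n t \<le> e + c' * t" using mm_le[of n t] c'(2)[of t] that by (simp add: T_def)
      ultimately show ?thesis by simp
    qed
    moreover have "d \<ge> 0" using l[OF True, of 0] JF by (simp add: l_def d_def concave_cone_def)
    ultimately have "\<exists>a b. 0 \<le> a \<and> (\<forall>t\<ge>0. chop a b (mm n) t = min (mm n t) (d + \<eta> (q n) * t))"
      by (intro chop_eq_min[where T = T] cone cont) (auto simp: T_def)
    then show ?thesis using True by (simp add: mm_Suc l_def d_def)
  next
    case False
    then show ?thesis by (intro exI[of _ 0]) (auto simp: mm_Suc chop_def)
  qed
  have cone: "mm n \<in> concave_cone" for n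
  proof (induction n)
    case (Suc n)
    obtain a b where "0 \<le> a" "\<And>t. t \<ge> 0 \<Longrightarrow> chop a b (mm n) t = mm (Suc n) t" using step[OF Suc] by blast
    then show ?case using concave_cone_cong[OF chop_concave_cone[OF Suc, of a b], of "mm (Suc n)"] by simp
  qed (simp add: mm_0 JG)
  have "\<forall>n. \<exists>p. 0 \<le> fst p \<and> (\<forall>t\<ge>0. chop (fst p) (snd p) (mm n) t = mm (Suc n) t)"
    using step[OF cone] by simp
  then obtain ab where ab: "\<And>n. 0 \<le> fst (ab n)"
    "\<And>n t. t \<ge> 0 \<Longrightarrow> chop (fst (ab n)) (snd (ab n)) (mm n) t = mm (Suc n) t" by metis
  have chops: "chops ab n JG t = mm n t" if "t \<ge> 0" for n t
    using that
  proof (induction n arbitrary: t)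
    case (Suc n)
    have "chops ab (Suc n) JG t = chop (fst (ab n)) (snd (ab n)) (mm n) t"
      using Suc ab(1)[of n] by (auto simp: chop_def)
    then show ?case using ab(2) Suc by simp
  qed (simp add: mm_0)
  let ?K = "chop_limit ab JG"
  have K_ge: "JF t \<le> ?K t" if "0 \<le> t" for t
    using chops_tendsto[of ab, OF ab(1) JG(1) that] JF_le[OF that] chops[OF that]
    by (intro LIMSEQ_le_const[of "\<lambda>n. chops ab n JG t"]) auto
  have K_le: "?K t \<le> l n t" if "active n" "0 \<le> t" for n t
    using chop_limit_le_chops[of ab, OF ab(1) JG(1) that(2), of "Suc n"] chops[OF that(2), of "Suc n"] that
    by (simp add: mm_Suc)
  have K_\<gamma>: "mono_on {0..} (\<lambda>t. (- \<gamma>) * t + 1 * ?K t)"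
    using \<gamma>(2) by (intro chop_limit_lipschitz ab JG) (simp add: algebra_simps)
  have "s * (m - r) \<le> ?K m - ?K r"
    if rm: "0 \<le> r" "r < m" and s: "\<And>x. 0 < x \<Longrightarrow> x < m \<Longrightarrow> s \<le> \<eta> x" for r m s
  proof (cases "s \<le> \<gamma>")
    case True
    have "s * (m - r) \<le> \<gamma> * (m - r)" using True rm by (intro mult_right_mono) auto
    also have "\<dots> \<le> ?K m - ?K r" using mono_onD[OF K_\<gamma>, of r m] rm by (simp add: algebra_simps)
    finally show ?thesis .
  next
    case False
    then have "s > 0" using \<gamma> by simp
    \<comment> \<open>Tangents at rational points slightly to the right of \<open>r\<close> are steep and take values close to \<open>JF r\<close> at \<open>r\<close>.\<close>
    have "?K r \<le> JF r"
    proof (rule field_le_epsilon)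
      fix e :: real assume e: "e > 0"
      obtain \<delta> where \<delta>: "\<delta> > 0" "\<And>x. x \<ge> 0 \<Longrightarrow> dist x r < \<delta> \<Longrightarrow> dist (JF x) (JF r) < e"
        using JF(2) rm e unfolding continuous_on_iff by fastforce
      obtain z :: rat where z: "r < of_rat z" "of_rat z < min m (r + \<delta>)"
        using of_rat_dense[of r "min m (r + \<delta>)"] rm \<delta> by auto
      define n where "n = to_nat z"
      have qn: "q n = of_rat z" by (simp add: q_def n_def)
      have q0: "0 < q n" unfolding qn by (rule le_less_trans[OF rm(1) z(1)])
      have \<eta>: "s \<le> \<eta> (q n)" using z by (intro s q0) (simp add: qn)
      then have "active n" using q0 False by (simp add: active_def)
      then have "?K r \<le> l n r" using K_le rm by simp
      also have "l n r = JF (q n) - \<eta> (q n) * (q n - r)" by (simp add: l_def algebra_simps)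
      also have "\<dots> \<le> JF (q n)" using \<eta> \<open>s > 0\<close> z by (simp add: qn)
      also have "\<dots> \<le> JF r + e" using \<delta>(2)[of "q n"] z q0 by (auto simp: qn dist_real_def)
      finally show "?K r \<le> JF r + e" .
    qed
    moreover have "s * (m - r) \<le> JF m - JF r"
    proof (rule ccontr)
      assume neg: "\<not> ?thesis"
      define y where "y = (JF m - JF r) / s"
      have sy: "JF m - JF r = s * y" using \<open>s > 0\<close> by (simp add: y_def)
      have mono: "JF x \<le> JF y" if "0 \<le> x" "x \<le> y" for x y
        using mono_onD[OF concave_cone_mono[OF JF(1)], of x y] that by simp
      have "0 \<le> y" using mono[of r m] rm \<open>s > 0\<close> by (simp add: y_def)
      moreover have "y < m - r" using neg \<open>s > 0\<close> unfolding sy by simp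
      ultimately obtain x where x: "r + y < x" "x < m" "r < x" using dense[of "r + y" m] by auto
      have "JF r \<le> JF x + \<eta> x * (r - x)" using F[of x r] x rm by simp
      then have "\<eta> x * (x - r) \<le> JF x - JF r" by (simp add: algebra_simps)
      moreover have "s * (x - r) \<le> \<eta> x * (x - r)" using s[of x] x rm by (intro mult_right_mono) auto
      moreover have "JF x \<le> JF m" using mono x rm by simp
      moreover have "s * y < s * (x - r)" using x \<open>s > 0\<close> by simp
      ultimately show False using sy by linarith
    qed
    ultimately show ?thesis using K_ge[of m] rm by simp
  qed
  then show ?thesis using ab(1) by (intro exI[of _ ab]) auto
qed

section \<open>Primitives and decreasing rearrangements\<close>

definition primitive :: "(real \<Rightarrow> ennreal) \<Rightarrow> real \<Rightarrow> real" where
  "primitive \<eta> t = enn2real (\<integral>\<^sup>+x. \<eta> x * indicator {0<..t} x \<partial>lborel)"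

lemma nn_integral_Ioc_split:
  fixes \<eta> :: "real \<Rightarrow> ennreal"
  assumes [measurable]: "\<eta> \<in> borel_measurable borel" and "a \<le> b" "b \<le> c"
  shows "(\<integral>\<^sup>+x. \<eta> x * indicator {a<..c} x \<partial>lborel) =
    (\<integral>\<^sup>+x. \<eta> x * indicator {a<..b} x \<partial>lborel) + (\<integral>\<^sup>+x. \<eta> x * indicator {b<..c} x \<partial>lborel)"
proof -
  have "\<eta> x * indicator {a<..c} x = \<eta> x * indicator {a<..b} x + \<eta> x * indicator {b<..c} x" for x
    by (cases "x \<le> b") (use assms in \<open>simp_all add: indicator_def\<close>)
  then show ?thesis by (simp add: nn_integral_add)
qed

lemma nn_integral_Ioc_const:
  "a \<le> b \<Longrightarrow> (\<integral>\<^sup>+x. c * indicator {a<..b} x \<partial>lborel) = c * ennreal (b - a)"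
  by (subst nn_integral_cmult_indicator) auto

locale locally_integrable_antitone =
  fixes \<eta> :: "real \<Rightarrow> ennreal"
  assumes meas [measurable]: "\<eta> \<in> borel_measurable borel"
    and anti: "\<And>x y. x \<le> y \<Longrightarrow> \<eta> y \<le> \<eta> x"
    and fin: "\<And>t. (\<integral>\<^sup>+x. \<eta> x * indicator {0<..t} x \<partial>lborel) < \<infinity>"
begin

lemma primitive_diff:
  assumes "0 \<le> s" "s \<le> t"
  shows "ennreal (primitive \<eta> t - primitive \<eta> s) = (\<integral>\<^sup>+x. \<eta> x * indicator {s<..t} x \<partial>lborel)"
    and "primitive \<eta> s \<le> primitive \<eta> t"
proof -
  let ?I = "\<lambda>a b. \<integral>\<^sup>+x. \<eta> x * indicator {a<..b} x \<partial>lborel"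
  have e: "?I 0 t = ?I 0 s + ?I s t" by (rule nn_integral_Ioc_split) (use assms in auto)
  have f: "?I 0 s < top" "?I s t < top" using fin[of t] by (auto simp: e)
  have p: "primitive \<eta> t = primitive \<eta> s + enn2real (?I s t)"
    unfolding primitive_def e using f by (simp add: enn2real_plus)
  show "ennreal (primitive \<eta> t - primitive \<eta> s) = ?I s t" using p f by simp
  show "primitive \<eta> s \<le> primitive \<eta> t" using p by simp
qed

lemma primitive_0: "primitive \<eta> 0 = 0" by (simp add: primitive_def)

lemma primitive_nonneg: "0 \<le> primitive \<eta> t" by (simp add: primitive_def)

lemma ennreal_primitive: "ennreal (primitive \<eta> t) = (\<integral>\<^sup>+x. \<eta> x * indicator {0<..t} x \<partial>lborel)"
  unfolding primitive_def using fin[of t] by (intro ennreal_enn2real) simp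

lemma finite:
  assumes "0 < x"
  shows "\<eta> x < top"
proof -
  have "\<eta> x * ennreal (x - 0) = (\<integral>\<^sup>+y. \<eta> x * indicator {0<..x} y \<partial>lborel)"
    using assms by (subst nn_integral_Ioc_const) auto
  also have "\<dots> \<le> (\<integral>\<^sup>+y. \<eta> y * indicator {0<..x} y \<partial>lborel)"
    by (intro nn_integral_mono) (auto simp: indicator_def intro: anti)
  also have "\<dots> < top" using fin[of x] by simp
  finally show ?thesis using assms by (auto simp: ennreal_mult_less_top)
qed

lemma primitive_diff_ge:
  assumes "0 \<le> s" "s \<le> t" "\<And>x. s < x \<Longrightarrow> x < t \<Longrightarrow> ennreal c \<le> \<eta> x" "0 \<le> c"
  shows "c * (t - s) \<le> primitive \<eta> t - primitive \<eta> s"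
proof -
  have "ennreal (c * (t - s)) = (\<integral>\<^sup>+x. ennreal c * indicator {s<..t} x \<partial>lborel)"
    using assms by (subst nn_integral_Ioc_const) (auto simp: ennreal_mult)
  also have "\<dots> \<le> (\<integral>\<^sup>+x. \<eta> x * indicator {s<..t} x \<partial>lborel)"
    using AE_lborel_singleton[of t] assms(3)
    by (intro nn_integral_mono_AE) (auto elim!: eventually_mono simp: indicator_def)
  also have "\<dots> = ennreal (primitive \<eta> t - primitive \<eta> s)" using primitive_diff(1)[OF assms(1,2)] by simp
  finally show ?thesis using primitive_diff(2)[OF assms(1,2)] by (simp add: ennreal_le_iff)
qed

lemma primitive_diff_le:
  assumes "0 \<le> s" "s \<le> t" "\<And>x. s < x \<Longrightarrow> x \<le> t \<Longrightarrow> \<eta> x \<le> ennreal c" "0 \<le> c"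
  shows "primitive \<eta> t - primitive \<eta> s \<le> c * (t - s)"
proof -
  have "ennreal (primitive \<eta> t - primitive \<eta> s) = (\<integral>\<^sup>+x. \<eta> x * indicator {s<..t} x \<partial>lborel)" 
    using primitive_diff(1)[OF assms(1,2)] by simp
  also have "\<dots> \<le> (\<integral>\<^sup>+x. ennreal c * indicator {s<..t} x \<partial>lborel)"
    using assms(3) by (intro nn_integral_mono) (auto simp: indicator_def)
  also have "\<dots> = ennreal (c * (t - s))"
    using assms by (subst nn_integral_Ioc_const) (auto simp: ennreal_mult)
  finally show ?thesis using assms by (simp add: ennreal_le_iff)
qed

lemma primitive_supergradient:
  assumes "0 < x" "0 \<le> t"
  shows "primitive \<eta> t \<le> primitive \<eta> x + enn2real (\<eta> x) * (t - x)"
proof (cases "x \<le> t")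
  case True
  have "\<eta> y \<le> ennreal (enn2real (\<eta> x))" if "x < y" for y
    using anti[of x y] finite[of x] that assms by simp
  from primitive_diff_le[OF _ True this] show ?thesis using assms by simp
next
  case False
  have "ennreal (enn2real (\<eta> x)) \<le> \<eta> y" if "y < x" for y
    using anti[of y x] finite[of x] that assms by simp
  then have "enn2real (\<eta> x) * (x - t) \<le> primitive \<eta> x - primitive \<eta> t"
    using False assms by (intro primitive_diff_ge) auto
  then show ?thesis by (simp add: algebra_simps)
qed

lemma primitive_cone: "primitive \<eta> \<in> concave_cone"
  unfolding concave_cone_def
proof (intro CollectI conjI allI impI)
  show "\<exists>c. \<forall>t\<ge>0. primitive \<eta> t \<le> primitive \<eta> x + c * (t - x)" if "0 < x" for x
    using primitive_supergradient[OF that] by blast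
qed (auto intro!: mono_onI primitive_0 primitive_diff(2))

text \<open>Away from \<open>0\<close> the primitive is locally Lipschitz; at \<open>0\<close>, where \<open>\<eta>\<close> may be unbounded, the integrals over
  shrinking intervals tend to \<open>0\<close>.\<close>

lemma primitive_continuous: "continuous_on {0..} (primitive \<eta>)"
  unfolding continuous_on_iff
proof (intro ballI allI impI)
  fix x e :: real assume x: "x \<in> {0..}" and e: "0 < e"
  show "\<exists>d>0. \<forall>t\<in>{0..}. dist t x < d \<longrightarrow> dist (primitive \<eta> t) (primitive \<eta> x) < e"
  proof (cases "x = 0")
    case True
    let ?g = "\<lambda>n y. \<eta> y * indicator {0<..1 / real (Suc n)} y"
    have "(INF n. integral\<^sup>N lborel (?g n)) = (\<integral>\<^sup>+y. (INF n. ?g n y) \<partial>lborel)"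
    proof (rule nn_integral_monotone_convergence_INF_decseq[symmetric, where i = 0])
      show "decseq ?g"
      proof (intro decseq_SucI le_funI mult_left_mono)
        fix n y
        have "1 / real (Suc (Suc n)) \<le> 1 / real (Suc n)" by (simp add: field_simps)
        then show "indicator {0<..1 / real (Suc (Suc n))} y \<le> (indicator {0<..1 / real (Suc n)} y :: ennreal)"
          by (simp add: indicator_def)
      qed simp
      show "integral\<^sup>N lborel (?g 0) < \<infinity>" using fin[of 1] by simp
    qed auto
    also have "\<dots> = (\<integral>\<^sup>+(y::real). 0 \<partial>lborel)"
    proof (intro nn_integral_cong)
      fix y :: real
      show "(INF n. ?g n y) = 0"
      proof (cases "0 < y")
        case True
        then obtain n where "1 / real (Suc n) < y" using nat_approx_posE by blast
        then have "?g n y = 0" by simp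
        moreover have "(INF n. ?g n y) \<le> ?g n y" by (rule INF_lower) simp
        ultimately show ?thesis by (simp only: le_zero_eq)
      next
        case False
        then have "?g 0 y = 0" by simp
        moreover have "(INF n. ?g n y) \<le> ?g 0 y" by (rule INF_lower) simp
        ultimately show ?thesis by (simp only: le_zero_eq)
      qed
    qed
    finally have "(INF n. integral\<^sup>N lborel (?g n)) < ennreal e" using e by simp
    then obtain n where "integral\<^sup>N lborel (?g n) < ennreal e" by (auto simp: INF_less_iff)
    then have "ennreal (primitive \<eta> (1 / real (Suc n))) < ennreal e" by (simp only: ennreal_primitive)
    then have n: "primitive \<eta> (1 / real (Suc n)) < e"
      by (simp only: ennreal_less_iff[OF primitive_nonneg])
    have "dist (primitive \<eta> t) (primitive \<eta> x) < e" if "t \<in> {0..}" "dist t x < 1 / real (Suc n)" for t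
      using primitive_diff(2)[of t "1 / real (Suc n)"] n that True primitive_nonneg[of t]
      by (simp add: dist_real_def primitive_0)
    then show ?thesis by (intro exI[of _ "1 / real (Suc n)"]) auto
  next
    case False
    then have x: "x > 0" using x by simp
    define c where "c = enn2real (\<eta> (x/2))"
    define d where "d = min (x/2) (e / (c + 1))"
    have c: "c \<ge> 0" by (simp add: c_def)
    have "d > 0" using x e c by (simp add: d_def)
    have lip: "\<bar>primitive \<eta> t - primitive \<eta> s\<bar> \<le> c * (t - s)" if "x/2 \<le> s" "s \<le> t" for s t
    proof -
      have "\<eta> y \<le> ennreal c" if "s < y" for y
        using anti[of "x/2" y] finite[of "x/2"] that \<open>x/2 \<le> s\<close> x by (simp add: c_def)
      from primitive_diff_le[OF _ \<open>s \<le> t\<close> this c] primitive_diff(2)[OF _ \<open>s \<le> t\<close>] that x show ?thesis by simp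
    qed
    have "dist (primitive \<eta> t) (primitive \<eta> x) < e" if "t \<in> {0..}" "dist t x < d" for t
    proof -
      have t: "x/2 \<le> t" "\<bar>t - x\<bar> < e / (c + 1)" using that by (auto simp: d_def dist_real_def abs_if split: if_splits)
      have "\<bar>primitive \<eta> t - primitive \<eta> x\<bar> \<le> c * \<bar>t - x\<bar>"
        using lip[of t x] lip[of x t] t x by (cases "t \<le> x") (auto simp: abs_minus_commute)
      also have "\<dots> \<le> (c + 1) * \<bar>t - x\<bar>" by (simp add: algebra_simps)
      also have "\<dots> < e" using t(2) c by (simp add: pos_less_divide_eq mult.commute)
      finally show ?thesis by (simp add: dist_real_def)
    qed
    then show ?thesis using \<open>d > 0\<close> by blast
  qed
qed

end

lemma primitive_sublinear:
  assumes "locally_integrable_antitone \<eta>" "locally_integrable_antitone \<eta>1" "locally_integrable_antitone \<eta>2"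
    and nonneg: "0 \<le> \<alpha>" "0 \<le> \<beta>"
    and le: "\<And>x. 0 < x \<Longrightarrow> \<eta> x \<le> ennreal \<alpha> * \<eta>1 x + ennreal \<beta> * \<eta>2 x"
  shows "mono_on {0..} (\<lambda>t. \<alpha> * primitive \<eta>1 t + \<beta> * primitive \<eta>2 t - primitive \<eta> t)"
proof (rule mono_onI)
  fix s t :: real assume st: "s \<in> {0..}" "t \<in> {0..}" "s \<le> t"
  interpret a: locally_integrable_antitone \<eta> by fact
  interpret a1: locally_integrable_antitone \<eta>1 by fact
  interpret a2: locally_integrable_antitone \<eta>2 by fact
  define d d1 d2 where "d = primitive \<eta> t - primitive \<eta> s" and "d1 = primitive \<eta>1 t - primitive \<eta>1 s"
    and "d2 = primitive \<eta>2 t - primitive \<eta>2 s"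
  have d: "d1 \<ge> 0" "d2 \<ge> 0" using st a1.primitive_diff(2) a2.primitive_diff(2) by (auto simp: d1_def d2_def)
  have "ennreal d = (\<integral>\<^sup>+x. \<eta> x * indicator {s<..t} x \<partial>lborel)"
    using st a.primitive_diff(1) by (simp add: d_def)
  also have "\<dots> \<le> (\<integral>\<^sup>+x. ennreal \<alpha> * (\<eta>1 x * indicator {s<..t} x) + ennreal \<beta> * (\<eta>2 x * indicator {s<..t} x) \<partial>lborel)"
    using le st by (intro nn_integral_mono) (auto simp: indicator_def)
  also have "\<dots> = ennreal \<alpha> * ennreal d1 + ennreal \<beta> * ennreal d2"
    using st by (subst nn_integral_add)
      (auto simp: a1.primitive_diff(1) a2.primitive_diff(1) nn_integral_cmult d1_def d2_def)
  also have "\<dots> = ennreal (\<alpha> * d1 + \<beta> * d2)"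
    using nonneg d by (simp add: ennreal_mult)
  finally have "d \<le> \<alpha> * d1 + \<beta> * d2"
    using nonneg d by (subst (asm) ennreal_le_iff) auto
  then show "\<alpha> * primitive \<eta>1 s + \<beta> * primitive \<eta>2 s - primitive \<eta> s
      \<le> \<alpha> * primitive \<eta>1 t + \<beta> * primitive \<eta>2 t - primitive \<eta> t"
    by (simp add: d_def d1_def d2_def algebra_simps)
qed

lemma emeasure_lborel_below: "emeasure lborel {y::real. 0 < y \<and> ennreal y < a} = a"
proof (cases a)
  case (real r)
  then have "{y::real. 0 < y \<and> ennreal y < a} = {0<..<r}" by (auto simp: ennreal_less_iff)
  then show ?thesis using real by simp
next
  case top
  then have e: "{y::real. 0 < y \<and> ennreal y < a} = {0<..}" by auto
  have "of_nat N \<le> emeasure lborel {0::real<..}" for N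
  proof -
    have "of_nat N = emeasure lborel {0<..<real N}" by (simp add: ennreal_of_nat_eq_real_of_nat)
    also have "\<dots> \<le> emeasure lborel {0::real<..}" by (intro emeasure_mono) auto
    finally show ?thesis .
  qed
  then have "(SUP N. of_nat N) \<le> emeasure lborel {0::real<..}" by (rule SUP_least)
  then have "emeasure lborel {0::real<..} = top" by (simp add: ennreal_SUP_of_nat_eq_top top_unique)
  then show ?thesis unfolding e using top by simp
qed

text \<open>Fubini's theorem for the region under the graph; the height is a real variable.\<close>

lemma (in sigma_finite_measure) layer_cake:
  assumes [measurable]: "\<phi> \<in> borel_measurable M"
  shows "(\<integral>\<^sup>+u. \<phi> u \<partial>M) = (\<integral>\<^sup>+y. indicator {0<..} y * emeasure M {u\<in>space M. ennreal y < \<phi> u} \<partial>lborel)"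
proof -
  interpret pair_sigma_finite M lborel ..
  let ?k = "\<lambda>(u, y). (if 0 < y \<and> ennreal y < \<phi> u then 1 else 0) :: ennreal"
  have "(\<integral>\<^sup>+u. \<phi> u \<partial>M) = (\<integral>\<^sup>+u. (\<integral>\<^sup>+y. ?k (u, y) \<partial>lborel) \<partial>M)"
  proof (rule nn_integral_cong)
    fix u
    have "(\<integral>\<^sup>+y. ?k (u, y) \<partial>lborel) = (\<integral>\<^sup>+y. indicator {y. 0 < y \<and> ennreal y < \<phi> u} y \<partial>lborel)"
      by (intro nn_integral_cong) (simp add: indicator_def)
    also have "\<dots> = \<phi> u" using emeasure_lborel_below[of "\<phi> u"] by (subst nn_integral_indicator) auto
    finally show "\<phi> u = (\<integral>\<^sup>+y. ?k (u, y) \<partial>lborel)" by simp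
  qed
  also have "\<dots> = (\<integral>\<^sup>+y. (\<integral>\<^sup>+u. ?k (u, y) \<partial>M) \<partial>lborel)"
    by (rule Fubini'[symmetric]) measurable
  also have "\<dots> = (\<integral>\<^sup>+y. indicator {0<..} y * emeasure M {u\<in>space M. ennreal y < \<phi> u} \<partial>lborel)"
  proof (rule nn_integral_cong)
    fix y :: real
    have "(\<integral>\<^sup>+u. ?k (u, y) \<partial>M) = (\<integral>\<^sup>+u. indicator {0<..} y * indicator {u\<in>space M. ennreal y < \<phi> u} u \<partial>M)"
      by (intro nn_integral_cong) (simp add: indicator_def)
    also have "\<dots> = indicator {0<..} y * emeasure M {u\<in>space M. ennreal y < \<phi> u}"
      by (rule nn_integral_cmult_indicator) measurable
    finally show "(\<integral>\<^sup>+u. ?k (u, y) \<partial>M) = indicator {0<..} y * emeasure M {u\<in>space M. ennreal y < \<phi> u}" .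
  qed
  finally show ?thesis .
qed

definition rearrangement :: "'a measure \<Rightarrow> ('a \<Rightarrow> ennreal) \<Rightarrow> real \<Rightarrow> ennreal" where
  "rearrangement M H x = Sup {y. ennreal x < emeasure M {u\<in>space M. y < H u}}"

text \<open>This Galois connection carries all later arguments about rearrangements.  The backward direction is
  continuity from below: the superlevel set at \<open>y\<close> is the increasing union of those at slightly greater heights.\<close>

lemma less_rearrangement_iff:
  assumes [measurable]: "H \<in> borel_measurable M"
  shows "y < rearrangement M H x \<longleftrightarrow> ennreal x < emeasure M {u\<in>space M. y < H u}"
proof
  assume "y < rearrangement M H x"
  then obtain z where "y < z" "ennreal x < emeasure M {u\<in>space M. z < H u}"
    by (auto simp: rearrangement_def less_Sup_iff)
  moreover from this have "emeasure M {u\<in>space M. z < H u} \<le> emeasure M {u\<in>space M. y < H u}"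
    by (intro emeasure_mono) auto
  ultimately show "ennreal x < emeasure M {u\<in>space M. y < H u}" by simp
next
  assume *: "ennreal x < emeasure M {u\<in>space M. y < H u}"
  have "y \<noteq> top" using * by (auto simp: not_less)
  define S where "S n = {u\<in>space M. y + ennreal (1 / Suc n) < H u}" for n
  have "{u\<in>space M. y < H u} = (\<Union>n. S n)"
  proof (intro equalityI subsetI)
    fix u assume u: "u \<in> {u\<in>space M. y < H u}"
    then have "0 < H u - y" by (simp add: diff_gr0_ennreal)
    then obtain e :: real where e: "0 < e" "ennreal e < H u - y"
      by (metis ennreal_less_zero_iff dense ennreal_cases less_top_ennreal not_less_iff_gr_or_eq top.not_eq_extremum)
    obtain n where "1 / real (Suc n) < e" using nat_approx_posE[OF e(1)] by blast
    then have "ennreal (1 / real (Suc n)) < H u - y" using e by (meson ennreal_leI less_imp_le order_le_less_trans)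
    then have "y + ennreal (1 / real (Suc n)) < H u"
      using \<open>y \<noteq> top\<close> by (subst (asm) less_diff_eq_ennreal) (auto simp: add.commute less_top)
    then show "u \<in> (\<Union>n. S n)" using u by (auto simp: S_def)
  next
    fix u assume "u \<in> (\<Union>n. S n)"
    then show "u \<in> {u\<in>space M. y < H u}" by (auto simp: S_def intro: order_le_less_trans[rotated])
  qed
  moreover have "incseq S"
  proof (intro incseq_SucI subsetI)
    fix n u assume u: "u \<in> S n"
    have "y + ennreal (1 / Suc (Suc n)) \<le> y + ennreal (1 / Suc n)"
      by (intro add_left_mono ennreal_leI) (simp add: field_simps)
    also have "\<dots> < H u" using u by (simp add: S_def)
    finally show "u \<in> S (Suc n)" using u by (simp add: S_def)
  qed
  ultimately have "emeasure M {u\<in>space M. y < H u} = (SUP n. emeasure M (S n))"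
    by (subst SUP_emeasure_incseq) (auto simp: S_def)
  with * obtain n where "ennreal x < emeasure M (S n)" by (auto simp: less_SUP_iff)
  then have "y + ennreal (1 / Suc n) \<le> rearrangement M H x"
    unfolding rearrangement_def S_def by (intro Sup_upper) simp
  moreover have "y < y + ennreal (1 / Suc n)"
    using \<open>y \<noteq> top\<close> ennreal_add_left_cancel_less[of y 0] by simp
  ultimately show "y < rearrangement M H x" by (metis order_less_le_trans)
qed

lemma rearrangement_measurable [measurable]:
  assumes "H \<in> borel_measurable M"
  shows "rearrangement M H \<in> borel_measurable borel"
proof (rule borel_measurableI_greater)
  fix y
  have "{x \<in> space borel. y < rearrangement M H x} = {x. ennreal x < emeasure M {u\<in>space M. y < H u}}"
    by (simp add: less_rearrangement_iff[OF assms])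
  also have "\<dots> \<in> sets borel" by measurable
  finally show "{x \<in> space borel. y < rearrangement M H x} \<in> sets borel" .
qed

lemma rearrangement_antitone: "x \<le> y \<Longrightarrow> rearrangement M H y \<le> rearrangement M H x"
  unfolding rearrangement_def
  by (intro Sup_subset_mono) (auto intro: order_le_less_trans ennreal_leI)

lemma rearrangement_const: "rearrangement M (\<lambda>u. c) x \<le> c"
  unfolding rearrangement_def
proof (rule Sup_least, rule ccontr)
  fix y assume y: "y \<in> {y. ennreal x < emeasure M {u\<in>space M. y < c}}" "\<not> y \<le> c"
  then have e: "{u\<in>space M. y < c} = {}" by auto
  show False using y(1) by (simp add: e)
qed

lemma rearrangement_diff:
  assumes [measurable]: "H \<in> borel_measurable M"
  shows "rearrangement M (\<lambda>u. H u - s) x \<le> rearrangement M H x - s"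
proof (rule ccontr)
  assume "\<not> ?thesis"
  then have "ennreal x < emeasure M {u\<in>space M. rearrangement M H x - s < H u - s}"
    by (simp add: not_le less_rearrangement_iff)
  also have "\<dots> \<le> emeasure M {u\<in>space M. rearrangement M H x < H u}"
  proof (rule emeasure_mono)
    show "{u\<in>space M. rearrangement M H x - s < H u - s} \<subseteq> {u\<in>space M. rearrangement M H x < H u}"
    proof safe
      fix u assume less: "rearrangement M H x - s < H u - s"
      show "rearrangement M H x < H u"
      proof (rule ccontr)
        assume "\<not> rearrangement M H x < H u"
        then have "H u - s \<le> rearrangement M H x - s" by (intro ennreal_minus_mono) auto
        from leD[OF this] less show False by (rule notE)
      qed
    qed
  qed measurable
  finally have "rearrangement M H x < rearrangement M H x"
    by (simp only: less_rearrangement_iff[OF assms])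
  then show False by simp
qed

text \<open>By \<open>less_rearrangement_iff\<close>, both sides have the same layer cake representation.\<close>

lemma (in sigma_finite_measure) nn_integral_rearrangement:
  assumes [measurable]: "H \<in> borel_measurable M"
  shows "(\<integral>\<^sup>+u. H u \<partial>M) = (\<integral>\<^sup>+x. rearrangement M H x * indicator {0<..} x \<partial>lborel)"
proof -
  let ?m = "\<lambda>y. emeasure M {u\<in>space M. ennreal y < H u}"
  let ?r = "\<lambda>x. rearrangement M H x * indicator {0<..} x"
  have "(\<integral>\<^sup>+x. ?r x \<partial>lborel) = (\<integral>\<^sup>+y. indicator {0<..} y * emeasure lborel {x\<in>space lborel. ennreal y < ?r x} \<partial>lborel)"
    by (rule lborel.layer_cake) measurable
  also have "\<dots> = (\<integral>\<^sup>+y. indicator {0<..} y * ?m y \<partial>lborel)"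
  proof (rule nn_integral_cong)
    fix y :: real
    show "indicator {0<..} y * emeasure lborel {x\<in>space lborel. ennreal y < ?r x} = indicator {0<..} y * ?m y"
    proof (cases "0 < y")
      case True
      have "{x\<in>space lborel. ennreal y < ?r x} = {x. 0 < x \<and> ennreal x < ?m y}"
        using less_rearrangement_iff[OF assms, of "ennreal y"] by (auto simp: indicator_def)
      then show ?thesis by (simp only: emeasure_lborel_below)
    qed simp
  qed
  finally show ?thesis by (simp only: layer_cake[OF assms])
qed

section \<open>Core decreasing functions\<close>

text \<open>The sigma-ring of a full core is the sigma-algebra that it generates, so that core decreasing
  functions are measurable functions for \<open>core_algebra\<close>.\<close>

locale core_space = sigma_finite_measure M for M :: "'a measure" +
  fixes \<A> :: "'a set set"
  assumes full: "full_ordered_core M \<A>"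
begin

abbreviation core_algebra :: "'a measure" where "core_algebra \<equiv> sigma (space M) \<A>"

lemma core_sets: "A \<in> \<A> \<Longrightarrow> A \<in> sets M" 
  and core_chain: "A \<in> \<A> \<Longrightarrow> B \<in> \<A> \<Longrightarrow> A \<subseteq> B \<or> B \<subseteq> A"
  and core_finite: "A \<in> \<A> \<Longrightarrow> emeasure M A < \<infinity>"
  and core_Union: "\<Union>\<A> = space M"
  using full unfolding full_ordered_core_def ordered_core_def by auto

lemma core_Pow: "\<A> \<subseteq> Pow (space M)" using core_Union by auto

lemma exhausting_core:
  obtains E :: "nat \<Rightarrow> 'a set" where "range E \<subseteq> \<A>" "(\<Union>n. E n) = space M"
proof -
  obtain \<A>0 where "\<A>0 \<subseteq> \<A>" "countable \<A>0" "\<Union>\<A> = \<Union>\<A>0"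
    using full unfolding full_ordered_core_def sigma_bounded_core_def by auto
  moreover have "{} \<in> \<A>" using full unfolding full_ordered_core_def ordered_core_def by auto
  ultimately show ?thesis
    using that[of "from_nat_into (insert {} \<A>0)"] range_from_nat_into[of "insert {} \<A>0"] core_Union by auto
qed

lemma space_sigma_ring: "space M \<in> sigma_ring_sets \<A>"
proof -
  obtain E :: "nat \<Rightarrow> 'a set" where "range E \<subseteq> \<A>" "(\<Union>n. E n) = space M" by (rule exhausting_core)
  then show ?thesis using sigma_ring_sets.Union[of E \<A>] by (auto intro: sigma_ring_sets.Basic)
qed

lemma sigma_ring_eq: "sigma_ring_sets \<A> = sets core_algebra"
proof (intro equalityI subsetI)
  fix A assume "A \<in> sigma_ring_sets \<A>"
  then show "A \<in> sets core_algebra"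
  proof induction
    case (Basic A)
    then show ?case unfolding sets_measure_of[OF core_Pow] by (rule sigma_sets.Basic)
  next
    case (Union E)
    then show ?case by (intro sets.countable_UN) auto
  qed (rule sets.empty_sets, rule sets.Diff)
next
  fix A assume "A \<in> sets core_algebra"
  then have "A \<in> sigma_sets (space M) \<A>" using core_Pow by simp
  then show "A \<in> sigma_ring_sets \<A>"
    by induction (auto intro: sigma_ring_sets.intros space_sigma_ring)
qed

lemma sets_core_algebra: "sets core_algebra \<subseteq> sets M"
  unfolding sets_measure_of[OF core_Pow] by (rule sets.sigma_sets_subset) (use core_sets in auto)

lemma borel_measurable_core_algebra: "f \<in> borel_measurable core_algebra \<Longrightarrow> f \<in> borel_measurable M"
  by (rule measurable_mono[THEN subsetD, of borel borel core_algebra M]) (use sets_core_algebra core_Pow in auto)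

lemma core_decreasing_iff: "f \<in> core_decreasing M \<A> \<longleftrightarrow>
    f \<in> borel_measurable core_algebra \<and> (\<forall>u\<in>space M. \<forall>v\<in>space M. core_le \<A> u v \<longrightarrow> f v \<le> f u)"
  unfolding core_decreasing_def sigma_ring_eq using core_Pow by (auto simp: measurable_def space_measure_of_conv)

lemma core_decreasing_core_algebra: "f \<in> core_decreasing M \<A> \<Longrightarrow> f \<in> borel_measurable core_algebra"
  and core_decreasing_measurable: "f \<in> core_decreasing M \<A> \<Longrightarrow> f \<in> borel_measurable M"
  and core_decreasingD: "f \<in> core_decreasing M \<A> \<Longrightarrow> core_le \<A> u v \<Longrightarrow> u \<in> space M \<Longrightarrow> v \<in> space M \<Longrightarrow> f v \<le> f u"
  using borel_measurable_core_algebra by (auto simp: core_decreasing_iff)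

lemma core_decreasing_INF:
  assumes "countable C" "\<And>i. i \<in> C \<Longrightarrow> D i \<in> core_decreasing M \<A>"
  shows "(\<lambda>u. INF i\<in>C. D i u) \<in> core_decreasing M \<A>"
  using assms unfolding core_decreasing_iff by (auto intro!: INF_mono borel_measurable_INF)

lemma core_decreasing_SUP:
  assumes "countable C" "\<And>i. i \<in> C \<Longrightarrow> D i \<in> core_decreasing M \<A>"
  shows "(\<lambda>u. SUP i\<in>C. D i u) \<in> core_decreasing M \<A>"
  using assms unfolding core_decreasing_iff by (auto intro!: SUP_mono borel_measurable_SUP)

lemma core_decreasing_const: "(\<lambda>u. c) \<in> core_decreasing M \<A>"
  by (auto simp: core_decreasing_iff)

lemma core_decreasing_add:
  "f \<in> core_decreasing M \<A> \<Longrightarrow> g \<in> core_decreasing M \<A> \<Longrightarrow> (\<lambda>u. f u + g u) \<in> core_decreasing M \<A>"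
  by (auto simp: core_decreasing_iff intro: add_mono)

lemma core_decreasing_cmult: "f \<in> core_decreasing M \<A> \<Longrightarrow> (\<lambda>u. c * f u) \<in> core_decreasing M \<A>"
  by (auto simp: core_decreasing_iff intro: mult_left_mono)

lemma core_decreasing_diff: "f \<in> core_decreasing M \<A> \<Longrightarrow> (\<lambda>u. f u - c) \<in> core_decreasing M \<A>"
  by (auto simp: core_decreasing_iff intro: ennreal_minus_mono)

lemma core_decreasing_suminf:
  "(\<And>n::nat. f n \<in> core_decreasing M \<A>) \<Longrightarrow> (\<lambda>u. \<Sum>n. f n u) \<in> core_decreasing M \<A>"
  by (auto simp: core_decreasing_iff intro!: suminf_le borel_measurable_suminf_order)

lemma core_le_total: "core_le \<A> u v \<or> core_le \<A> v u"
  unfolding core_le_def using core_chain by blast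

text \<open>Initial segments of the preorder given by the core.  They form a chain that contains the core and all
  superlevel sets of core decreasing functions.\<close>

definition down_set :: "'a set \<Rightarrow> bool" where
  "down_set D \<longleftrightarrow> D \<in> sets core_algebra \<and> (\<forall>u\<in>space M. \<forall>v\<in>D. core_le \<A> u v \<longrightarrow> u \<in> D)"

lemma down_set_space: "down_set D \<Longrightarrow> D \<subseteq> space M"
  unfolding down_set_def by (metis sets.sets_into_space space_measure_of_conv)

lemma down_set_sets: "down_set D \<Longrightarrow> D \<in> sets M"
  using sets_core_algebra by (auto simp: down_set_def)

lemma down_set_chain:
  assumes "down_set D1" "down_set D2"
  shows "D1 \<subseteq> D2 \<or> D2 \<subseteq> D1"
proof (rule ccontr)
  assume "\<not> ?thesis"
  then obtain u v where uv: "u \<in> D1" "u \<notin> D2" "v \<in> D2" "v \<notin> D1" by auto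
  then have "u \<in> space M" "v \<in> space M" using assms down_set_space by auto
  then show False using uv assms core_le_total[of u v] unfolding down_set_def by blast
qed

lemma down_set_core: "A \<in> \<A> \<Longrightarrow> down_set A"
  using core_Pow by (auto simp: down_set_def core_le_def)

lemma down_set_superlevel:
  assumes f: "f \<in> core_decreasing M \<A>"
  shows "down_set {u\<in>space M. y < f u}"
proof -
  have "{u\<in>space core_algebra. y < f u} \<in> sets core_algebra"
    using core_decreasing_core_algebra[OF f] by measurable
  then have "{u\<in>space M. y < f u} \<in> sets core_algebra" by (simp only: space_measure_of_conv)
  then show ?thesis
    unfolding down_set_def using core_decreasingD[OF f] by (auto intro: less_le_trans)
qed

lemma down_set_Int: "down_set D1 \<Longrightarrow> down_set D2 \<Longrightarrow> down_set (D1 \<inter> D2)"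
  unfolding down_set_def by blast

text \<open>Where the sum exceeds \<open>\<alpha> a + \<beta> b\<close>, one of the summands exceeds its threshold.  The two superlevel sets are nested, so
  the measure of their union is not the sum but the maximum of the measures.  For
  functions that are not monotone along a common chain the inequality can fail.\<close>

lemma rearrangement_sublinear:
  fixes \<alpha> \<beta> :: ennreal
  assumes H: "H \<in> core_decreasing M \<A>" "H1 \<in> core_decreasing M \<A>" "H2 \<in> core_decreasing M \<A>"
    and le: "AE u in M. H u \<le> \<alpha> * H1 u + \<beta> * H2 u"
  shows "rearrangement M H x \<le> \<alpha> * rearrangement M H1 x + \<beta> * rearrangement M H2 x"
proof (rule ccontr)
  note [measurable] = core_decreasing_measurable[OF H(1)] core_decreasing_measurable[OF H(2)]
    core_decreasing_measurable[OF H(3)]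
  define a b where "a = rearrangement M H1 x" and "b = rearrangement M H2 x"
  assume "\<not> ?thesis"
  then have "ennreal x < emeasure M {u\<in>space M. \<alpha> * a + \<beta> * b < H u}"
    by (simp add: less_rearrangement_iff not_le a_def b_def)
  also have "\<dots> \<le> emeasure M ({u\<in>space M. a < H1 u} \<union> {u\<in>space M. b < H2 u})"
  proof (rule emeasure_mono_AE)
    show "AE u in M. u \<in> {u\<in>space M. \<alpha> * a + \<beta> * b < H u} \<longrightarrow> u \<in> {u\<in>space M. a < H1 u} \<union> {u\<in>space M. b < H2 u}"
      using le
    proof eventually_elim
      case (elim u)
      show ?case
      proof (rule impI, rule ccontr)
        assume "u \<in> {u\<in>space M. \<alpha> * a + \<beta> * b < H u}" "u \<notin> {u\<in>space M. a < H1 u} \<union> {u\<in>space M. b < H2 u}"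
        then have ab: "H1 u \<le> a" "H2 u \<le> b" and less: "\<alpha> * a + \<beta> * b < H u" by auto
        have "H u \<le> \<alpha> * a + \<beta> * b"
          using elim by (rule order_trans) (intro add_mono mult_left_mono ab; simp)
        from leD[OF this] less show False by (rule notE)
      qed
    qed
  qed simp
  also have "\<dots> \<le> ennreal x"
  proof -
    have 1: "emeasure M {u\<in>space M. a < H1 u} \<le> ennreal x"
      using less_rearrangement_iff[of H1 M a x] by (simp add: a_def not_less[symmetric])
    have 2: "emeasure M {u\<in>space M. b < H2 u} \<le> ennreal x"
      using less_rearrangement_iff[of H2 M b x] by (simp add: b_def not_less[symmetric])
    show ?thesis
      using down_set_chain[OF down_set_superlevel[OF H(2), of a] down_set_superlevel[OF H(3), of b]] 1 2
      by (auto simp: Un_absorb1 Un_absorb2)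
  qed
  finally show False by simp
qed

definition tilde :: "('a \<Rightarrow> real) \<Rightarrow> 'a \<Rightarrow> ennreal" where
  "tilde g = core_tilde M \<A> (\<lambda>v. ereal (g v))"

text \<open>Core decreasing majorants are closed under countable infima, so their essential infimum is one of them.\<close>

lemma least_majorant_exists: 
  assumes g: "g \<in> borel_measurable M"
  shows "\<exists>G. least_core_decreasing_majorant M \<A> (\<lambda>v. ereal (g v)) G"
proof -
  define W where "W = {h\<in>core_decreasing M \<A>. AE u in M. \<bar>ereal (g u)\<bar> \<le> enn2ereal (h u)}"
  have "h \<in> borel_measurable M" if "h \<in> W" for h using that core_decreasing_measurable by (auto simp: W_def)
  from essential_infimum[of W "\<lambda>h. h", OF this] obtain C where C: "C \<subseteq> W" "countable C"
    "\<forall>h\<in>W. AE u in M. (INF j\<in>C. j u) \<le> h u" by auto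
  have G: "(\<lambda>u. INF j\<in>C. j u) \<in> core_decreasing M \<A>"
    using C by (intro core_decreasing_INF) (auto simp: W_def)
  have "AE u in M. \<forall>j\<in>C. \<bar>ereal (g u)\<bar> \<le> enn2ereal (j u)"
    using C by (subst AE_ball_countable) (auto simp: W_def)
  then have maj: "AE u in M. \<bar>ereal (g u)\<bar> \<le> enn2ereal (INF j\<in>C. j u)"
  proof eventually_elim
    case (elim u)
    have "ennreal \<bar>g u\<bar> \<le> (INF j\<in>C. j u)"
      using elim by (intro INF_greatest) (simp add: less_eq_ennreal.rep_eq)
    then show ?case by (simp add: less_eq_ennreal.rep_eq)
  qed
  have least: "AE u in M. (INF j\<in>C. j u) \<le> h u"
    if "h \<in> core_decreasing M \<A>" "AE u in M. \<bar>ereal (g u)\<bar> \<le> enn2ereal (h u)" for h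
    by (rule C(3)[rule_format]) (unfold W_def, use that in blast)
  show ?thesis
    unfolding least_core_decreasing_majorant_def by (intro exI conjI ballI impI, rule G, rule maj, rule least)
qed

lemma
  assumes g: "g \<in> borel_measurable M"
  shows tilde_core_decreasing: "tilde g \<in> core_decreasing M \<A>"
    and tilde_majorant: "AE u in M. ennreal \<bar>g u\<bar> \<le> tilde g u"
    and tilde_least: "\<And>h. h \<in> core_decreasing M \<A> \<Longrightarrow> (AE u in M. ennreal \<bar>g u\<bar> \<le> h u) \<Longrightarrow>
      (AE u in M. tilde g u \<le> h u)"
proof -
  have "least_core_decreasing_majorant M \<A> (\<lambda>v. ereal (g v)) (tilde g)"
    unfolding tilde_def core_tilde_def using least_majorant_exists[OF g] by (rule someI_ex)
  then show "tilde g \<in> core_decreasing M \<A>" "AE u in M. ennreal \<bar>g u\<bar> \<le> tilde g u"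
    "\<And>h. h \<in> core_decreasing M \<A> \<Longrightarrow> (AE u in M. ennreal \<bar>g u\<bar> \<le> h u) \<Longrightarrow>
      (AE u in M. tilde g u \<le> h u)"
    unfolding least_core_decreasing_majorant_def by (simp_all add: less_eq_ennreal.rep_eq)
qed

lemma tilde_measurable [measurable]: "g \<in> borel_measurable M \<Longrightarrow> tilde g \<in> borel_measurable M"
  by (intro core_decreasing_measurable tilde_core_decreasing)

text \<open>Core decreasing functions form a cone closed under countable sums, and hence the sum of
  majorants is a competitor for the least majorant of the sum.\<close>

lemma tilde_suminf:
  assumes "f \<in> borel_measurable M" "\<And>n::nat. F n \<in> borel_measurable M"
    and "AE u in M. ennreal \<bar>f u\<bar> \<le> (\<Sum>n. ennreal \<bar>F n u\<bar>)"
  shows "AE u in M. tilde f u \<le> (\<Sum>n. tilde (F n) u)"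
proof (rule tilde_least[OF assms(1)])
  show "(\<lambda>u. \<Sum>n. tilde (F n) u) \<in> core_decreasing M \<A>"
    by (intro core_decreasing_suminf tilde_core_decreasing assms)
  have "AE u in M. \<forall>n. ennreal \<bar>F n u\<bar> \<le> tilde (F n) u"
    unfolding AE_all_countable using tilde_majorant assms(2) by auto
  then show "AE u in M. ennreal \<bar>f u\<bar> \<le> (\<Sum>n. tilde (F n) u)"
    using assms(3)
  proof eventually_elim
    case (elim u)
    note elim(2)
    also have "(\<Sum>n. ennreal \<bar>F n u\<bar>) \<le> (\<Sum>n. tilde (F n) u)" using elim(1) by (intro suminf_le) auto
    finally show ?case .
  qed
qed

lemma tilde_sublinear:
  assumes [measurable]: "f \<in> borel_measurable M" "g \<in> borel_measurable M" "h \<in> borel_measurable M"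
    and nonneg: "0 \<le> \<alpha>" "0 \<le> \<beta>"
    and le: "AE u in M. \<bar>f u\<bar> \<le> \<alpha> * \<bar>g u\<bar> + \<beta> * \<bar>h u\<bar>"
  shows "AE u in M. tilde f u \<le> ennreal \<alpha> * tilde g u + ennreal \<beta> * tilde h u"
proof (rule tilde_least)
  show "(\<lambda>u. ennreal \<alpha> * tilde g u + ennreal \<beta> * tilde h u) \<in> core_decreasing M \<A>"
    by (intro core_decreasing_add core_decreasing_cmult tilde_core_decreasing assms)
  show "AE u in M. ennreal \<bar>f u\<bar> \<le> ennreal \<alpha> * tilde g u + ennreal \<beta> * tilde h u"
    using le tilde_majorant[OF assms(2)] tilde_majorant[OF assms(3)]
  proof eventually_elim
    case (elim u)
    have "ennreal \<bar>f u\<bar> \<le> ennreal (\<alpha> * \<bar>g u\<bar> + \<beta> * \<bar>h u\<bar>)" using elim by (intro ennreal_leI)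
    also have "\<dots> = ennreal \<alpha> * ennreal \<bar>g u\<bar> + ennreal \<beta> * ennreal \<bar>h u\<bar>"
      using nonneg by (simp add: ennreal_mult)
    also have "\<dots> \<le> ennreal \<alpha> * tilde g u + ennreal \<beta> * tilde h u"
      using elim by (intro add_mono mult_left_mono) auto
    finally show ?case .
  qed
qed measurable

lemma tilde_scale_le:
  assumes [measurable]: "f \<in> borel_measurable M"
  shows "AE u in M. tilde (\<lambda>v. c * f v) u \<le> ennreal \<bar>c\<bar> * tilde f u"
  using tilde_sublinear[of "\<lambda>v. c * f v" f f "\<bar>c\<bar>" 0] by (simp add: abs_mult)

lemma tilde_scale:
  assumes [measurable]: "f \<in> borel_measurable M"
  shows "AE u in M. tilde (\<lambda>v. c * f v) u = ennreal \<bar>c\<bar> * tilde f u"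
proof (cases "c = 0")
  case True
  then show ?thesis using tilde_scale_le[OF assms, of c] by simp
next
  case False
  have "AE u in M. tilde (\<lambda>v. (1/c) * (c * f v)) u \<le> ennreal \<bar>1/c\<bar> * tilde (\<lambda>v. c * f v) u"
    by (rule tilde_scale_le) measurable
  then show ?thesis using tilde_scale_le[OF assms, of c]
  proof eventually_elim
    case (elim u)
    have "ennreal \<bar>c\<bar> * tilde f u \<le> ennreal \<bar>c\<bar> * (ennreal \<bar>1/c\<bar> * tilde (\<lambda>v. c * f v) u)"
      using elim(1) False by (intro mult_left_mono) auto
    also have "\<dots> = tilde (\<lambda>v. c * f v) u"
      using False by (simp add: mult.assoc[symmetric] flip: ennreal_mult)
    finally show ?case using elim(2) by simp
  qed
qed

end

section \<open>From the half-line back to the core\<close>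

lemma slope_antitone_left:
  assumes "antitone_slopes J" "0 \<le> r" "r \<le> s" "s < t"
  shows "(J t - J s) / (t - s) \<le> (J t - J r) / (t - r)"
proof (cases "r = s")
  case False
  then have "(J t - J s) * (s - r) \<le> (J s - J r) * (t - s)"
    using assms unfolding antitone_slopes_def by simp
  then have "(J t - J s) * (t - r) \<le> (J t - J r) * (t - s)" by (simp add: algebra_simps)
  then show ?thesis using assms by (simp add: divide_simps)
qed simp

lemma slope_antitone_right:
  assumes "antitone_slopes J" "0 \<le> r" "r < s" "s \<le> t"
  shows "(J t - J r) / (t - r) \<le> (J s - J r) / (s - r)"
proof (cases "s = t")
  case False
  then have "(J t - J s) * (s - r) \<le> (J s - J r) * (t - s)"
    using assms unfolding antitone_slopes_def by simp
  then have "(J t - J r) * (s - r) \<le> (J s - J r) * (t - r)" by (simp add: algebra_simps)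
  then show ?thesis using assms by (simp add: divide_simps)
qed simp

text \<open>A countable chain of down-sets of finite measure is used in place of the core itself: the core may be
  uncountable, and unions of uncountably many of its members need not be measurable.\<close>

locale chain_cover = core_space M \<A> for M :: "'a measure" and \<A> +
  fixes \<Q> :: "'a set set"
  assumes countable: "countable \<Q>"
    and down: "\<And>A. A \<in> \<Q> \<Longrightarrow> down_set A"
    and fin: "\<And>A. A \<in> \<Q> \<Longrightarrow> emeasure M A < \<infinity>"
    and empty: "{} \<in> \<Q>"
    and cover: "\<Union>\<Q> = space M"
begin

lemma \<Q>_sets [measurable]: "A \<in> \<Q> \<Longrightarrow> A \<in> sets M"
  using down down_set_sets by blast

lemma \<Q>_chain: "A \<in> \<Q> \<Longrightarrow> B \<in> \<Q> \<Longrightarrow> A \<subseteq> B \<or> B \<subseteq> A"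
  by (intro down_set_chain down)

lemma \<Q>_emeasure: "A \<in> \<Q> \<Longrightarrow> emeasure M A = ennreal (measure M A)"
  using fin by (intro emeasure_eq_ennreal_measure) (auto simp: less_top)

lemma \<Q>_mono: "A \<in> \<Q> \<Longrightarrow> B \<in> \<Q> \<Longrightarrow> A \<subseteq> B \<Longrightarrow> measure M A \<le> measure M B"
  using fin[of B] by (intro measure_mono_fmeasurable fmeasurableI) auto

text \<open>The measure of the part of the space that lies strictly before \<open>u\<close>, as seen by the members of \<open>\<Q>\<close>.\<close>

definition position :: "'a \<Rightarrow> real" where
  "position u = Sup (measure M ` {B\<in>\<Q>. u \<notin> B})"

lemma position_bdd:
  assumes u: "u \<in> space M"
  shows "bdd_above (measure M ` {B\<in>\<Q>. u \<notin> B})"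
proof -
  obtain A where A: "A \<in> \<Q>" "u \<in> A" using u cover by auto
  have "measure M B \<le> measure M A" if "B \<in> \<Q>" "u \<notin> B" for B
    using that A \<Q>_chain[of A B] by (intro \<Q>_mono) auto
  then show ?thesis by (intro bdd_aboveI[of _ "measure M A"]) auto
qed

lemma less_position_iff:
  "u \<in> space M \<Longrightarrow> x < position u \<longleftrightarrow> (\<exists>B\<in>\<Q>. u \<notin> B \<and> x < measure M B)"
  unfolding position_def using position_bdd[of u] empty by (subst less_cSup_iff) auto

lemma position_ge: "u \<in> space M \<Longrightarrow> B \<in> \<Q> \<Longrightarrow> u \<notin> B \<Longrightarrow> measure M B \<le> position u"
  unfolding position_def by (intro cSup_upper position_bdd) auto

lemma position_nonneg: "u \<in> space M \<Longrightarrow> 0 \<le> position u"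
  using position_ge[of u "{}"] empty by simp

lemma position_mono:
  assumes "core_le \<A> u v" "u \<in> space M" "v \<in> space M"
  shows "position u \<le> position v"
  unfolding position_def
proof (rule cSup_subset_mono)
  show "measure M ` {B\<in>\<Q>. u \<notin> B} \<noteq> {}" using empty by auto
  show "bdd_above (measure M ` {B\<in>\<Q>. v \<notin> B})" by (rule position_bdd) fact
  show "measure M ` {B\<in>\<Q>. u \<notin> B} \<subseteq> measure M ` {B\<in>\<Q>. v \<notin> B}"
    using assms down unfolding down_set_def by blast
qed

lemma position_measurable: "position \<in> borel_measurable core_algebra"
proof (rule borel_measurableI_greater)
  fix x
  have "{u \<in> space core_algebra. x < position u} = (\<Union>B\<in>{B\<in>\<Q>. x < measure M B}. space core_algebra - B)"
    by (auto simp: less_position_iff space_measure_of_conv)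
  also have "\<dots> \<in> sets core_algebra"
    using countable down by (intro sets.countable_UN'' sets.compl_sets) (auto simp: down_set_def simp del: sets_measure_of)
  finally show "{u \<in> space core_algebra. x < position u} \<in> sets core_algebra" .
qed

text \<open>The position of \<open>u \<in> A\<close> equals the measure of \<open>A\<close> only if members of \<open>\<Q>\<close> that omit \<open>u\<close> exhaust \<open>A\<close> up
  to arbitrarily small measure.  As \<open>\<Q>\<close> is a chain, all points with this property lie in sets of arbitrarily small measure.\<close>

lemma position_less_AE:
  assumes A: "A \<in> \<Q>"
  shows "AE u in M. u \<in> A \<longrightarrow> position u < measure M A"
proof -
  have [measurable]: "position \<in> borel_measurable M" by (intro borel_measurable_core_algebra position_measurable)
  define Z where "Z = {u\<in>space M. u \<in> A \<and> measure M A \<le> position u}"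
  have [measurable]: "A \<in> sets M" using A by simp
  have "emeasure M Z \<le> 0 + ennreal e" if e: "e > 0" for e
  proof -
    define \<Q>' where "\<Q>' = {B\<in>\<Q>. measure M A - e < measure M B}"
    have sub: "Z \<subseteq> (\<Union>B\<in>\<Q>'. A - B)"
    proof
      fix u assume u: "u \<in> Z"
      then have "measure M A - e < position u" using e by (simp add: Z_def)
      then obtain B where "B \<in> \<Q>" "u \<notin> B" "measure M A - e < measure M B"
        using u less_position_iff[of u] by (auto simp: Z_def)
      then show "u \<in> (\<Union>B\<in>\<Q>'. A - B)" using u by (auto simp: \<Q>'_def Z_def)
    qed
    show ?thesis
    proof (cases "\<Q>' = {}")
      case True
      then show ?thesis using sub by simp
    next
      case False
      define B where "B = from_nat_into \<Q>'"
      have cQ: "Countable_Set.countable \<Q>'" using countable by (simp add: \<Q>'_def)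
      have B: "B n \<in> \<Q>'" for n using False by (simp add: B_def from_nat_into)
      have rB: "range B = \<Q>'" using range_from_nat_into[OF False cQ] by (simp add: B_def)
      \<comment> \<open>Finite intersections of members of a chain are members, so the complements form an increasing sequence of sets of measure at most \<open>e\<close>.\<close>
      define C where "C = rec_nat (B 0) (\<lambda>n X. X \<inter> B (Suc n))"
      have C0: "C 0 = B 0" and CS: "C (Suc n) = C n \<inter> B (Suc n)" for n by (simp_all add: C_def)
      have C: "C n \<in> \<Q>'" for n
      proof (induction n)
        case (Suc n)
        then have "C n \<subseteq> B (Suc n) \<or> B (Suc n) \<subseteq> C n" using B[of "Suc n"] by (intro \<Q>_chain) (auto simp: \<Q>'_def)
        then have "C (Suc n) = C n \<or> C (Suc n) = B (Suc n)" by (auto simp: CS)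
        then show ?case using Suc B by metis
      qed (simp add: C0 B)
      have CB: "C n \<subseteq> B n" for n by (cases n) (auto simp: C0 CS)
      have "incseq (\<lambda>n. A - C n)" by (intro incseq_SucI) (auto simp: CS)
      moreover have "C n \<in> sets M" for n using C[of n] by (auto simp: \<Q>'_def)
      ultimately have "emeasure M (\<Union>n. A - C n) = (SUP n. emeasure M (A - C n))"
        by (intro SUP_emeasure_incseq[symmetric]) auto
      also have "\<dots> \<le> ennreal e"
      proof (rule SUP_least)
        fix n
        have Cn: "C n \<in> \<Q>" "measure M A - e < measure M (C n)" using C[of n] by (auto simp: \<Q>'_def)
        show "emeasure M (A - C n) \<le> ennreal e"
        proof (cases "C n \<subseteq> A")
          case True
          have "emeasure M (A - C n) = ennreal (measure M A - measure M (C n))"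
            using True A Cn by (subst emeasure_Diff) (auto simp: \<Q>_emeasure ennreal_minus)
          also have "\<dots> \<le> ennreal e" using Cn by (intro ennreal_leI) simp
          finally show ?thesis .
        next
          case False
          then have e: "A - C n = {}" using \<Q>_chain[OF A Cn(1)] by auto
          show ?thesis unfolding e by simp
        qed
      qed
      finally have "emeasure M (\<Union>n. A - C n) \<le> ennreal e" .
      moreover have "emeasure M Z \<le> emeasure M (\<Union>n. A - C n)"
      proof (rule emeasure_mono)
        show "Z \<subseteq> (\<Union>n. A - C n)" using sub CB rB by blast
        show "(\<Union>n. A - C n) \<in> sets M" using C by (intro sets.countable_UN) (auto simp: \<Q>'_def)
      qed
      ultimately show ?thesis by simp
    qed
  qed
  then have "emeasure M Z \<le> 0" by (rule ennreal_le_epsilon) auto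
  then have "Z \<in> null_sets M" by (auto simp: Z_def null_sets_def)
  then show ?thesis by (rule AE_I') (auto simp: Z_def not_less)
qed

text \<open>The value \<open>0\<close> where \<open>A\<close> is not admitted is neutral in suprema.\<close>

definition slope_at :: "(real \<Rightarrow> real) \<Rightarrow> 'a set \<Rightarrow> 'a \<Rightarrow> ennreal" where
  "slope_at J A u = (if u \<in> A \<and> position u < measure M A
     then ennreal ((J (measure M A) - J (position u)) / (measure M A - position u)) else 0)"

text \<open>For concave \<open>J\<close> the slopes increase as \<open>A\<close> shrinks towards \<open>u\<close>, so this is a right derivative of \<open>J\<close> at the position of
  \<open>u\<close>, except that a jump of the chain at \<open>u\<close> yields the mean slope over the jump.\<close>

definition transport :: "(real \<Rightarrow> real) \<Rightarrow> 'a \<Rightarrow> ennreal" where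
  "transport J u = (SUP A\<in>\<Q>. slope_at J A u)"

lemma slope_at_measurable:
  assumes "mono_on {0..} J" "A \<in> \<Q>"
  shows "slope_at J A \<in> borel_measurable core_algebra"
proof -
  have [measurable]: "A \<in> sets core_algebra" using down[OF assms(2)] by (simp only: down_set_def)
  note [measurable] = position_measurable
  have "mono (\<lambda>x. J (max 0 x))"
    using assms(1) by (intro monoI) (auto simp: mono_on_def max_def)
  then have [measurable]: "(\<lambda>x. J (max 0 x)) \<in> borel_measurable borel" by (rule borel_measurable_mono)
  have "(\<lambda>u. J (max 0 (position u))) \<in> borel_measurable core_algebra"
    by (rule measurable_compose[OF position_measurable]) measurable
  then have [measurable]: "(\<lambda>u. J (position u)) \<in> borel_measurable core_algebra"
    by (rule measurable_cong[THEN iffD1, rotated]) (use position_nonneg in \<open>simp add: space_measure_of_conv\<close>)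
  show ?thesis unfolding slope_at_def by measurable
qed

lemma transport_core_decreasing:
  assumes J: "mono_on {0..} J" "antitone_slopes J"
  shows "transport J \<in> core_decreasing M \<A>"
proof -
  have "slope_at J A \<in> core_decreasing M \<A>" if A: "A \<in> \<Q>" for A
    unfolding core_decreasing_iff
  proof (intro conjI ballI impI)
    show "slope_at J A \<in> borel_measurable core_algebra" by (rule slope_at_measurable[OF J(1) A])
    fix u v assume uv: "u \<in> space M" "v \<in> space M" "core_le \<A> u v"
    note pos = position_mono[OF uv(3,1,2)]
    show "slope_at J A v \<le> slope_at J A u"
    proof (cases "v \<in> A \<and> position v < measure M A")
      case True
      then have "u \<in> A" using uv down[OF A] unfolding down_set_def by blast
      then show ?thesis using True pos slope_antitone_left[OF J(2) _ pos] position_nonneg[OF uv(1)]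
        by (auto simp: slope_at_def intro!: ennreal_leI)
    qed (auto simp: slope_at_def)
  qed
  then show ?thesis unfolding transport_def by (intro core_decreasing_SUP countable)
qed

text \<open>For a finite chain the supremum is at most the mean slope of \<open>J\<close> over the block between consecutive members, and these
  contributions telescope.  The induction adds the largest set \<open>A\<close>; \<open>B\<close> is the largest of
  the others.  On \<open>B\<close> the chord to \<open>A\<close> is flatter than the chord to \<open>B\<close>, which is already counted.\<close>

lemma transport_integral_finite:
  assumes J: "mono_on {0..} J" "antitone_slopes J" "J 0 = 0"
    and S: "finite S" "S \<subseteq> \<Q>" and m: "0 \<le> m" "\<And>A. A \<in> S \<Longrightarrow> measure M A \<le> m"
  shows "(\<integral>\<^sup>+u. (SUP A\<in>S. slope_at J A u) \<partial>M) \<le> ennreal (J m)"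
  using S m
proof (induction S arbitrary: m rule: finite_ranking_induct[where f = "measure M"])
  case empty
  then show ?case by (simp add: bot_ennreal)
next
  case (insert A S)
  have Jmono: "J x \<le> J y" if "0 \<le> x" "x \<le> y" for x y using mono_onD[OF J(1)] that by auto
  obtain B where B: "B \<in> \<Q>" "B \<in> S \<or> B = {}" "\<And>C. C \<in> S \<Longrightarrow> measure M C \<le> measure M B" "measure M B \<le> measure M A"
  proof (cases "S = {}")
    case True
    then show ?thesis using that[of "{}"] empty by simp
  next
    case False
    then have "Max (measure M ` S) \<in> measure M ` S" using insert by (intro Max_in) auto
    then obtain B where B: "B \<in> S" "measure M B = Max (measure M ` S)" by (metis imageE)
    have "measure M C \<le> measure M B" if "C \<in> S" for C unfolding B(2) using that insert(1) by simp
    moreover have "measure M B \<le> measure M A" using insert(2)[OF B(1)] .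
    moreover have "B \<in> \<Q>" using B(1) insert by auto
    ultimately show ?thesis using that[of B] B(1) by blast
  qed
  have A: "A \<in> \<Q>" "S \<subseteq> \<Q>" using insert by auto
  have IH: "(\<integral>\<^sup>+u. (SUP A\<in>S. slope_at J A u) \<partial>M) \<le> ennreal (J (measure M B))"
    using B A by (intro "insert.IH") auto
  define k where "k = (J (measure M A) - J (measure M B)) / (measure M A - measure M B)"
  have k: "k \<ge> 0" using Jmono[of "measure M B" "measure M A"] B by (auto simp: k_def)
  have meas: "slope_at J C \<in> borel_measurable M" if "C \<in> \<Q>" for C
    by (intro borel_measurable_core_algebra slope_at_measurable J that)
  have "AE u in M. (SUP C\<in>insert A S. slope_at J C u) \<le> (SUP C\<in>S. slope_at J C u) + ennreal k * indicator (A - B) u"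
    using position_less_AE[OF B(1)] AE_space
  proof eventually_elim
    case (elim u)
    have "slope_at J A u \<le> (SUP C\<in>S. slope_at J C u) + ennreal k * indicator (A - B) u"
    proof (cases "u \<in> A \<and> position u < measure M A")
      case True
      show ?thesis
      proof (cases "u \<in> B")
        case uB: True
        then have "B \<in> S" using B(2) by auto
        have p: "position u < measure M B" using elim uB by simp
        have "slope_at J A u \<le> slope_at J B u"
          using True uB p slope_antitone_right[OF J(2) position_nonneg[OF elim(2)] p B(4)]
          by (auto simp: slope_at_def intro!: ennreal_leI)
        also have "\<dots> \<le> (SUP C\<in>S. slope_at J C u)" using \<open>B \<in> S\<close> by (rule SUP_upper)
        also have "\<dots> \<le> (SUP C\<in>S. slope_at J C u) + ennreal k * indicator (A - B) u" by simp
        finally show ?thesis .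
      next
        case False
        have "measure M B \<le> position u" using False B elim by (intro position_ge)
        then have "slope_at J A u \<le> ennreal k"
          using True slope_antitone_left[OF J(2), of "measure M B" "position u" "measure M A"]
          by (auto simp: slope_at_def k_def intro!: ennreal_leI)
        then show ?thesis using True False by (simp add: add_increasing)
      qed
    qed (auto simp: slope_at_def)
    then show ?case by simp
  qed
  then have "(\<integral>\<^sup>+u. (SUP C\<in>insert A S. slope_at J C u) \<partial>M)
      \<le> (\<integral>\<^sup>+u. (SUP C\<in>S. slope_at J C u) + ennreal k * indicator (A - B) u \<partial>M)"
    by (rule nn_integral_mono_AE)
  also have "\<dots> = (\<integral>\<^sup>+u. (SUP C\<in>S. slope_at J C u) \<partial>M) + ennreal k * emeasure M (A - B)"
    using A B meas insert(1) by (subst nn_integral_add) (auto intro!: borel_measurable_SUP countable_finite simp: nn_integral_cmult_indicator)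
  also have "\<dots> \<le> ennreal (J (measure M B)) + ennreal (J (measure M A) - J (measure M B))"
  proof (rule add_mono[OF IH])
    show "ennreal k * emeasure M (A - B) \<le> ennreal (J (measure M A) - J (measure M B))"
    proof (cases "measure M B < measure M A")
      case True
      then have "\<not> A \<subseteq> B" using \<Q>_mono[OF A(1) B(1)] by auto
      then have "B \<subseteq> A" using \<Q>_chain[OF A(1) B(1)] by auto
      then have "emeasure M (A - B) = ennreal (measure M A - measure M B)"
        using A B by (subst emeasure_Diff) (auto simp: \<Q>_emeasure ennreal_minus)
      then show ?thesis using k True by (simp add: k_def flip: ennreal_mult)
    next
      case False
      then show ?thesis using B(4) by (simp add: k_def)
    qed
  qed
  also have "\<dots> = ennreal (J (measure M A))"
    using Jmono[of 0 "measure M B"] Jmono[of "measure M B" "measure M A"] B J(3) by (simp flip: ennreal_plus)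
  also have "\<dots> \<le> ennreal (J m)" using insert by (intro ennreal_leI Jmono) auto
  finally show ?case .
qed

lemma transport_integral:
  assumes J: "mono_on {0..} J" "antitone_slopes J" "J 0 = 0"
    and c: "\<And>m. 0 \<le> m \<Longrightarrow> ennreal (J m) \<le> c"
  shows "(\<integral>\<^sup>+u. transport J u \<partial>M) \<le> c"
proof -
  define Q where "Q = from_nat_into \<Q>"
  have rQ: "range Q = \<Q>" using range_from_nat_into[OF _ countable] empty by (auto simp: Q_def)
  have meas: "slope_at J C \<in> borel_measurable M" if "C \<in> \<Q>" for C
    by (intro borel_measurable_core_algebra slope_at_measurable J that)
  have "transport J u = (SUP n. SUP A\<in>Q ` {..<n}. slope_at J A u)" for u
  proof -
    have "transport J u = (SUP A\<in>range Q. slope_at J A u)" by (simp only: transport_def rQ)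
    also have "\<dots> = (SUP i. slope_at J (Q i) u)" by (simp only: image_image)
    also have "\<dots> = (SUP n. SUP A\<in>Q ` {..<n}. slope_at J A u)"
    proof (rule antisym)
      show "(SUP i. slope_at J (Q i) u) \<le> (SUP n. SUP A\<in>Q ` {..<n}. slope_at J A u)"
        by (rule SUP_least, rule SUP_upper2[of "Suc _"]) (auto intro!: SUP_upper)
      show "(SUP n. SUP A\<in>Q ` {..<n}. slope_at J A u) \<le> (SUP i. slope_at J (Q i) u)"
        by (auto intro!: SUP_least intro: SUP_upper)
    qed
    finally show ?thesis .
  qed
  then have "(\<integral>\<^sup>+u. transport J u \<partial>M) = (\<integral>\<^sup>+u. (SUP n. SUP A\<in>Q ` {..<n}. slope_at J A u) \<partial>M)" by simp
  also have "\<dots> = (SUP n. \<integral>\<^sup>+u. (SUP A\<in>Q ` {..<n}. slope_at J A u) \<partial>M)"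
  proof (rule nn_integral_monotone_convergence_SUP)
    show "incseq (\<lambda>n u. SUP A\<in>Q ` {..<n}. slope_at J A u)"
      by (intro incseq_SucI le_funI SUP_subset_mono) auto
    show "(\<lambda>u. SUP A\<in>Q ` {..<n}. slope_at J A u) \<in> borel_measurable M" for n
      using rQ by (intro borel_measurable_SUP meas) auto
  qed
  also have "\<dots> \<le> c"
  proof (rule SUP_least)
    fix n
    define m where "m = Max (insert 0 (measure M ` Q ` {..<n}))"
    have m: "0 \<le> m" "\<And>A. A \<in> Q ` {..<n} \<Longrightarrow> measure M A \<le> m"
      unfolding m_def by (auto intro!: Max_ge)
    have "(\<integral>\<^sup>+u. (SUP A\<in>Q ` {..<n}. slope_at J A u) \<partial>M) \<le> ennreal (J m)"
      using rQ m by (intro transport_integral_finite J) auto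
    also have "\<dots> \<le> c" by (rule c[OF m(1)])
    finally show "(\<integral>\<^sup>+u. (SUP A\<in>Q ` {..<n}. slope_at J A u) \<partial>M) \<le> c" .
  qed
  finally show ?thesis .
qed

lemma transport_sublinear:
  assumes J: "mono_on {0..} J1" "mono_on {0..} J2" and nonneg: "0 \<le> \<alpha>" "0 \<le> \<beta>"
    and le: "mono_on {0..} (\<lambda>t. \<alpha> * J1 t + \<beta> * J2 t - J t)" and u: "u \<in> space M"
  shows "transport J u \<le> ennreal \<alpha> * transport J1 u + ennreal \<beta> * transport J2 u"
  unfolding transport_def[of J]
proof (rule SUP_least)
  fix A assume A: "A \<in> \<Q>"
  have "slope_at J A u \<le> ennreal \<alpha> * slope_at J1 A u + ennreal \<beta> * slope_at J2 A u"
  proof (cases "u \<in> A \<and> position u < measure M A")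
    case True
    let ?p = "position u" and ?m = "measure M A"
    have pm: "0 \<le> ?p" "?p \<le> ?m" using True position_nonneg[OF u] by auto
    define s1 s2 where "s1 = (J1 ?m - J1 ?p) / (?m - ?p)" and "s2 = (J2 ?m - J2 ?p) / (?m - ?p)"
    have s: "s1 \<ge> 0" "s2 \<ge> 0"
      using mono_onD[OF J(1), of ?p ?m] mono_onD[OF J(2), of ?p ?m] pm by (auto simp: s1_def s2_def)
    have "(J ?m - J ?p) / (?m - ?p) \<le> (\<alpha> * (J1 ?m - J1 ?p) + \<beta> * (J2 ?m - J2 ?p)) / (?m - ?p)"
      using mono_onD[OF le, of ?p ?m] True pm by (intro divide_right_mono) (auto simp: right_diff_distrib)
    also have "\<dots> = \<alpha> * s1 + \<beta> * s2" by (simp add: s1_def s2_def add_divide_distrib)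
    finally have "ennreal ((J ?m - J ?p) / (?m - ?p)) \<le> ennreal (\<alpha> * s1 + \<beta> * s2)"
      by (rule ennreal_leI)
    also have "\<dots> = ennreal \<alpha> * ennreal s1 + ennreal \<beta> * ennreal s2"
      using nonneg s by (simp add: ennreal_mult)
    finally show ?thesis using True by (simp add: slope_at_def s1_def s2_def)
  qed (auto simp: slope_at_def)
  also have "\<dots> \<le> ennreal \<alpha> * transport J1 u + ennreal \<beta> * transport J2 u"
    unfolding transport_def by (intro add_mono mult_left_mono SUP_upper A) auto
  finally show "slope_at J A u \<le> ennreal \<alpha> * transport J1 u + ennreal \<beta> * transport J2 u" .
qed

lemma transport_lipschitz:
  assumes "0 \<le> c" "mono_on {0..} (\<lambda>t. c * t - J t)" and u: "u \<in> space M"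
  shows "transport J u \<le> ennreal c"
  unfolding transport_def
proof (rule SUP_least)
  fix A assume A: "A \<in> \<Q>"
  show "slope_at J A u \<le> ennreal c"
  proof (cases "u \<in> A \<and> position u < measure M A")
    case True
    let ?p = "position u" and ?m = "measure M A"
    have "J ?m - J ?p \<le> c * (?m - ?p)"
      using mono_onD[OF assms(2), of ?p ?m] True position_nonneg[OF u] by (auto simp: right_diff_distrib)
    then show ?thesis using True by (simp add: slope_at_def pos_divide_le_eq ennreal_leI)
  qed (auto simp: slope_at_def)
qed

text \<open>Almost every point of \<open>A\<close> lies strictly before the end of \<open>A\<close>, so \<open>A\<close> itself is admitted in the supremum.\<close>

lemma transport_ge:
  assumes A: "A \<in> \<Q>" and q: "\<And>r. 0 \<le> r \<Longrightarrow> r < measure M A \<Longrightarrow> q * (measure M A - r) \<le> J (measure M A) - J r"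
  shows "AE u in M. u \<in> A \<longrightarrow> ennreal q \<le> transport J u"
  using position_less_AE[OF A] AE_space
proof eventually_elim
  case (elim u)
  show ?case
  proof
    assume u: "u \<in> A"
    then have p: "position u < measure M A" using elim by simp
    have "ennreal q \<le> slope_at J A u"
      using u p q[OF position_nonneg[OF elim(2)] p] by (simp add: slope_at_def pos_le_divide_eq ennreal_leI)
    also have "\<dots> \<le> transport J u" unfolding transport_def by (rule SUP_upper[OF A])
    finally show "ennreal q \<le> transport J u" .
  qed
qed

end

section \<open>The couple and its K-functional\<close>

context core_space
begin

abbreviation "tilde_norm \<equiv> (\<lambda>g. \<integral>\<^sup>+u. tilde g u \<partial>M)"
abbreviation "sup_norm \<equiv> (\<lambda>g. esssup M (\<lambda>u. ennreal \<bar>g u\<bar>))"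

lemma L1_function_norm: "function_norm M tilde_norm"
proof
  fix f and F :: "nat \<Rightarrow> 'a \<Rightarrow> real"
  assume f: "f \<in> borel_measurable M" "\<And>n. F n \<in> borel_measurable M"
    "AE u in M. ennreal \<bar>f u\<bar> \<le> (\<Sum>n. ennreal \<bar>F n u\<bar>)"
  have "tilde_norm f \<le> (\<integral>\<^sup>+u. (\<Sum>n. tilde (F n) u) \<partial>M)"
    by (intro nn_integral_mono_AE tilde_suminf f)
  also have "\<dots> = (\<Sum>n. tilde_norm (F n))" using f by (intro nn_integral_suminf) auto
  finally show "tilde_norm f \<le> (\<Sum>n. tilde_norm (F n))" .
next
  fix f :: "'a \<Rightarrow> real" and c assume f: "f \<in> borel_measurable M"
  have "tilde_norm (\<lambda>u. c * f u) = (\<integral>\<^sup>+u. ennreal \<bar>c\<bar> * tilde f u \<partial>M)"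
    by (intro nn_integral_cong_AE tilde_scale f)
  also have "\<dots> = ennreal \<bar>c\<bar> * tilde_norm f" using f by (intro nn_integral_cmult) auto
  finally show "tilde_norm (\<lambda>u. c * f u) = ennreal \<bar>c\<bar> * tilde_norm f" .
next
  fix F :: "nat \<Rightarrow> 'a \<Rightarrow> real"
  assume F: "\<And>n. F n \<in> borel_measurable M" "(\<Sum>n. tilde_norm (F n)) < \<infinity>"
  have "(\<integral>\<^sup>+u. (\<Sum>n. tilde (F n) u) \<partial>M) = (\<Sum>n. tilde_norm (F n))" using F by (intro nn_integral_suminf) auto
  then have "AE u in M. (\<Sum>n. tilde (F n) u) \<noteq> \<infinity>"
    using F by (intro nn_integral_PInf_AE) auto
  moreover have "AE u in M. \<forall>n. ennreal \<bar>F n u\<bar> \<le> tilde (F n) u"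
    unfolding AE_all_countable using tilde_majorant F by auto
  ultimately show "AE u in M. (\<Sum>n. ennreal \<bar>F n u\<bar>) < \<infinity>"
  proof eventually_elim
    case (elim u)
    have "(\<Sum>n. ennreal \<bar>F n u\<bar>) \<le> (\<Sum>n. tilde (F n) u)" using elim by (intro suminf_le) auto
    also have "\<dots> < \<infinity>" using elim by (simp add: less_top)
    finally show ?case .
  qed
qed

lemma Linfty_AE: "AE u in M. ennreal \<bar>g u\<bar> \<le> sup_norm g"
  by (rule esssup_AE)

lemma Linfty_le:
  assumes [measurable]: "g \<in> borel_measurable M" and "AE u in M. ennreal \<bar>g u\<bar> \<le> c"
  shows "sup_norm g \<le> c"
  by (rule esssup_I) (use assms in measurable)

lemma Linfty_scale_le:
  assumes [measurable]: "f \<in> borel_measurable M"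
  shows "sup_norm (\<lambda>u. c * f u) \<le> ennreal \<bar>c\<bar> * sup_norm f"
proof (rule Linfty_le)
  show "AE u in M. ennreal \<bar>c * f u\<bar> \<le> ennreal \<bar>c\<bar> * sup_norm f"
    using Linfty_AE[of f] by eventually_elim (auto simp: abs_mult ennreal_mult intro: mult_left_mono)
qed measurable

lemma Linfty_function_norm: "function_norm M sup_norm"
proof
  fix f and F :: "nat \<Rightarrow> 'a \<Rightarrow> real"
  assume f: "f \<in> borel_measurable M" "\<And>n. F n \<in> borel_measurable M"
    "AE u in M. ennreal \<bar>f u\<bar> \<le> (\<Sum>n. ennreal \<bar>F n u\<bar>)"
  have "AE u in M. \<forall>n. ennreal \<bar>F n u\<bar> \<le> sup_norm (F n)"
    unfolding AE_all_countable using Linfty_AE by auto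
  then have "AE u in M. ennreal \<bar>f u\<bar> \<le> (\<Sum>n. sup_norm (F n))"
    using f(3)
  proof eventually_elim
    case (elim u)
    note elim(2)
    also have "(\<Sum>n. ennreal \<bar>F n u\<bar>) \<le> (\<Sum>n. sup_norm (F n))" using elim(1) by (intro suminf_le) auto
    finally show ?case .
  qed
  then show "sup_norm f \<le> (\<Sum>n. sup_norm (F n))" by (rule Linfty_le[OF f(1)])
next
  fix f :: "'a \<Rightarrow> real" and c assume f [measurable]: "f \<in> borel_measurable M"
  show "sup_norm (\<lambda>u. c * f u) = ennreal \<bar>c\<bar> * sup_norm f"
  proof (rule antisym[OF Linfty_scale_le[OF f]])
    show "ennreal \<bar>c\<bar> * sup_norm f \<le> sup_norm (\<lambda>u. c * f u)"
    proof (cases "c = 0")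
      case False
      have "ennreal \<bar>c\<bar> * sup_norm (\<lambda>u. (1/c) * (c * f u)) \<le> ennreal \<bar>c\<bar> * (ennreal \<bar>1/c\<bar> * sup_norm (\<lambda>u. c * f u))"
        by (intro mult_left_mono Linfty_scale_le) auto
      also have "\<dots> = sup_norm (\<lambda>u. c * f u)"
        using False by (simp add: mult.assoc[symmetric] flip: ennreal_mult)
      finally show ?thesis using False by simp
    qed simp
  qed
next
  fix F :: "nat \<Rightarrow> 'a \<Rightarrow> real"
  assume F: "(\<Sum>n. sup_norm (F n)) < \<infinity>"
  have "AE u in M. \<forall>n. ennreal \<bar>F n u\<bar> \<le> sup_norm (F n)"
    unfolding AE_all_countable using Linfty_AE by auto
  then show "AE u in M. (\<Sum>n. ennreal \<bar>F n u\<bar>) < \<infinity>"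
  proof eventually_elim
    case (elim u)
    have "(\<Sum>n. ennreal \<bar>F n u\<bar>) \<le> (\<Sum>n. sup_norm (F n))" using elim by (intro suminf_le) auto
    then show ?case using F by (rule order_le_less_trans)
  qed
qed

abbreviation "X0 \<equiv> L1_tilde M \<A>"
abbreviation "X1 \<equiv> Linfty M"

lemma X0_eq: "X0 = function_norm.finite_norm_space M tilde_norm"
  unfolding function_norm.finite_norm_space_def[OF L1_function_norm] L1_tilde_def unfolding tilde_def ..

lemma X1_eq: "X1 = function_norm.finite_norm_space M sup_norm"
  unfolding Linfty_def function_norm.finite_norm_space_def[OF Linfty_function_norm] ..

lemma X0_elems: "f \<in> elems X0 \<longleftrightarrow> f \<in> borel_measurable M \<and> tilde_norm f < \<infinity>"
  and X0_norm: "f \<in> elems X0 \<Longrightarrow> ennreal (fnorm X0 f) = tilde_norm f"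
  by (auto simp: L1_tilde_def tilde_def)

lemma X1_elems: "f \<in> elems X1 \<longleftrightarrow> f \<in> borel_measurable M \<and> sup_norm f < \<infinity>"
  and X1_norm: "f \<in> elems X1 \<Longrightarrow> ennreal (fnorm X1 f) = sup_norm f"
  by (auto simp: Linfty_def)

lemma X0_norm_nonneg: "0 \<le> fnorm X0 f" and X1_norm_nonneg: "0 \<le> fnorm X1 f"
  by (simp_all add: L1_tilde_def Linfty_def)

lemma X0_embeds: "embeds_in_measure M X0"
  unfolding embeds_in_measure_def
proof (intro allI impI ballI, elim conjE)
  fix F :: "nat \<Rightarrow> 'a \<Rightarrow> real" and E and \<epsilon> :: real
  assume F: "\<forall>n. F n \<in> elems X0" "(\<lambda>n. fnorm X0 (F n)) \<longlonglongrightarrow> 0" and E: "E \<in> sets M" and \<epsilon>: "\<epsilon> > 0"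
  have le: "emeasure M {u\<in>E. \<bar>F n u\<bar> > \<epsilon>} \<le> ennreal ((1 / \<epsilon>) * fnorm X0 (F n))" for n
  proof -
    have Fn [measurable]: "F n \<in> borel_measurable M" using F(1) by (auto simp: X0_elems)
    have m: "{u\<in>E. \<bar>F n u\<bar> > \<epsilon>} \<in> sets M"
    proof -
      have "{u\<in>E. \<bar>F n u\<bar> > \<epsilon>} = E \<inter> {u\<in>space M. \<bar>F n u\<bar> > \<epsilon>}" using sets.sets_into_space[OF E] by auto
      also have "\<dots> \<in> sets M" using E by measurable
      finally show ?thesis .
    qed
    have "ennreal \<epsilon> * emeasure M {u\<in>E. \<bar>F n u\<bar> > \<epsilon>} = (\<integral>\<^sup>+u. ennreal \<epsilon> * indicator {u\<in>E. \<bar>F n u\<bar> > \<epsilon>} u \<partial>M)"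
      using m by (simp add: nn_integral_cmult_indicator)
    also have "\<dots> \<le> tilde_norm (F n)"
    proof (rule nn_integral_mono_AE)
      show "AE u in M. ennreal \<epsilon> * indicator {u\<in>E. \<bar>F n u\<bar> > \<epsilon>} u \<le> tilde (F n) u"
        using tilde_majorant[OF Fn]
      proof eventually_elim
        case (elim u)
        show ?case
        proof (cases "u \<in> E \<and> \<bar>F n u\<bar> > \<epsilon>")
          case True
          then have "ennreal \<epsilon> \<le> ennreal \<bar>F n u\<bar>" by (intro ennreal_leI) simp
          also note elim
          finally show ?thesis using True by simp
        qed auto
      qed
    qed
    finally have "ennreal \<epsilon> * emeasure M {u\<in>E. \<bar>F n u\<bar> > \<epsilon>} \<le> ennreal (fnorm X0 (F n))"
      using F(1) by (simp add: X0_norm)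
    then have "ennreal (1 / \<epsilon>) * (ennreal \<epsilon> * emeasure M {u\<in>E. \<bar>F n u\<bar> > \<epsilon>}) \<le> ennreal (1 / \<epsilon>) * ennreal (fnorm X0 (F n))"
      by (intro mult_left_mono) auto
    moreover have "ennreal (1 / \<epsilon>) * (ennreal \<epsilon> * emeasure M {u\<in>E. \<bar>F n u\<bar> > \<epsilon>}) = emeasure M {u\<in>E. \<bar>F n u\<bar> > \<epsilon>}"
      using \<epsilon> by (simp add: mult.assoc[symmetric] flip: ennreal_mult)
    moreover have "ennreal (1 / \<epsilon>) * ennreal (fnorm X0 (F n)) = ennreal ((1 / \<epsilon>) * fnorm X0 (F n))"
      using \<epsilon> X0_norm_nonneg by (intro ennreal_mult[symmetric]) auto
    ultimately show ?thesis by (simp only:)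
  qed
  have "(\<lambda>n. ennreal ((1 / \<epsilon>) * fnorm X0 (F n))) \<longlonglongrightarrow> ennreal ((1 / \<epsilon>) * 0)"
    by (intro tendsto_ennrealI tendsto_mult_left F(2))
  then have lim: "(\<lambda>n. ennreal ((1 / \<epsilon>) * fnorm X0 (F n))) \<longlonglongrightarrow> 0" by simp
  show "(\<lambda>n. emeasure M {u\<in>E. \<bar>F n u\<bar> > \<epsilon>}) \<longlonglongrightarrow> 0"
    by (rule tendsto_sandwich[OF _ _ tendsto_const lim]) (use le in auto)
qed

lemma X1_embeds: "embeds_in_measure M X1"
  unfolding embeds_in_measure_def
proof (intro allI impI ballI, elim conjE)
  fix F :: "nat \<Rightarrow> 'a \<Rightarrow> real" and E and \<epsilon> :: real
  assume F: "\<forall>n. F n \<in> elems X1" "(\<lambda>n. fnorm X1 (F n)) \<longlonglongrightarrow> 0" and E: "E \<in> sets M" and \<epsilon>: "\<epsilon> > 0"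
  have "\<forall>\<^sub>F n in sequentially. fnorm X1 (F n) < \<epsilon>"
    using order_tendstoD(2)[OF F(2) \<epsilon>] .
  then have "\<forall>\<^sub>F n in sequentially. emeasure M {u\<in>E. \<bar>F n u\<bar> > \<epsilon>} = 0"
  proof eventually_elim
    case (elim n)
    have Fn [measurable]: "F n \<in> borel_measurable M" using F(1) by (auto simp: X1_elems)
    have "AE u in M. \<not> (u \<in> E \<and> \<bar>F n u\<bar> > \<epsilon>)"
      using Linfty_AE[of "F n"]
    proof eventually_elim
      case (elim u)
      then have "ennreal \<bar>F n u\<bar> \<le> ennreal (fnorm X1 (F n))" using F(1) by (simp add: X1_norm)
      then have "\<bar>F n u\<bar> \<le> fnorm X1 (F n)" using X1_norm_nonneg by (simp add: ennreal_le_iff)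
      then show ?case using \<open>fnorm X1 (F n) < \<epsilon>\<close> by simp
    qed
    moreover have "{u\<in>E. \<bar>F n u\<bar> > \<epsilon>} = {u\<in>space M. u \<in> E \<and> \<bar>F n u\<bar> > \<epsilon>}"
      using sets.sets_into_space[OF E] by auto
    moreover have "{u\<in>space M. u \<in> E \<and> \<bar>F n u\<bar> > \<epsilon>} \<in> sets M" using E by measurable
    ultimately show ?case by (simp add: AE_iff_measurable)
  qed
  then show "(\<lambda>n. emeasure M {u\<in>E. \<bar>F n u\<bar> > \<epsilon>}) \<longlonglongrightarrow> 0"
    by (rule tendsto_eventually)
qed

theorem compatible: "compatible_couple M X0 X1"
  unfolding compatible_couple_def
  using function_norm.banach[OF L1_function_norm] function_norm.banach[OF Linfty_function_norm] X0_embeds X1_embeds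
  by (simp add: X0_eq X1_eq)

abbreviation "X \<equiv> couple_sum M X0 X1"

lemma X_decompose:
  assumes "f \<in> X"
  obtains f0 f1 where "f0 \<in> elems X0" "f1 \<in> elems X1" "AE u in M. f0 u + f1 u = f u"
  using assms by (auto simp: couple_sum_def)

lemma X_measurable [measurable_dest]: "f \<in> X \<Longrightarrow> f \<in> borel_measurable M"
  by (simp add: couple_sum_def)

lemma X0_zero: "(\<lambda>u. 0) \<in> elems X0" and X1_zero: "(\<lambda>u. 0) \<in> elems X1"
  using compatible by (auto simp: compatible_couple_def banach_fun_space_def)

lemma X0_subset: "f \<in> elems X0 \<Longrightarrow> f \<in> X"
  unfolding couple_sum_def
  by (intro CollectI conjI, simp add: X0_elems, rule bexI[of _ f], rule bexI[OF _ X1_zero]) auto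

lemma X1_subset: "f \<in> elems X1 \<Longrightarrow> f \<in> X"
  unfolding couple_sum_def
  by (intro CollectI conjI, simp add: X1_elems, rule bexI[OF _ X0_zero], rule bexI[of _ f]) auto

lemma X_add:
  assumes "f \<in> X" "g \<in> X"
  shows "(\<lambda>u. f u + g u) \<in> X"
proof -
  obtain f0 f1 where f: "f0 \<in> elems X0" "f1 \<in> elems X1" "AE u in M. f0 u + f1 u = f u"
    by (rule X_decompose[OF assms(1)])
  obtain g0 g1 where g: "g0 \<in> elems X0" "g1 \<in> elems X1" "AE u in M. g0 u + g1 u = g u"
    by (rule X_decompose[OF assms(2)])
  have s: "(\<lambda>u. f0 u + g0 u) \<in> elems X0" "(\<lambda>u. f1 u + g1 u) \<in> elems X1"
    using compatible f g by (auto simp: compatible_couple_def banach_fun_space_def)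
  have "AE u in M. (f0 u + g0 u) + (f1 u + g1 u) = f u + g u"
    using f(3) g(3) by eventually_elim simp
  moreover have "(\<lambda>u. f u + g u) \<in> borel_measurable M"
    using X_measurable[OF assms(1)] X_measurable[OF assms(2)] by measurable
  ultimately show ?thesis unfolding couple_sum_def by (intro CollectI conjI bexI[OF _ s(1)] bexI[OF _ s(2)])
qed

lemma X_scale:
  assumes "f \<in> X"
  shows "(\<lambda>u. c * f u) \<in> X"
proof -
  obtain f0 f1 where f: "f0 \<in> elems X0" "f1 \<in> elems X1" "AE u in M. f0 u + f1 u = f u"
    by (rule X_decompose[OF assms(1)])
  have c: "(\<lambda>u. c * f0 u) \<in> elems X0" "(\<lambda>u. c * f1 u) \<in> elems X1"
    using compatible f by (auto simp: compatible_couple_def banach_fun_space_def)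
  have "AE u in M. c * f0 u + c * f1 u = c * f u"
    using f(3) by eventually_elim (simp add: distrib_left[symmetric])
  moreover have "(\<lambda>u. c * f u) \<in> borel_measurable M" using X_measurable[OF assms] by measurable
  ultimately show ?thesis unfolding couple_sum_def by (intro CollectI conjI bexI[OF _ c(1)] bexI[OF _ c(2)])
qed

abbreviation \<eta> :: "('a \<Rightarrow> real) \<Rightarrow> real \<Rightarrow> ennreal" where "\<eta> h \<equiv> rearrangement M (tilde h)"
abbreviation J :: "('a \<Rightarrow> real) \<Rightarrow> real \<Rightarrow> real" where "J h \<equiv> primitive (\<eta> h)"

text \<open>A bounded function adds only a constant to the majorant, and a constant adds only a constant to
  the rearrangement.\<close>

lemma \<eta>_decompose:
  assumes f: "f \<in> borel_measurable M" "f0 \<in> elems X0" "f1 \<in> elems X1" "AE u in M. f0 u + f1 u = f u"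
  shows "\<eta> f x \<le> \<eta> f0 x + ennreal (fnorm X1 f1)"
proof -
  have m: "f0 \<in> borel_measurable M" using f by (simp add: X0_elems)
  have "AE u in M. tilde f u \<le> 1 * tilde f0 u + 1 * ennreal (fnorm X1 f1)"
  proof (rule tilde_least[OF f(1)])
    show "(\<lambda>u. 1 * tilde f0 u + 1 * ennreal (fnorm X1 f1)) \<in> core_decreasing M \<A>"
      by (intro core_decreasing_add core_decreasing_cmult tilde_core_decreasing core_decreasing_const m)
    show "AE u in M. ennreal \<bar>f u\<bar> \<le> 1 * tilde f0 u + 1 * ennreal (fnorm X1 f1)"
      using tilde_majorant[OF m] Linfty_AE[of f1] f(4)
    proof eventually_elim
      case (elim u)
      have "ennreal \<bar>f u\<bar> \<le> ennreal (\<bar>f0 u\<bar> + \<bar>f1 u\<bar>)" using elim(3) by (intro ennreal_leI) linarith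
      also have "\<dots> = ennreal \<bar>f0 u\<bar> + ennreal \<bar>f1 u\<bar>" by (rule ennreal_plus) auto
      also have "\<dots> \<le> tilde f0 u + ennreal (fnorm X1 f1)"
        using elim(1,2) by (intro add_mono) (simp_all add: X1_norm[OF f(3)])
      finally show ?case by simp
    qed
  qed
  then have "\<eta> f x \<le> 1 * \<eta> f0 x + 1 * rearrangement M (\<lambda>u. ennreal (fnorm X1 f1)) x"
    by (intro rearrangement_sublinear tilde_core_decreasing core_decreasing_const m f)
  also have "\<dots> \<le> 1 * \<eta> f0 x + 1 * ennreal (fnorm X1 f1)"
    by (intro add_left_mono mult_left_mono rearrangement_const) auto
  finally show ?thesis by simp
qed

lemma nn_integral_\<eta>_decompose:
  assumes f: "f \<in> borel_measurable M" "f0 \<in> elems X0" "f1 \<in> elems X1" "AE u in M. f0 u + f1 u = f u" and t: "0 \<le> t"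
  shows "(\<integral>\<^sup>+x. \<eta> f x * indicator {0<..t} x \<partial>lborel) \<le> ennreal (fnorm X0 f0 + t * fnorm X1 f1)"
proof -
  have [measurable]: "f0 \<in> borel_measurable M" using f by (simp add: X0_elems)
  have "(\<integral>\<^sup>+x. \<eta> f x * indicator {0<..t} x \<partial>lborel)
      \<le> (\<integral>\<^sup>+x. \<eta> f0 x * indicator {0<..} x + ennreal (fnorm X1 f1) * indicator {0<..t} x \<partial>lborel)"
    using \<eta>_decompose[OF f] by (intro nn_integral_mono) (auto simp: indicator_def)
  also have "\<dots> = tilde_norm f0 + ennreal (fnorm X1 f1) * ennreal t"
    using t by (subst nn_integral_add) (auto simp: nn_integral_rearrangement nn_integral_cmult_indicator)
  also have "\<dots> = ennreal (fnorm X0 f0 + t * fnorm X1 f1)"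
    using t X0_norm_nonneg X1_norm_nonneg by (simp add: X0_norm[OF f(2), symmetric] ennreal_mult mult.commute)
  finally show ?thesis .
qed

lemma \<eta>_locally_integrable:
  assumes "f \<in> X"
  shows "locally_integrable_antitone (\<eta> f)"
proof
  have [measurable]: "f \<in> borel_measurable M" using assms by (rule X_measurable)
  show "\<eta> f \<in> borel_measurable borel" by measurable
  show "\<eta> f y \<le> \<eta> f x" if "x \<le> y" for x y by (rule rearrangement_antitone[OF that])
  fix t :: real
  obtain f0 f1 where f: "f0 \<in> elems X0" "f1 \<in> elems X1" "AE u in M. f0 u + f1 u = f u"
    by (rule X_decompose[OF assms(1)])
  show "(\<integral>\<^sup>+x. \<eta> f x * indicator {0<..t} x \<partial>lborel) < \<infinity>"
  proof (cases "0 \<le> t")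
    case True
    show ?thesis using nn_integral_\<eta>_decompose[OF _ f True] by (auto intro: order_le_less_trans)
  qed simp
qed

lemma J_le_integral:
  assumes "f \<in> X"
  shows "ennreal (J f t) \<le> tilde_norm f"
proof -
  have [measurable]: "f \<in> borel_measurable M" using assms by (rule X_measurable)
  have "ennreal (J f t) = (\<integral>\<^sup>+x. \<eta> f x * indicator {0<..t} x \<partial>lborel)"
    by (rule locally_integrable_antitone.ennreal_primitive[OF \<eta>_locally_integrable[OF assms]])
  also have "\<dots> \<le> (\<integral>\<^sup>+x. \<eta> f x * indicator {0<..} x \<partial>lborel)"
    by (intro nn_integral_mono) (auto simp: indicator_def)
  also have "\<dots> = tilde_norm f" by (rule nn_integral_rearrangement[symmetric]) measurable
  finally show ?thesis .
qed

lemma J_le_K: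
  assumes f: "f \<in> X" and t: "0 < t"
  shows "J f t \<le> K_functional M X0 X1 f t"
  unfolding K_functional_def
proof (rule cInf_greatest)
  show "{fnorm X0 f0 + t * fnorm X1 f1 |f0 f1. f0 \<in> elems X0 \<and> f1 \<in> elems X1 \<and> (AE u in M. f0 u + f1 u = f u)} \<noteq> {}"
    using X_decompose[OF f] by blast
next
  fix k assume "k \<in> {fnorm X0 f0 + t * fnorm X1 f1 |f0 f1. f0 \<in> elems X0 \<and> f1 \<in> elems X1 \<and> (AE u in M. f0 u + f1 u = f u)}"
  then obtain f0 f1 where k: "k = fnorm X0 f0 + t * fnorm X1 f1"
    and f01: "f0 \<in> elems X0" "f1 \<in> elems X1" "AE u in M. f0 u + f1 u = f u" by auto
  have "ennreal (J f t) \<le> ennreal k"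
    using nn_integral_\<eta>_decompose[OF X_measurable[OF f] f01, of t] t
      locally_integrable_antitone.ennreal_primitive[OF \<eta>_locally_integrable[OF f], of t] by (simp add: k)
  moreover have "0 \<le> k" using t X0_norm_nonneg X1_norm_nonneg by (simp add: k)
  ultimately show "J f t \<le> k" by (simp add: ennreal_le_iff)
qed

text \<open>The truncation \<open>g1\<close> of \<open>g\<close> at the height \<open>s = \<eta> g t\<close> has norm at most \<open>s\<close>.  The majorant of the remainder is at most
  the excess of the majorant of \<open>g\<close> over \<open>s\<close>, whose rearrangement vanishes beyond \<open>t\<close>.\<close>

lemma K_le_J:
  assumes g: "g \<in> X" and t: "0 < t"
  shows "K_functional M X0 X1 g t \<le> J g t"
proof -
  have [measurable]: "g \<in> borel_measurable M" using g by (rule X_measurable)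
  interpret lia: locally_integrable_antitone "\<eta> g" by (rule \<eta>_locally_integrable[OF g])
  define s where "s = enn2real (\<eta> g t)"
  have s: "0 \<le> s" "ennreal s = \<eta> g t" using lia.finite[OF t] by (auto simp: s_def)
  define g1 where "g1 u = max (-s) (min s (g u))" for u
  define g0 where "g0 u = g u - g1 u" for u
  have [measurable]: "g1 \<in> borel_measurable M" "g0 \<in> borel_measurable M" unfolding g0_def g1_def by measurable
  have g1: "\<bar>g1 u\<bar> \<le> s" for u using s by (auto simp: g1_def)
  have g0: "\<bar>g0 u\<bar> = max 0 (\<bar>g u\<bar> - s)" for u using s by (auto simp: g0_def g1_def)
  have "AE u in M. tilde g0 u \<le> tilde g u - ennreal s"
  proof (rule tilde_least)
    show "(\<lambda>u. tilde g u - ennreal s) \<in> core_decreasing M \<A>"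
      by (intro core_decreasing_diff tilde_core_decreasing) measurable
    show "AE u in M. ennreal \<bar>g0 u\<bar> \<le> tilde g u - ennreal s"
      using tilde_majorant[of g]
    proof (rule eventually_mono)
      fix u assume "ennreal \<bar>g u\<bar> \<le> tilde g u"
      then have "ennreal \<bar>g u\<bar> - ennreal s \<le> tilde g u - ennreal s" by (rule ennreal_minus_mono) simp
      moreover have "ennreal \<bar>g0 u\<bar> = ennreal \<bar>g u\<bar> - ennreal s"
        using s(1) by (simp add: g0 ennreal_minus max_def ennreal_neg)
      ultimately show "ennreal \<bar>g0 u\<bar> \<le> tilde g u - ennreal s" by simp
    qed measurable
  qed measurable
  then have "tilde_norm g0 \<le> (\<integral>\<^sup>+u. tilde g u - ennreal s \<partial>M)" by (rule nn_integral_mono_AE)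
  also have "\<dots> = (\<integral>\<^sup>+x. rearrangement M (\<lambda>u. tilde g u - ennreal s) x * indicator {0<..} x \<partial>lborel)"
    by (rule nn_integral_rearrangement) measurable
  also have "\<dots> \<le> (\<integral>\<^sup>+x. (\<eta> g x - ennreal s) * indicator {0<..t} x \<partial>lborel)"
  proof (rule nn_integral_mono)
    fix x
    have le: "rearrangement M (\<lambda>u. tilde g u - ennreal s) x \<le> \<eta> g x - ennreal s"
      by (rule rearrangement_diff) measurable
    have "\<eta> g x - ennreal s = 0" if "t < x"
    proof -
      have "\<eta> g x \<le> ennreal s" unfolding s(2) using that by (intro lia.anti) simp
      moreover from this have "\<eta> g x < top" by (rule order_le_less_trans) simp
      ultimately show ?thesis by (simp only: diff_eq_0_iff_ennreal)
    qed
    then show "rearrangement M (\<lambda>u. tilde g u - ennreal s) x * indicator {0<..} x \<le> (\<eta> g x - ennreal s) * indicator {0<..t} x"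
      using le by (auto simp: indicator_def not_le)
  qed
  finally have "tilde_norm g0 + ennreal s * ennreal t
      \<le> (\<integral>\<^sup>+x. (\<eta> g x - ennreal s) * indicator {0<..t} x \<partial>lborel) + (\<integral>\<^sup>+x. ennreal s * indicator {0<..t} x \<partial>lborel)"
    using t by (intro add_mono) (auto simp: nn_integral_cmult_indicator)
  also have "\<dots> = (\<integral>\<^sup>+x. (\<eta> g x - ennreal s) * indicator {0<..t} x + ennreal s * indicator {0<..t} x \<partial>lborel)"
    by (rule nn_integral_add[symmetric]) measurable
  also have "\<dots> = (\<integral>\<^sup>+x. \<eta> g x * indicator {0<..t} x \<partial>lborel)"
  proof (rule nn_integral_cong)
    fix x
    have "\<eta> g x - ennreal s + ennreal s = \<eta> g x" if "x \<le> t"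
      using lia.anti[OF that] s by (simp add: diff_add_cancel_ennreal)
    then show "(\<eta> g x - ennreal s) * indicator {0<..t} x + ennreal s * indicator {0<..t} x = \<eta> g x * indicator {0<..t} x"
      by (auto simp: indicator_def)
  qed
  also have "\<dots> = ennreal (J g t)" by (rule lia.ennreal_primitive[symmetric])
  finally have le: "tilde_norm g0 + ennreal s * ennreal t \<le> ennreal (J g t)" .
  have "tilde_norm g0 \<le> tilde_norm g0 + ennreal s * ennreal t" by simp
  also note le
  also have "ennreal (J g t) < \<infinity>" by simp
  finally have "tilde_norm g0 < \<infinity>" .
  then have g0X: "g0 \<in> elems X0" by (simp add: X0_elems)
  have "sup_norm g1 \<le> ennreal s" by (rule Linfty_le) (auto intro: ennreal_leI g1)
  then have g1X: "g1 \<in> elems X1" and n1: "fnorm X1 g1 \<le> s"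
    using s(1) by (auto simp: X1_elems Linfty_def intro: order_le_less_trans enn2real_leI)
  have "ennreal (fnorm X0 g0 + s * t) \<le> ennreal (J g t)"
    using le s t X0_norm_nonneg by (simp add: X0_norm[OF g0X] ennreal_mult)
  then have "fnorm X0 g0 + s * t \<le> J g t" using lia.primitive_nonneg by (simp add: ennreal_le_iff)
  moreover have "t * fnorm X1 g1 \<le> s * t" using n1 t by (simp add: mult.commute)
  moreover have "K_functional M X0 X1 g t \<le> fnorm X0 g0 + t * fnorm X1 g1"
    unfolding K_functional_def
  proof (rule cInf_lower)
    show "fnorm X0 g0 + t * fnorm X1 g1 \<in> {fnorm X0 f0 + t * fnorm X1 f1 |f0 f1. f0 \<in> elems X0 \<and> f1 \<in> elems X1 \<and> (AE u in M. f0 u + f1 u = g u)}"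
      by (rule CollectI, rule exI[of _ g0], rule exI[of _ g1]) (use g0X g1X in \<open>auto simp: g0_def\<close>)
    show "bdd_below {fnorm X0 f0 + t * fnorm X1 f1 |f0 f1. f0 \<in> elems X0 \<and> f1 \<in> elems X1 \<and> (AE u in M. f0 u + f1 u = g u)}"
      using t X0_norm_nonneg X1_norm_nonneg by (intro bdd_belowI[of _ 0]) auto
  qed
  ultimately show ?thesis by linarith
qed

end

section \<open>Constructing the contraction\<close>

lemma ennreal_le_rat:
  fixes x y :: ennreal
  assumes "\<And>q::rat. 0 \<le> q \<Longrightarrow> ennreal (of_rat q) < x \<Longrightarrow> ennreal (of_rat q) \<le> y"
  shows "x \<le> y"
proof (rule ccontr)
  assume "\<not> x \<le> y"
  then obtain r :: rat where r: "y < ennreal (of_rat r)" "ennreal (of_rat r) < x"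
    using ennreal_rat_dense[of y x] by (metis not_le)
  have "0 < ennreal (of_rat r)" using r(1) by (rule le_less_trans[rotated]) simp
  then have "0 \<le> r" by (simp add: ennreal_less_zero_iff)
  from leD[OF assms[OF this r(2)]] r(1) show False by (rule notE)
qed

context core_space
begin

text \<open>Rational superlevel sets recover \<open>F\<close>; the intersection with the exhausting sequence \<open>E\<close> makes their measure finite.\<close>

definition level_cover :: "('a \<Rightarrow> ennreal) \<Rightarrow> (nat \<Rightarrow> 'a set) \<Rightarrow> 'a set set" where
  "level_cover F E = insert {} (range E \<union> range (\<lambda>(q::rat, n). {u\<in>space M. ennreal (of_rat q) < F u} \<inter> E n))"

lemma level_cover_chain_cover:
  assumes F: "F \<in> core_decreasing M \<A>" and E: "range E \<subseteq> \<A>" "(\<Union>n. E n) = space M"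
  shows "chain_cover M \<A> (level_cover F E)"
proof
  show "countable (level_cover F E)" unfolding level_cover_def by (intro countable_insert countable_Un countable_image) auto
  have En: "down_set (E n)" "emeasure M (E n) < \<infinity>" for n
    using E core_finite[of "E n"] by (auto intro: down_set_core)
  have fin: "emeasure M ({u\<in>space M. c < F u} \<inter> E n) < \<infinity>" for c n
  proof -
    have "emeasure M ({u\<in>space M. c < F u} \<inter> E n) \<le> emeasure M (E n)"
      by (rule emeasure_mono) (use down_set_sets[OF En(1)] in auto)
    then show ?thesis using En(2) by (rule order_le_less_trans)
  qed
  show "down_set A" if "A \<in> level_cover F E" for A
    using that En(1) down_set_Int[OF down_set_superlevel[OF F] En(1)]
    by (auto simp: level_cover_def down_set_def[of "{}"])
  show "emeasure M A < \<infinity>" if "A \<in> level_cover F E" for A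
    using that En(2) fin by (auto simp: level_cover_def)
  show "{} \<in> level_cover F E" by (simp add: level_cover_def)
  show "\<Union>(level_cover F E) = space M" using E(2) by (auto simp: level_cover_def)
qed

text \<open>The dominant for the Hahn-Banach argument.  The operator on concave functions and the chain are both
  chosen for the given \<open>f\<close> and \<open>g\<close>; the integral, supremum and sublinearity properties hold for any choice.\<close>

theorem sublinear_dominant:
  assumes f: "f \<in> X" and g: "g \<in> X" and le: "\<And>t. 0 < t \<Longrightarrow> J f t \<le> J g t"
  shows "\<exists>P. (\<forall>h\<in>X. P h \<in> core_decreasing M \<A> \<and> (\<integral>\<^sup>+u. P h u \<partial>M) \<le> tilde_norm h \<and> (AE u in M. P h u \<le> sup_norm h)) \<and>
    (\<forall>h\<in>X. \<forall>h1\<in>X. \<forall>h2\<in>X. \<forall>\<alpha>\<ge>0. \<forall>\<beta>\<ge>0. (AE u in M. \<bar>h u\<bar> \<le> \<alpha> * \<bar>h1 u\<bar> + \<beta> * \<bar>h2 u\<bar>) \<longrightarrow>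
       (AE u in M. P h u \<le> ennreal \<alpha> * P h1 u + ennreal \<beta> * P h2 u)) \<and>
    (AE u in M. ennreal \<bar>f u\<bar> \<le> P g u)"
proof -
  note lia = \<eta>_locally_integrable
  interpret F: locally_integrable_antitone "\<eta> f" by (rule lia[OF f])
  interpret G: locally_integrable_antitone "\<eta> g" by (rule lia[OF g])
  have cone: "J h \<in> concave_cone" if "h \<in> X" for h
    by (rule locally_integrable_antitone.primitive_cone[OF lia[OF that]])
  \<comment> \<open>The limit at infinity of the rearrangement of the majorant of \<open>g\<close>.\<close>
  define \<gamma> where "\<gamma> = (INF x\<in>{0<..}. enn2real (\<eta> g x))"
  have bdd: "bdd_below ((\<lambda>x. enn2real (\<eta> g x)) ` {0<..})" by (intro bdd_belowI[of _ 0]) auto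
  have \<gamma>: "\<gamma> \<ge> 0" unfolding \<gamma>_def by (intro cINF_greatest) auto
  have \<gamma>_le: "ennreal \<gamma> \<le> \<eta> g x" if "0 < x" for x
  proof -
    have "\<gamma> \<le> enn2real (\<eta> g x)" unfolding \<gamma>_def using that by (intro cINF_lower bdd) auto
    then have "ennreal \<gamma> \<le> ennreal (enn2real (\<eta> g x))" by (rule ennreal_leI)
    then show ?thesis using G.finite[OF that] by simp
  qed
  have "\<exists>ab. (\<forall>n. 0 \<le> fst (ab n)) \<and>
    (\<forall>r m s. 0 \<le> r \<longrightarrow> r < m \<longrightarrow> (\<forall>x. 0 < x \<longrightarrow> x < m \<longrightarrow> s \<le> enn2real (\<eta> f x)) \<longrightarrow>
       s * (m - r) \<le> chop_limit ab (J g) m - chop_limit ab (J g) r)"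
  proof (rule chop_sequence_exists)
    show "J f t \<le> J g t" if "0 \<le> t" for t
      using le[of t] that F.primitive_0 G.primitive_0 by (cases "t = 0") auto
    show "mono_on {0..} (\<lambda>t. J g t - \<gamma> * t)"
    proof (rule mono_onI)
      fix s t :: real assume st: "s \<in> {0..}" "t \<in> {0..}" "s \<le> t"
      then have "\<gamma> * (t - s) \<le> J g t - J g s"
        by (intro G.primitive_diff_ge \<gamma> \<gamma>_le) auto
      then show "J g s - \<gamma> * s \<le> J g t - \<gamma> * t" by (simp add: right_diff_distrib)
    qed
    show "\<exists>c'<c. \<exists>e. \<forall>t\<ge>0. J g t \<le> e + c' * t" if c: "\<gamma> < c" for c
    proof -
      obtain x where x: "0 < x" "enn2real (\<eta> g x) < c"
        using c cINF_less_iff[OF _ bdd, of c] unfolding \<gamma>_def by auto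
      have "J g t \<le> (J g x - enn2real (\<eta> g x) * x) + enn2real (\<eta> g x) * t" if "0 \<le> t" for t
        using G.primitive_supergradient[OF x(1) that] by (simp add: algebra_simps)
      then show ?thesis using x(2) by blast
    qed
  qed (use cone f g F.primitive_continuous G.primitive_continuous F.primitive_supergradient \<gamma> in auto)
  then obtain ab where ab: "\<And>n. 0 \<le> fst (ab n)"
    and ab_ge: "\<And>r m s. 0 \<le> r \<Longrightarrow> r < m \<Longrightarrow> (\<And>x. 0 < x \<Longrightarrow> x < m \<Longrightarrow> s \<le> enn2real (\<eta> f x)) \<Longrightarrow>
       s * (m - r) \<le> chop_limit ab (J g) m - chop_limit ab (J g) r"
    by blast
  define K where "K h = chop_limit ab (J h)" for h
  have K_mono: "mono_on {0..} (K h)" and K_slopes: "antitone_slopes (K h)" and K_0: "K h 0 = 0"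
    and K_le: "\<And>t. 0 \<le> t \<Longrightarrow> K h t \<le> J h t" if "h \<in> X" for h
    unfolding K_def
    using chop_limit_mono[of ab, OF ab cone[OF that]] chop_limit_antitone_slopes[of ab, OF ab cone[OF that]]
      chop_limit_0[of ab, OF ab cone[OF that]] chop_limit_le[of ab, OF ab cone[OF that]] by auto
  have [measurable]: "f \<in> borel_measurable M" "g \<in> borel_measurable M" using f g by (auto intro: X_measurable)
  obtain E :: "nat \<Rightarrow> 'a set" where E: "range E \<subseteq> \<A>" "(\<Union>n. E n) = space M" by (rule exhausting_core)
  interpret chain_cover M \<A> "level_cover (tilde f) E"
    by (rule level_cover_chain_cover[OF tilde_core_decreasing E]) measurable
  define P where "P h = transport (K h)" for h
  have P_core: "P h \<in> core_decreasing M \<A>" if "h \<in> X" for h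
    unfolding P_def by (rule transport_core_decreasing[OF K_mono K_slopes]) fact+
  have P_int: "(\<integral>\<^sup>+u. P h u \<partial>M) \<le> tilde_norm h" if h: "h \<in> X" for h
    unfolding P_def
  proof (rule transport_integral[OF K_mono[OF h] K_slopes[OF h] K_0[OF h]])
    fix m :: real assume "0 \<le> m"
    then have "ennreal (K h m) \<le> ennreal (J h m)" by (intro ennreal_leI K_le h)
    also have "\<dots> \<le> tilde_norm h" by (rule J_le_integral[OF h])
    finally show "ennreal (K h m) \<le> tilde_norm h" .
  qed
  have P_sup: "AE u in M. P h u \<le> sup_norm h" if h: "h \<in> X" for h
  proof (cases "sup_norm h < \<infinity>")
    case True
    then have hX1: "h \<in> elems X1" using X_measurable[OF h] by (simp add: X1_elems)
    define c where "c = fnorm X1 h"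
    have c: "0 \<le> c" "ennreal c = sup_norm h" using X1_norm[OF hX1] X1_norm_nonneg by (auto simp: c_def)
    have "\<eta> h x \<le> ennreal c" for x
    proof -
      have "\<eta> h x \<le> \<eta> (\<lambda>u. 0) x + ennreal c"
        unfolding c_def by (rule \<eta>_decompose[OF X_measurable[OF h] X0_zero hX1]) simp
      moreover have "\<eta> (\<lambda>u. 0) x \<le> 0 * rearrangement M (\<lambda>u. 0) x + 0 * rearrangement M (\<lambda>u. 0) x"
      proof (rule rearrangement_sublinear[OF tilde_core_decreasing core_decreasing_const core_decreasing_const])
        show "AE u in M. tilde (\<lambda>u. 0) u \<le> 0 * 0 + 0 * 0"
          using tilde_least[OF _ core_decreasing_const[of 0], of "\<lambda>u. 0"] by simp
      qed simp
      ultimately show ?thesis by simp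
    qed
    then have "mono_on {0..} (\<lambda>t. c * t + (-1) * J h t)"
      using locally_integrable_antitone.primitive_diff_le[OF lia[OF h], of _ _ c] c(1)
      by (intro mono_onI) (auto simp: right_diff_distrib algebra_simps)
    then have "mono_on {0..} (\<lambda>t. c * t + (-1) * K h t)"
      unfolding K_def by (intro chop_limit_lipschitz ab cone h)
    then have "mono_on {0..} (\<lambda>t. c * t - K h t)" by simp
    then have "P h u \<le> sup_norm h" if "u \<in> space M" for u
      unfolding P_def c(2)[symmetric] using that c(1) by (intro transport_lipschitz) auto
    then show ?thesis by (intro AE_I2)
  next
    case False
    then have "sup_norm h = top" by (metis infinity_ennreal_def top.not_eq_extremum)
    then show ?thesis by simp
  qed
  have P_sublinear: "AE u in M. P h u \<le> ennreal \<alpha> * P h1 u + ennreal \<beta> * P h2 u"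
    if h: "h \<in> X" "h1 \<in> X" "h2 \<in> X" and nonneg: "0 \<le> \<alpha>" "0 \<le> \<beta>"
      and le: "AE u in M. \<bar>h u\<bar> \<le> \<alpha> * \<bar>h1 u\<bar> + \<beta> * \<bar>h2 u\<bar>" for h h1 h2 \<alpha> \<beta>
  proof -
    note m = h[THEN X_measurable]
    have "\<eta> h x \<le> ennreal \<alpha> * \<eta> h1 x + ennreal \<beta> * \<eta> h2 x" for x
      by (intro rearrangement_sublinear tilde_core_decreasing tilde_sublinear m nonneg le)
    then have "mono_on {0..} (\<lambda>t. \<alpha> * J h1 t + \<beta> * J h2 t - J h t)"
      by (intro primitive_sublinear lia h nonneg)
    then have "mono_on {0..} (\<lambda>t. \<alpha> * K h1 t + \<beta> * K h2 t - K h t)"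
      unfolding K_def by (intro chop_limit_sublinear ab cone h)
    then show ?thesis
      unfolding P_def by (intro AE_I2 transport_sublinear K_mono h nonneg)
  qed
  \<comment> \<open>On a superlevel set of the majorant of \<open>f\<close> at a rational height \<open>q\<close>, the rearrangement is at least \<open>q\<close> up to the
    measure of the set; hence the slopes of \<open>K g\<close> are at least \<open>q\<close> there, and so is \<open>P g\<close>.\<close>
  have P_dominates: "AE u in M. ennreal \<bar>f u\<bar> \<le> P g u"
  proof -
    define D where "D q n = {u\<in>space M. ennreal (of_rat q) < tilde f u} \<inter> E n" for q :: rat and n
    have D: "D q n \<in> level_cover (tilde f) E" for q n by (auto simp: D_def level_cover_def)
    have "AE u in M. u \<in> D q n \<longrightarrow> ennreal (of_rat q) \<le> P g u" if q: "0 \<le> q" for q n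
      unfolding P_def
    proof (rule transport_ge[OF D])
      fix r assume r: "0 \<le> r" "r < measure M (D q n)"
      have "of_rat q \<le> enn2real (\<eta> f x)" if x: "0 < x" "x < measure M (D q n)" for x
      proof -
        have "ennreal x < ennreal (measure M (D q n))" using x by (simp add: ennreal_less_iff)
        also have "\<dots> = emeasure M (D q n)" using \<Q>_emeasure[OF D] by simp
        also have "\<dots> \<le> emeasure M {u\<in>space M. ennreal (of_rat q) < tilde f u}"
          by (rule emeasure_mono) (auto simp: D_def)
        finally have "ennreal (of_rat q) < \<eta> f x" by (subst less_rearrangement_iff) auto
        then have "enn2real (ennreal (of_rat q)) \<le> enn2real (\<eta> f x)"
          using F.finite[OF x(1)] by (intro enn2real_mono) auto
        then show ?thesis using q by simp
      qed
      then show "of_rat q * (measure M (D q n) - r) \<le> K g (measure M (D q n)) - K g r"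
        unfolding K_def by (rule ab_ge[OF r])
    qed
    then have "AE u in M. \<forall>q n. 0 \<le> q \<longrightarrow> u \<in> D q n \<longrightarrow> ennreal (of_rat q) \<le> P g u"
      unfolding AE_all_countable by auto
    moreover have "AE u in M. ennreal \<bar>f u\<bar> \<le> tilde f u" by (rule tilde_majorant) measurable
    ultimately show ?thesis using AE_space
    proof eventually_elim
      case (elim u)
      have "u \<in> (\<Union>n. E n)" unfolding E(2) by (rule elim(3))
      then obtain n where n: "u \<in> E n" by (rule UN_E)
      have "tilde f u \<le> P g u"
      proof (rule ennreal_le_rat)
        fix q :: rat assume q: "0 \<le> q" "ennreal (of_rat q) < tilde f u"
        have "u \<in> D q n" unfolding D_def using n q(2) elim(3) by (intro IntI CollectI conjI)
        with elim(1) q(1) show "ennreal (of_rat q) \<le> P g u" by (elim allE[of _ q] allE[of _ n] impE)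
      qed
      with elim(2) show ?case by (rule order_trans)
    qed
  qed
  show ?thesis
    by (rule exI[of _ P]) (use P_core P_int P_sup P_sublinear P_dominates in blast)
qed

text \<open>The domination \<open>\<bar>T h\<bar> \<le> P h\<close> follows from the one-sided bound applied to \<open>h\<close> and \<open>- h\<close>.\<close>

theorem exact_Calderon: "exact_Calderon_couple M X0 X1"
  unfolding exact_Calderon_couple_def
proof (intro conjI ballI impI)
  show "compatible_couple M X0 X1" by (rule compatible)
next
  fix f g assume f: "f \<in> X" and g: "g \<in> X"
    and K: "\<forall>t>0. K_functional M X0 X1 f t \<le> K_functional M X0 X1 g t"
  have "J f t \<le> J g t" if "0 < t" for t
    using J_le_K[OF f that] K_le_J[OF g that] K that by force
  from sublinear_dominant[OF f g this] obtain P
    where P_core: "\<And>h. h \<in> X \<Longrightarrow> P h \<in> core_decreasing M \<A>"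
    and P_int: "\<And>h. h \<in> X \<Longrightarrow> (\<integral>\<^sup>+u. P h u \<partial>M) \<le> tilde_norm h"
    and P_sup: "\<And>h. h \<in> X \<Longrightarrow> (AE u in M. P h u \<le> sup_norm h)"
    and P_sublinear: "\<And>h h1 h2 \<alpha> \<beta>. h \<in> X \<Longrightarrow> h1 \<in> X \<Longrightarrow> h2 \<in> X \<Longrightarrow> 0 \<le> \<alpha> \<Longrightarrow> 0 \<le> \<beta> \<Longrightarrow>
       (AE u in M. \<bar>h u\<bar> \<le> \<alpha> * \<bar>h1 u\<bar> + \<beta> * \<bar>h2 u\<bar>) \<Longrightarrow>
       (AE u in M. P h u \<le> ennreal \<alpha> * P h1 u + ennreal \<beta> * P h2 u)"
    and P_dominates: "AE u in M. ennreal \<bar>f u\<bar> \<le> P g u" by blast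
  \<comment> \<open>The Hahn-Banach theorem takes a real-valued dominant.\<close>
  have P_finite: "AE u in M. P h u < top" if h: "h \<in> X" for h
  proof -
    obtain h0 h1 where h01: "h0 \<in> elems X0" "h1 \<in> elems X1" "AE u in M. h0 u + h1 u = h u"
      by (rule X_decompose[OF h])
    note hX = X0_subset[OF h01(1)] X1_subset[OF h01(2)]
    have "AE u in M. \<bar>h u\<bar> \<le> 1 * \<bar>h0 u\<bar> + 1 * \<bar>h1 u\<bar>"
      using h01(3) by eventually_elim linarith
    then have "AE u in M. P h u \<le> ennreal 1 * P h0 u + ennreal 1 * P h1 u"
      by (intro P_sublinear h hX) auto
    moreover have "AE u in M. P h0 u \<noteq> \<infinity>"
      using P_int[OF hX(1)] h01(1)
      by (intro nn_integral_PInf_AE core_decreasing_measurable P_core hX) (auto simp: X0_elems top_unique)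
    moreover have "AE u in M. P h1 u < top"
      using P_sup[OF hX(2)] h01(2) by (auto simp: X1_elems elim!: eventually_mono intro: order_le_less_trans)
    ultimately show ?thesis
    proof eventually_elim
      case (elim u)
      note elim(1)
      also have "ennreal 1 * P h0 u + ennreal 1 * P h1 u < top" using elim(2,3) by (simp add: less_top)
      finally show ?case .
    qed
  qed
  define p where "p h u = enn2real (P h u)" for h u
  have p_sublinear: "AE u in M. p h u \<le> \<alpha> * p h1 u + \<beta> * p h2 u"
    if h: "h \<in> X" "h1 \<in> X" "h2 \<in> X" and nonneg: "0 \<le> \<alpha>" "0 \<le> \<beta>"
      and le: "AE u in M. \<bar>h u\<bar> \<le> \<alpha> * \<bar>h1 u\<bar> + \<beta> * \<bar>h2 u\<bar>" for h h1 h2 \<alpha> \<beta>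
    using P_sublinear[OF h nonneg le] P_finite[OF h(2)] P_finite[OF h(3)]
  proof eventually_elim
    case (elim u)
    have fin: "ennreal \<alpha> * P h1 u < top" "ennreal \<beta> * P h2 u < top"
      using elim(2,3) by (auto simp: ennreal_mult_less_top)
    have "p h u \<le> enn2real (ennreal \<alpha> * P h1 u + ennreal \<beta> * P h2 u)"
      unfolding p_def using elim(1) fin by (intro enn2real_mono) auto
    also have "\<dots> = \<alpha> * p h1 u + \<beta> * p h2 u"
      using fin nonneg by (simp add: enn2real_plus enn2real_mult p_def)
    finally show ?case .
  qed
  have p_nonneg: "0 \<le> p h u" for h u by (simp add: p_def)
  have p_meas: "p h \<in> borel_measurable M" if "h \<in> X" for h
    using core_decreasing_measurable[OF P_core[OF that]] unfolding p_def by measurable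
  have p_scale: "AE u in M. p (\<lambda>v. c * h v) u \<le> \<bar>c\<bar> * p h u" if h: "h \<in> X" for h c
    using p_sublinear[of "\<lambda>v. c * h v" h h "\<bar>c\<bar>" 0] h X_scale by (simp add: abs_mult)
  have fp: "AE u in M. c * f u \<le> p (\<lambda>v. c * g v) u" for c
  proof (cases "c = 0")
    case True
    then show ?thesis by (simp add: p_nonneg)
  next
    case False
    have "AE u in M. p (\<lambda>v. (1/c) * (c * g v)) u \<le> \<bar>1/c\<bar> * p (\<lambda>v. c * g v) u"
      by (intro p_scale X_scale g)
    then show ?thesis using P_dominates P_finite[OF g]
    proof eventually_elim
      case (elim u)
      have "ennreal \<bar>f u\<bar> \<le> ennreal (p g u)" using elim(2,3) by (simp add: p_def)
      then have "\<bar>f u\<bar> \<le> p g u" using p_nonneg by (simp add: ennreal_le_iff)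
      also have "\<dots> \<le> (1 / \<bar>c\<bar>) * p (\<lambda>v. c * g v) u" using elim(1) False by simp
      finally have "\<bar>c\<bar> * \<bar>f u\<bar> \<le> p (\<lambda>v. c * g v) u" using False by (simp add: field_simps)
      then show ?case by (simp add: abs_mult[symmetric])
    qed
  qed
  have "\<exists>T. (\<forall>h\<in>X. T h \<in> borel_measurable M \<and> (AE u in M. T h u \<le> p h u)) \<and>
    (\<forall>h\<in>X. \<forall>h'\<in>X. AE u in M. T (\<lambda>v. h v + h' v) u = T h u + T h' u) \<and>
    (\<forall>h\<in>X. \<forall>c. AE u in M. T (\<lambda>v. c * h v) u = c * T h u) \<and>
    (\<forall>h\<in>X. \<forall>h'\<in>X. (AE u in M. h u = h' u) \<longrightarrow> (AE u in M. T h u = T h' u)) \<and>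
    (AE u in M. T g u = f u)"
  proof (rule hahn_banach_measurable)
    show "AE u in M. p (\<lambda>v. h v + h' v) u \<le> p h u + p h' u" if "h \<in> X" "h' \<in> X" for h h'
      using p_sublinear[of "\<lambda>v. h v + h' v" h h' 1 1] X_add that by simp
    show "AE u in M. p (\<lambda>v. c * h v) u \<le> c * p h u" if "h \<in> X" "c > 0" for h c
      using p_scale[OF that(1), of c] that(2) by simp
    show "AE u in M. p h u \<le> 0" if "h \<in> X" "AE u in M. h u = 0" for h
      using p_sublinear[of h h h 0 0] that by simp
  qed (use X_add X_scale p_meas g fp X_measurable[OF f] in auto)
  then obtain T where T_meas: "\<And>h. h \<in> X \<Longrightarrow> T h \<in> borel_measurable M"
    and T_le: "\<And>h. h \<in> X \<Longrightarrow> AE u in M. T h u \<le> p h u"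
    and T_add: "\<And>h h'. h \<in> X \<Longrightarrow> h' \<in> X \<Longrightarrow> AE u in M. T (\<lambda>v. h v + h' v) u = T h u + T h' u"
    and T_scale: "\<And>h c. h \<in> X \<Longrightarrow> AE u in M. T (\<lambda>v. c * h v) u = c * T h u"
    and T_cong: "\<And>h h'. h \<in> X \<Longrightarrow> h' \<in> X \<Longrightarrow> (AE u in M. h u = h' u) \<Longrightarrow> AE u in M. T h u = T h' u"
    and T_g: "AE u in M. T g u = f u"
    by blast
  have T_abs: "AE u in M. ennreal \<bar>T h u\<bar> \<le> P h u" if h: "h \<in> X" for h
    using T_le[OF h] T_le[OF X_scale[OF h, of "-1"]] T_scale[OF h, of "-1"] p_scale[OF h, of "-1"] P_finite[OF h]
  proof eventually_elim
    case (elim u)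
    then have "\<bar>T h u\<bar> \<le> p h u" by auto
    then have "ennreal \<bar>T h u\<bar> \<le> ennreal (p h u)" by (rule ennreal_leI)
    then show ?case using elim(5) by (simp add: p_def)
  qed
  have T0: "T h \<in> elems X0 \<and> fnorm X0 (T h) \<le> fnorm X0 h" if h: "h \<in> elems X0" for h
  proof -
    note hX = X0_subset[OF h]
    have "AE u in M. tilde (T h) u \<le> P h u" by (rule tilde_least[OF T_meas[OF hX] P_core[OF hX] T_abs[OF hX]])
    then have "tilde_norm (T h) \<le> (\<integral>\<^sup>+u. P h u \<partial>M)" by (rule nn_integral_mono_AE)
    also have "\<dots> \<le> tilde_norm h" by (rule P_int[OF hX])
    finally have le: "tilde_norm (T h) \<le> tilde_norm h" .
    then have Th: "T h \<in> elems X0" using h T_meas[OF hX] by (auto simp: X0_elems intro: order_le_less_trans)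
    have "ennreal (fnorm X0 (T h)) \<le> ennreal (fnorm X0 h)" using le by (simp add: X0_norm h Th)
    then show ?thesis using Th X0_norm_nonneg by (simp add: ennreal_le_iff)
  qed
  have T1: "T h \<in> elems X1 \<and> fnorm X1 (T h) \<le> fnorm X1 h" if h: "h \<in> elems X1" for h
  proof -
    note hX = X1_subset[OF h]
    have "AE u in M. ennreal \<bar>T h u\<bar> \<le> sup_norm h"
      using T_abs[OF hX] P_sup[OF hX] by eventually_elim (rule order_trans)
    then have le: "sup_norm (T h) \<le> sup_norm h" by (rule Linfty_le[OF T_meas[OF hX]])
    then have Th: "T h \<in> elems X1" using h T_meas[OF hX] by (auto simp: X1_elems intro: order_le_less_trans)
    have "ennreal (fnorm X1 (T h)) \<le> ennreal (fnorm X1 h)" using le by (simp add: X1_norm h Th)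
    then show ?thesis using Th X1_norm_nonneg by (simp add: ennreal_le_iff)
  qed
  have TX: "T h \<in> X" if h: "h \<in> X" for h
  proof -
    obtain h0 h1 where h01: "h0 \<in> elems X0" "h1 \<in> elems X1" "AE u in M. h0 u + h1 u = h u"
      by (rule X_decompose[OF h])
    note hX = X0_subset[OF h01(1)] X1_subset[OF h01(2)]
    have "AE u in M. T (\<lambda>v. h0 v + h1 v) u = T h u" by (rule T_cong[OF X_add[OF hX] h h01(3)])
    then have "AE u in M. T h0 u + T h1 u = T h u"
      using T_add[OF hX] by eventually_elim simp
    then show ?thesis using T0[OF h01(1)] T1[OF h01(2)] T_meas[OF h] by (auto simp: couple_sum_def)
  qed
  have "admissible_contraction M X0 X1 T"
    unfolding admissible_contraction_def using TX T_cong T_add T_scale T0 T1 by blast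
  then show "\<exists>T. admissible_contraction M X0 X1 T \<and> (AE u in M. T g u = f u)" using T_g by blast
qed

end

theorem theorem8p7:
  fixes M :: "'a measure" and \<A> :: "'a set set"
  assumes "sigma_finite_measure M"
    and "full_ordered_core M \<A>"
  shows "exact_Calderon_couple M (L1_tilde M \<A>) (Linfty M)"
proof -
  interpret core_space M \<A>
    by (intro core_space.intro core_space_axioms.intro assms)
  show ?thesis by (rule exact_Calderon)
qed

end
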